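(* Consider a sequential fragmentation of $(0,1)$ in which at each step the current largest subinterval is split into $b\ge2$ pieces by $b-1$ random division points whose positions, rescaled to the unit interval, have a fixed law (the same at every step, independently of the past). Let $F(x)$ be the expected number of pieces of length $<x$ when $(0,1)$ is split according to this law, and assume $F$ is uniformly continuous on $(0,1)$, differentiable, with $F'$ uniformly positive. Then the spacing distribution of the process is stationary if and only if the mean spacing of the process is stationary.
   Context: After $n$ splits there are $N=n(b-1)+1$ spacings; let $L_n$ denote the length of the current largest spacing, which is used as the unit of length. The normalized empirical spacing distribution is $u_n(x)=\frac1N\#\{\text{spacings of length}\le xL_n\}$, $x\in[0,1]$. The spacing distribution is called stationary if $u_n$ converges (with high probability, uniformly in $x$) to a limiting function as $n\to\infty$. The mean spacing is called stationary if the mean normalized spacing within $(0,y)$, namely $y/(L_n\cdot\#\{\text{spacings contained in }(0,y)\})$, converges as $n\to\infty$ to the same value for every $y\in(0,1]$ (equivalently, the empirical distribution of the division points is asymptotically uniform on $(0,1)$). *)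

theory Defs
  imports "HOL-Probability.Probability"
begin

text \<open>A division vector v :: nat => real lists the b-1 division points v 0, ..., v (b-2),
  rescaled to the unit interval. The resulting piece lengths (as fractions of the split
  interval), in left-to-right order:\<close>
definition pieces :: "nat \<Rightarrow> (nat \<Rightarrow> real) \<Rightarrow> real list" where
  "pieces b v = (let ps = sort (map v [0..<b - 1]) in
      map2 (\<lambda>x y. y - x) (0 # ps) (ps @ [1]))"

text \<open>State = list of spacing lengths in left-to-right order. The largest spacing
  (leftmost one in case of ties) is replaced by its pieces.\<close>
definition split_max :: "real list \<Rightarrow> real list \<Rightarrow> real list" where
  "split_max s q = (let i = (LEAST i. i < length s \<and> s ! i = Max (set s)) in
      take i s @ map (\<lambda>r. (s ! i) * r) q @ drop (Suc i) s)"

fun frag_state :: "nat \<Rightarrow> (nat \<Rightarrow> nat \<Rightarrow> real) \<Rightarrow> nat \<Rightarrow> real list" where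
  "frag_state b \<omega> 0 = [1]"
| "frag_state b \<omega> (Suc n) = split_max (frag_state b \<omega> n) (pieces b (\<omega> n))"

definition largest :: "nat \<Rightarrow> (nat \<Rightarrow> nat \<Rightarrow> real) \<Rightarrow> nat \<Rightarrow> real" where
  "largest b \<omega> n = Max (set (frag_state b \<omega> n))"

definition spacing_distr :: "nat \<Rightarrow> (nat \<Rightarrow> nat \<Rightarrow> real) \<Rightarrow> nat \<Rightarrow> real \<Rightarrow> real" where
  "spacing_distr b \<omega> n x =
     real (length (filter (\<lambda>l. l \<le> x * largest b \<omega> n) (frag_state b \<omega> n)))
     / real (length (frag_state b \<omega> n))"

text \<open>Number of spacings contained in (0,y): the k-th spacing (k>=1) is the interval
  (sum of first k-1 lengths, sum of first k lengths).\<close>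
definition count_in :: "real list \<Rightarrow> real \<Rightarrow> nat" where
  "count_in s y = card {k. 1 \<le> k \<and> k \<le> length s \<and> sum_list (take k s) \<le> y}"

definition mean_spacing :: "nat \<Rightarrow> (nat \<Rightarrow> nat \<Rightarrow> real) \<Rightarrow> nat \<Rightarrow> real \<Rightarrow> real" where
  "mean_spacing b \<omega> n y =
     y / (largest b \<omega> n * real (count_in (frag_state b \<omega> n) y))"

text \<open>Q n holds with high probability as n tends to infinity (phrased via measurable
  events, so no measurability side conditions are hidden).\<close>
definition whp :: "'a measure \<Rightarrow> (nat \<Rightarrow> 'a \<Rightarrow> bool) \<Rightarrow> bool" where
  "whp P Q \<longleftrightarrow> (\<forall>\<delta>>0. \<exists>N. \<forall>n\<ge>N. \<exists>A\<in>sets P. measure P A \<ge> 1 - \<delta> \<and> (\<forall>\<omega>\<in>A. Q n \<omega>))"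

definition spacing_stationary :: "nat \<Rightarrow> (nat \<Rightarrow> nat \<Rightarrow> real) measure \<Rightarrow> bool" where
  "spacing_stationary b P \<longleftrightarrow> (\<exists>u :: real \<Rightarrow> real. \<forall>\<epsilon>>0.
     whp P (\<lambda>n \<omega>. \<forall>x\<in>{0..1}. \<bar>spacing_distr b \<omega> n x - u x\<bar> \<le> \<epsilon>))"

definition mean_stationary :: "nat \<Rightarrow> (nat \<Rightarrow> nat \<Rightarrow> real) measure \<Rightarrow> bool" where
  "mean_stationary b P \<longleftrightarrow> (\<exists>c :: real. \<forall>y\<in>{0<..1}. \<forall>\<epsilon>>0.
     whp P (\<lambda>n \<omega>. \<bar>mean_spacing b \<omega> n y - c\<bar> \<le> \<epsilon>))"

definition exp_pieces :: "nat \<Rightarrow> (nat \<Rightarrow> real) measure \<Rightarrow> real \<Rightarrow> real" where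
  "exp_pieces b D x = (\<integral>v. real (length (filter (\<lambda>p. p < x) (pieces b v))) \<partial>D)"

end

theory Submission
  imports Defs "HOL-Library.More_List"
begin

text \<open>
  Write \<open>L\<^sub>n\<close> for the largest spacing and \<open>N\<^sub>n\<close> for the number of spacings after \<open>n\<close> splits. Both notions
  of stationarity are equivalent to \<open>1 / (L\<^sub>n N\<^sub>n) \<rightarrow> c\<close> in probability for some \<open>c > 0\<close>.

  If this holds then \<open>L\<^sub>n / L\<^sub>k\<close> is close to \<open>k / n\<close>. A piece of length at most \<open>x L\<^sub>n\<close> with \<open>x < 1\<close> is never
  split again, so the number of such spacings is the sum over \<open>k < n\<close> of the number of relative pieces
  of length at most \<open>x L\<^sub>n / L\<^sub>k\<close> in the \<open>k\<close>-th split; a uniform law of large numbers then gives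
  \<open>u\<^sub>n(x) \<rightarrow> 1 / (b - 1) \<integral>\<^sub>0\<^sup>1 F(x s) ds\<close>.

  Conversely, \<open>1 / (L\<^sub>n N\<^sub>n)\<close> is the mean of \<open>u\<^sub>n\<close>, so it converges if \<open>u\<^sub>n\<close> does. Each spacing present at a
  fixed time then evolves in its own clock as a scaled copy of the whole process, and therefore ends up
  with at least its proportional share of the \<open>N\<^sub>n\<close> spacings. Since the shares add up to \<open>N\<^sub>n\<close>, the lower
  bounds on both sides of a point \<open>y\<close> force the number of spacings in \<open>(0, y)\<close> to be about \<open>y N\<^sub>n\<close>.
\<close>

section \<open>Splitting the largest spacing\<close>

text \<open>Neither notion of stationarity says outright that the limit \<open>c\<close> of
  \<open>1 / (L_n N_n)\<close> is positive, yet the later estimates divide by \<open>c\<close>.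
  Positivity comes from a potential: the splits up to time \<open>n\<close> consume a total defect
  of at most \<open>1 / L_n\<close>, while the law of large numbers makes that total grow linearly
  in \<open>n\<close>. Hence \<open>L_n\<close> is of order \<open>1 / n\<close>.

  The delicate point of the converse is the scaled copy. How often a given spacing and its
  descendants have been split by time \<open>n\<close> is random and depends on all other spacings,
  so the copy cannot be compared at a fixed number of splits. What can be shown is one-sided: if a
  block has received few splits although the whole mesh is already at most \<open>l\<close>, then
  its stand-alone copy reaches mesh \<open>l\<close> in few splits, which contradicts the known
  decay of \<open>L_r\<close>. As an inequality between probabilities this follows by induction over
  the first split. It bounds shares from below only, and for that reason conservation of the total
  number has to supply the upper bounds.\<close>

lemma split_max_eq:
  assumes "s = xs @ m # ys" "Max (set s) = m" "m \<notin> set xs"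
  shows "split_max s q = xs @ map ((*) m) q @ ys"
proof -
  have "(LEAST i. i < length s \<and> s ! i = Max (set s)) = length xs"
  proof (rule Least_equality)
    show "length xs < length s \<and> s ! length xs = Max (set s)"
      using assms(2) by (simp add: assms(1))
    show "length xs \<le> i" if "i < length s \<and> s ! i = Max (set s)" for i
    proof (rule ccontr)
      assume "\<not> length xs \<le> i"
      then have "s ! i \<in> set xs"
        by (simp add: assms(1) nth_append)
      then show False using that assms(2,3) by simp
    qed
  qed
  moreover have "s ! length xs = m" "take (length xs) s = xs" "drop (Suc (length xs)) s = ys"
    by (simp_all add: assms(1))
  ultimately show ?thesis
    unfolding split_max_def Let_def by simp
qed

text \<open>Replaces the \<open>LEAST\<close> index by a decomposition at the first maximum. Since
  \<open>xs\<close> and \<open>ys\<close> depend on \<open>s\<close> alone, one decomposition serves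
  every division \<open>q\<close>.\<close>

lemma split_max_cases:
  assumes "s \<noteq> []"
  obtains xs ys where "s = xs @ Max (set s) # ys" "Max (set s) \<notin> set xs"
    "\<And>q. split_max s q = xs @ map ((*) (Max (set s))) q @ ys"
proof -
  have "Max (set s) \<in> set s" using assms by simp
  then obtain xs ys where *: "s = xs @ Max (set s) # ys" "Max (set s) \<notin> set xs"
    using split_list_first by metis
  show thesis
    by (rule that[OF *]) (rule split_max_eq[OF *(1) refl *(2)])
qed

lemma length_split_max:
  assumes "s \<noteq> []"
  shows "length (split_max s q) + 1 = length s + length q"
proof -
  obtain xs ys where *: "s = xs @ Max (set s) # ys"
    "\<And>q. split_max s q = xs @ map ((*) (Max (set s))) q @ ys"
    using split_max_cases[OF assms] by metis
  show ?thesis unfolding *(2) using arg_cong[OF *(1), of length] by simp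
qed

lemma sum_list_split_max:
  assumes "s \<noteq> []" "sum_list q = 1"
  shows "sum_list (split_max s q) = sum_list s"
proof -
  obtain xs ys where *: "s = xs @ Max (set s) # ys"
    "\<And>q. split_max s q = xs @ map ((*) (Max (set s))) q @ ys"
    using split_max_cases[OF assms(1)] by metis
  show ?thesis
    unfolding *(2) using arg_cong[OF *(1), of sum_list] assms(2)
    by (simp add: sum_list_const_mult)
qed

lemma split_max_elem_cases:
  assumes "s \<noteq> []" "y \<in> set (split_max s q)"
  shows "y \<in> set s \<or> (\<exists>p\<in>set q. y = Max (set s) * p)"
proof -
  obtain xs ys where *: "s = xs @ Max (set s) # ys"
    "\<And>q. split_max s q = xs @ map ((*) (Max (set s))) q @ ys"
    using split_max_cases[OF assms(1)] by metis
  have "set (xs @ Max (set s) # ys) = set s"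
    using arg_cong[OF *(1), of set] by (rule sym)
  then have "set xs \<subseteq> set s" "set ys \<subseteq> set s"
    by auto
  then show ?thesis using assms(2) unfolding *(2) by auto
qed

lemma split_max_nonneg:
  assumes "s \<noteq> []" "\<forall>x\<in>set s. 0 \<le> x" "\<forall>p\<in>set q. 0 \<le> p" "y \<in> set (split_max s q)"
  shows "(0::real) \<le> y"
proof -
  have "Max (set s) \<in> set s" using assms(1) by simp
  then have "0 \<le> Max (set s)" using assms(2) by blast
  then show ?thesis
    using split_max_elem_cases[OF assms(1,4)] assms(2,3) by auto
qed

lemma split_max_le_Max:
  assumes "s \<noteq> []" "\<forall>x\<in>set s. 0 \<le> x" "\<forall>p\<in>set q. p \<le> 1" "y \<in> set (split_max s q)"
  shows "y \<le> Max (set s)"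
proof -
  have "Max (set s) \<in> set s" using assms(1) by simp
  then have "0 \<le> Max (set s)" using assms(2) by blast
  then show ?thesis
    using split_max_elem_cases[OF assms(1,4)] assms(3)
    by (auto intro: mult_left_le)
qed

text \<open>A positive factor preserves the position of the first maximum. This is the
  self-similarity of the process.\<close>

lemma split_max_scale:
  assumes "s \<noteq> []" "0 < (c::real)"
  shows "split_max (map ((*) c) s) q = map ((*) c) (split_max s q)"
proof -
  obtain xs ys where *: "s = xs @ Max (set s) # ys" "Max (set s) \<notin> set xs"
    "\<And>q. split_max s q = xs @ map ((*) (Max (set s))) q @ ys"
    using split_max_cases[OF assms(1)] by metis
  have M: "Max (set (map ((*) c) s)) = c * Max (set s)"
    unfolding set_map
    by (rule mono_Max_commute[symmetric]) (use assms in \<open>auto simp: mono_def\<close>)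
  have "split_max (map ((*) c) s) q
    = map ((*) c) xs @ map ((*) (c * Max (set s))) q @ map ((*) c) ys"
  proof (rule split_max_eq)
    show "map ((*) c) s = map ((*) c) xs @ (c * Max (set s)) # map ((*) c) ys"
      by (subst (1) *(1)) simp
    show "c * Max (set s) \<notin> set (map ((*) c) xs)" using *(2) assms(2) by auto
  qed (fact M)
  then show ?thesis unfolding *(3) by (simp add: mult.assoc)
qed

section \<open>Divisions of the unit interval and their pieces\<close>

definition valid_division :: "nat \<Rightarrow> (nat \<Rightarrow> real) \<Rightarrow> bool" where
  "valid_division b v \<longleftrightarrow> (\<forall>i<b - 1. v i \<in> {0<..<1})"

lemma length_pieces [simp]: "1 \<le> b \<Longrightarrow> length (pieces b v) = b"
  by (simp add: pieces_def Let_def)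

lemma sum_list_differences:
  "sum_list (map2 (\<lambda>x y. y - x) (a # ps) (ps @ [c])) = c - (a::real)"
  by (induction ps arbitrary: a) auto

lemma differences_nonneg:
  assumes "sorted (a # ps @ [c])"
    and "p \<in> set (map2 (\<lambda>x y. y - x) (a # ps) (ps @ [c]))"
  shows "(0::real) \<le> p"
  using assms
proof (induction ps arbitrary: a)
  case (Cons x ps)
  have "p = x - a \<or> p \<in> set (map2 (\<lambda>x y. y - x) (x # ps) (ps @ [c]))"
    using Cons.prems(2) by simp
  moreover have "a \<le> x" "sorted (x # ps @ [c])"
    using Cons.prems(1) by simp_all
  ultimately show ?case using Cons.IH by fastforce
qed simp

lemma sum_list_pieces: "sum_list (pieces b v) = 1"
  by (simp only: pieces_def Let_def sum_list_differences)

lemma pieces_nonneg: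
  assumes "valid_division b v" "p \<in> set (pieces b v)"
  shows "0 \<le> p"
proof (rule differences_nonneg)
  show "p \<in> set (map2 (\<lambda>x y. y - x) (0 # sort (map v [0..<b - 1])) (sort (map v [0..<b - 1]) @ [1]))"
    using assms(2) by (simp only: pieces_def Let_def)
  show "sorted (0 # sort (map v [0..<b - 1]) @ [1])"
    using assms(1) by (fastforce simp: sorted_append valid_division_def)
qed

lemma pieces_le_1:
  assumes "valid_division b v" "p \<in> set (pieces b v)"
  shows "p \<le> 1"
  using member_le_sum_list[OF assms(2)] pieces_nonneg[OF assms(1)] sum_list_pieces by simp

text \<open>Every piece has a division point at one of its ends: the first piece ends at a point
  below 1, any other begins at a point above 0. Points may coincide, so pieces of length 0 do occur
  and only the bound at 1 is strict.\<close>

lemma pieces_less_1: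
  assumes "2 \<le> b" "valid_division b v" "p \<in> set (pieces b v)"
  shows "p < 1"
proof -
  define ps where "ps = sort (map v [0..<b - 1])"
  have len: "length ps = b - 1" by (simp add: ps_def)
  have ps: "0 < x \<and> x < 1" if "x \<in> set ps" for x
    using that assms(2) by (auto simp: ps_def valid_division_def)
  have "p \<in> set (map2 (\<lambda>x y. y - x) (0 # ps) (ps @ [1]))"
    using assms(3) by (simp add: pieces_def ps_def Let_def)
  then obtain i where i: "i < b" "p = (ps @ [1]) ! i - (0 # ps) ! i"
    using assms(1) len by (auto simp: set_zip)
  show ?thesis
  proof (cases i)
    case 0
    then show ?thesis using i assms(1) len ps[of "ps ! 0"] by (auto simp: nth_append)
  next
    case (Suc j)
    then have "0 < ps ! j" using i len by (intro ps[THEN conjunct1] nth_mem) simp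
    moreover have "(ps @ [1]) ! i \<le> 1"
      using ps[of "ps ! i"] i len by (auto simp: nth_append)
    ultimately show ?thesis using i(2) Suc by simp
  qed
qed

section \<open>The process started from an arbitrary list\<close>

fun run :: "nat \<Rightarrow> real list \<Rightarrow> (nat \<Rightarrow> nat \<Rightarrow> real) \<Rightarrow> nat \<Rightarrow> real list" where
  "run b s \<omega> 0 = s"
| "run b s \<omega> (Suc n) = split_max (run b s \<omega> n) (pieces b (\<omega> n))"

lemma frag_state_eq_run: "frag_state b \<omega> n = run b [1] \<omega> n"
  by (induction n) auto

text \<open>Together with \<open>run_comb_seq\<close>, which restarts after \<open>m\<close>
  divisions, this is the Markov property path by path; Fubini later turns it into
  conditioning.\<close>

lemma run_case_nat: "run b s (case_nat v \<omega>) (Suc n) = run b (split_max s (pieces b v)) \<omega> n"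
  by (induction n) auto

lemma run_comb_seq: "run b s (comb_seq m \<omega> \<omega>') (m + n) = run b (run b s \<omega> m) \<omega>' n"
proof (induction n)
  case 0
  have "run b s (comb_seq m \<omega> \<omega>') k = run b s \<omega> k" if "k \<le> m" for k
    using that by (induction k) (auto simp: comb_seq_less)
  then show ?case by simp
next
  case (Suc n)
  then show ?case using comb_seq_add[of m \<omega> \<omega>' n] by (simp add: add.commute)
qed

lemma length_run:
  assumes "1 \<le> b" "s \<noteq> []"
  shows "length (run b s \<omega> n) = length s + n * (b - 1)"
proof (induction n)
  case (Suc n)
  then have "run b s \<omega> n \<noteq> []" using assms(2) by auto
  from length_split_max[OF this, of "pieces b (\<omega> n)"] Suc assms(1) show ?case by simp
qed simp

lemma run_not_Nil:
  assumes "1 \<le> b" "s \<noteq> []"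
  shows "run b s \<omega> n \<noteq> []"
  using length_run[OF assms, of \<omega> n] assms(2) by auto

lemma run_nonneg:
  assumes "1 \<le> b" "s \<noteq> []" "\<And>k. valid_division b (\<omega> k)" "\<forall>x\<in>set s. 0 \<le> x"
    and "y \<in> set (run b s \<omega> n)"
  shows "0 \<le> y"
  using assms(5)
proof (induction n arbitrary: y)
  case (Suc n)
  have "\<forall>x\<in>set (run b s \<omega> n). 0 \<le> x" "\<forall>p\<in>set (pieces b (\<omega> n)). 0 \<le> p"
    using Suc.IH pieces_nonneg[OF assms(3)] by auto
  from split_max_nonneg[OF run_not_Nil[OF assms(1,2)] this] Suc.prems show ?case by simp
qed (use assms(4) in auto)

lemma sum_list_run:
  assumes "1 \<le> b" "s \<noteq> []"
  shows "sum_list (run b s \<omega> n) = sum_list s"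
  by (induction n)
     (simp_all add: sum_list_split_max[OF run_not_Nil[OF assms]] sum_list_pieces)

lemma Max_run_Suc_le:
  assumes "1 \<le> b" "s \<noteq> []" "\<And>k. valid_division b (\<omega> k)" "\<forall>x\<in>set s. 0 \<le> x"
  shows "Max (set (run b s \<omega> (Suc n))) \<le> Max (set (run b s \<omega> n))"
proof -
  have "run b s \<omega> (Suc n) \<noteq> []" by (rule run_not_Nil[OF assms(1,2)])
  moreover have "y \<le> Max (set (run b s \<omega> n))" if "y \<in> set (run b s \<omega> (Suc n))" for y
    using that run_nonneg[OF assms] pieces_le_1[OF assms(3)]
    by (intro split_max_le_Max[where q = "pieces b (\<omega> n)"] run_not_Nil[OF assms(1,2)]) auto
  ultimately show ?thesis by (metis List.finite_set Max_in set_empty)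
qed

lemma Max_run_antimono:
  assumes "1 \<le> b" "s \<noteq> []" "\<And>k. valid_division b (\<omega> k)" "\<forall>x\<in>set s. 0 \<le> x" "m \<le> n"
  shows "Max (set (run b s \<omega> n)) \<le> Max (set (run b s \<omega> m))"
  using Max_run_Suc_le[OF assms(1-4)] assms(5) by (rule lift_Suc_antimono_le)

lemma run_scale:
  assumes "1 \<le> b" "s \<noteq> []" "0 < c"
  shows "run b (map ((*) c) s) \<omega> n = map ((*) c) (run b s \<omega> n)"
  by (induction n) (simp_all add: split_max_scale[OF run_not_Nil[OF assms(1,2)] assms(3)])

lemma largest_eq: "largest b \<omega> n = Max (set (run b [1] \<omega> n))"
  by (simp add: largest_def frag_state_eq_run)

lemma length_frag_state: "1 \<le> b \<Longrightarrow> length (frag_state b \<omega> n) = Suc (n * (b - 1))"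
  by (simp add: frag_state_eq_run length_run)

lemma largest_0: "largest b \<omega> 0 = 1"
  by (simp add: largest_def)

lemma largest_antimono:
  assumes "1 \<le> b" "\<And>k. valid_division b (\<omega> k)" "m \<le> n"
  shows "largest b \<omega> n \<le> largest b \<omega> m"
  unfolding largest_eq using Max_run_antimono[OF assms(1) _ assms(2) _ assms(3), of "[1]"] by simp

lemma frag_state_nonneg:
  assumes "1 \<le> b" "\<And>k. valid_division b (\<omega> k)" "y \<in> set (frag_state b \<omega> n)"
  shows "0 \<le> y"
  using run_nonneg[OF assms(1) _ assms(2), of "[1]"] assms(3) by (simp add: frag_state_eq_run)

lemma sum_list_frag_state: "1 \<le> b \<Longrightarrow> sum_list (frag_state b \<omega> n) = 1"
  by (simp add: frag_state_eq_run sum_list_run)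

lemma frag_state_le_largest: "y \<in> set (frag_state b \<omega> n) \<Longrightarrow> y \<le> largest b \<omega> n"
  by (simp add: largest_def)

lemma length_mult_largest_ge_1:
  assumes "1 \<le> b"
  shows "1 \<le> real (Suc (n * (b - 1))) * largest b \<omega> n"
proof -
  have "sum_list (frag_state b \<omega> n) \<le> sum_list (map (\<lambda>_. largest b \<omega> n) (frag_state b \<omega> n))"
    using sum_list_mono[of "frag_state b \<omega> n" "\<lambda>x. x" "\<lambda>_. largest b \<omega> n"] frag_state_le_largest
    by auto
  then show ?thesis
    by (simp add: sum_list_frag_state[OF assms] sum_list_triv length_frag_state[OF assms])
qed

text \<open>The spacings sum to 1 for every \<open>\<omega>\<close>, so the largest is at least the
  reciprocal of their number. Division by \<open>largest\<close> is thus legitimate outside the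
  almost sure set as well.\<close>

lemma largest_pos:
  assumes "1 \<le> b"
  shows "0 < largest b \<omega> n"
  using length_mult_largest_ge_1[OF assms, of n \<omega>]
  by (metis less_le_trans mult_less_0_iff not_less of_nat_0_le_iff zero_less_one mult_zero_right
      linorder_neqE_linordered_idom mult_nonneg_nonpos)

text \<open>Each spacing split before time \<open>n\<close> exceeds \<open>t\<close>, so a step
  removes nothing from the count and only adds the short pieces that it creates. The initial spacing
  1 is kept out by \<open>t < 1\<close>.\<close>

lemma length_filter_frag_state:
  assumes "1 \<le> b" "t < 1" "\<And>k. k < n \<Longrightarrow> t < largest b \<omega> k"
  shows "length (filter (\<lambda>l. l \<le> t) (frag_state b \<omega> n)) =
    (\<Sum>k<n. length (filter (\<lambda>p. largest b \<omega> k * p \<le> t) (pieces b (\<omega> k))))"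
  using assms(3)
proof (induction n)
  case 0
  then show ?case using assms(2) by simp
next
  case (Suc n)
  let ?s = "frag_state b \<omega> n"
  have "?s \<noteq> []" using length_frag_state[OF assms(1), of \<omega> n] by auto
  then obtain xs ys where *: "?s = xs @ largest b \<omega> n # ys"
    "\<And>q. split_max ?s q = xs @ map ((*) (largest b \<omega> n)) q @ ys"
    using split_max_cases unfolding largest_def by metis
  have "length (filter (\<lambda>l. l \<le> t) ?s) = length (filter (\<lambda>l. l \<le> t) xs) + length (filter (\<lambda>l. l \<le> t) ys)"
    using Suc.prems[of n] by (subst *(1)) simp
  moreover have "length (filter (\<lambda>l. l \<le> t) (frag_state b \<omega> (Suc n))) =
    length (filter (\<lambda>l. l \<le> t) xs) + length (filter (\<lambda>p. largest b \<omega> n * p \<le> t) (pieces b (\<omega> n)))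
    + length (filter (\<lambda>l. l \<le> t) ys)"
    unfolding frag_state.simps *(2) by (simp add: filter_map comp_def)
  ultimately show ?case using Suc by simp
qed

section \<open>A potential bounding the number of splits\<close>

text \<open>The cases correspond to no entry, exactly one entry, or at least two entries above
  \<open>h\<close>. In the last case \<open>h\<close> is subtracted at least twice, and the entries
  below \<open>h\<close> only help because they are nonnegative.\<close>

lemma sum_excess_cases:
  assumes "0 \<le> h" "\<forall>y\<in>set ys. 0 \<le> (y::real)"
  defines "S \<equiv> sum_list (map (\<lambda>y. max 0 (y - h)) ys)"
  shows "S = 0 \<or> (\<exists>y\<in>set ys. S = y - h) \<or> S \<le> sum_list ys - 2 * h"
  using assms(2) unfolding S_def
proof (induction ys)
  case (Cons x xs)
  let ?S = "sum_list (map (\<lambda>y. max 0 (y - h)) xs)"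
  have "?S = 0 \<or> (\<exists>y\<in>set xs. ?S = y - h) \<or> ?S \<le> sum_list xs - 2 * h"
    using Cons by simp
  moreover have "y \<le> sum_list xs" if "y \<in> set xs" for y
    using Cons.prems by (intro member_le_sum_list that) auto
  ultimately show ?case using assms(1) Cons.prems by (fastforce simp: max_def)
qed simp

text \<open>The sum of \<open>max 0 (z - l / 2)\<close> over all spacings \<open>z\<close> is below 1 initially, so the next lemma allows
  only \<open>O(1 / l)\<close> splits before the mesh drops below \<open>l\<close>.\<close>

lemma excess_split_le:
  fixes l z d :: real
  assumes z: "l \<le> z" "0 < l" and q: "\<forall>p\<in>set q. 0 \<le> p" "sum_list q = 1"
    and d: "d \<le> 1 / 2" "\<forall>p\<in>set q. d \<le> 1 - p"
  shows "sum_list (map (\<lambda>y. max 0 (y - l / 2)) (map ((*) z) q)) \<le> max 0 (z - l / 2) - l * d"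
proof -
  let ?S = "sum_list (map (\<lambda>y. max 0 (y - l / 2)) (map ((*) z) q))"
  have sum: "sum_list (map ((*) z) q) = z"
    using q(2) sum_list_const_mult[of z "\<lambda>x. x" q] by simp
  have "?S = 0 \<or> (\<exists>y\<in>set (map ((*) z) q). ?S = y - l / 2) \<or> ?S \<le> z - 2 * (l / 2)"
    using sum_excess_cases[of "l / 2" "map ((*) z) q"] z q(1) unfolding sum by auto
  then have cases: "?S = 0 \<or> (\<exists>p\<in>set q. ?S = z * p - l / 2) \<or> ?S \<le> z - l"
    by auto
  have ld: "l * d \<le> l / 2" using d(1) z(2) by simp
  \<comment> \<open>With a single piece above \<open>l / 2\<close> the potential drops by just
    \<open>z * (1 - p)\<close>, which is where a lower bound on \<open>1 - p\<close> enters. The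
    other two cases lose at least \<open>l / 2\<close>.\<close>
  have *: "?S \<le> z - l / 2 - l * d" if "p \<in> set q" "?S = z * p - l / 2" for p
  proof -
    have "l * d \<le> l * (1 - p)" using d(2) that(1) z by (intro mult_left_mono) auto
    also have "\<dots> \<le> z * (1 - p)"
      using z member_le_sum_list[OF that(1)] q by (intro mult_right_mono) auto
    finally show ?thesis using that(2) by (simp add: algebra_simps)
  qed
  have "?S \<le> z - l / 2 - l * d"
    using cases
  proof (elim disjE bexE)
    assume "?S = 0"
    then show ?thesis using ld z(1) by argo
  next
    assume "?S \<le> z - l"
    then show ?thesis using ld by argo
  qed (rule *)
  then show ?thesis by linarith
qed

text \<open>Any positive measurable function of the division that is bounded by \<open>1 / 2\<close> and by \<open>1 - p\<close> for
  every piece \<open>p\<close> would do.\<close>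

definition defect :: "nat \<Rightarrow> (nat \<Rightarrow> real) \<Rightarrow> real" where
  "defect b v = (1 / 2) * (\<Prod>i<b. 1 - pieces b v ! i)"

lemma prod_le_factor:
  assumes "finite A" "i \<in> A" "\<And>j. j \<in> A \<Longrightarrow> 0 \<le> f j \<and> f j \<le> (1::real)"
  shows "prod f A \<le> f i"
proof -
  have "prod f (A - {i}) \<le> 1" using assms by (intro prod_le_1) auto
  then show ?thesis
    using assms(3)[OF assms(2)] by (simp add: prod.remove[OF assms(1,2)] mult_left_le)
qed

lemma defect_le:
  assumes "2 \<le> b" "valid_division b v"
  shows "defect b v \<le> 1 / 2" "p \<in> set (pieces b v) \<Longrightarrow> defect b v \<le> 1 - p" "0 < defect b v"
proof -
  have f: "0 < 1 - pieces b v ! i" "1 - pieces b v ! i \<le> 1" if "i < b" for i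
    using that pieces_nonneg[OF assms(2), of "pieces b v ! i"]
      pieces_less_1[OF assms, of "pieces b v ! i"] assms(1) by auto
  show "0 < defect b v" unfolding defect_def using f by (auto intro!: mult_pos_pos prod_pos)
  have "(\<Prod>i<b. 1 - pieces b v ! i) \<le> 1"
    using f by (intro prod_le_1) (auto intro: less_imp_le)
  then show "defect b v \<le> 1 / 2" by (simp add: defect_def)
  have pr: "0 < (\<Prod>i<b. 1 - pieces b v ! i)" using f by (auto intro!: prod_pos)
  show "defect b v \<le> 1 - p" if p: "p \<in> set (pieces b v)"
  proof -
    obtain i where i: "i < b" "p = pieces b v ! i"
      using p assms(1) by (auto simp: in_set_conv_nth)
    have "(\<Prod>i<b. 1 - pieces b v ! i) \<le> 1 - p"
      unfolding i(2) using i f by (intro prod_le_factor) (auto intro: less_imp_le)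
    then show ?thesis using pr by (simp add: defect_def)
  qed
qed

text \<open>The threshold is half of the final mesh \<open>l = largest b \<omega> n\<close>, fixed
  in advance. Every spacing split before time \<open>n\<close> is at least \<open>l\<close> long, so
  each split lowers the potential by at least \<open>l\<close> times its defect, while the potential
  starts below 1 and stays nonnegative.\<close>

lemma largest_mult_sum_defect_le_1:
  assumes "2 \<le> b" "\<And>k. valid_division b (\<omega> k)"
  shows "largest b \<omega> n * (\<Sum>k<n. defect b (\<omega> k)) \<le> 1"
proof -
  have b: "1 \<le> b" using assms(1) by simp
  define l where "l = largest b \<omega> n"
  have l: "0 < l" unfolding l_def by (rule largest_pos[OF b])
  define \<Psi> where "\<Psi> = (\<lambda>s. sum_list (map (\<lambda>y. max 0 (y - l / 2)) s))"
  have "l * (\<Sum>k<m. defect b (\<omega> k)) \<le> 1 - \<Psi> (frag_state b \<omega> m)" if "m \<le> n" for m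
    using that
  proof (induction m)
    case 0
    then show ?case using l by (simp add: \<Psi>_def max_def)
  next
    case (Suc m)
    let ?s = "frag_state b \<omega> m"
    have "?s \<noteq> []" using length_frag_state[OF b, of \<omega> m] by auto
    then obtain xs ys where *: "?s = xs @ largest b \<omega> m # ys"
      "\<And>q. split_max ?s q = xs @ map ((*) (largest b \<omega> m)) q @ ys"
      using split_max_cases unfolding largest_def by metis
    have "l \<le> largest b \<omega> m"
      unfolding l_def using Suc.prems by (intro largest_antimono[OF b assms(2)]) simp
    from excess_split_le[OF this l _ sum_list_pieces defect_le(1)[OF assms(1)]]
    have "\<Psi> (map ((*) (largest b \<omega> m)) (pieces b (\<omega> m)))
      \<le> max 0 (largest b \<omega> m - l / 2) - l * defect b (\<omega> m)"
      unfolding \<Psi>_def using pieces_nonneg[OF assms(2)] defect_le(2)[OF assms] assms(2) by blast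
    moreover have "\<Psi> ?s = \<Psi> xs + max 0 (largest b \<omega> m - l / 2) + \<Psi> ys"
      by (subst *(1)) (simp add: \<Psi>_def)
    moreover have "\<Psi> (frag_state b \<omega> (Suc m))
      = \<Psi> xs + \<Psi> (map ((*) (largest b \<omega> m)) (pieces b (\<omega> m))) + \<Psi> ys"
      unfolding frag_state.simps *(2) by (simp add: \<Psi>_def)
    ultimately have "\<Psi> (frag_state b \<omega> (Suc m)) \<le> \<Psi> ?s - l * defect b (\<omega> m)"
      by simp
    then show ?case using Suc by (simp add: algebra_simps)
  qed
  from this[of n] have "l * (\<Sum>k<n. defect b (\<omega> k)) \<le> 1 - \<Psi> (frag_state b \<omega> n)" by simp
  moreover have "0 \<le> \<Psi> (frag_state b \<omega> n)"
    unfolding \<Psi>_def by (intro sum_list_nonneg) auto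
  ultimately show ?thesis unfolding l_def by linarith
qed

section \<open>Events of high probability\<close>

lemma (in prob_space) prob_Int_ge:
  assumes "A \<in> events" "B \<in> events"
  shows "prob A + prob B - 1 \<le> prob (A \<inter> B)"
proof -
  have "prob (space M - A \<inter> B) \<le> prob ((space M - A) \<union> (space M - B))"
    using assms by (intro finite_measure_mono) auto
  also have "\<dots> \<le> prob (space M - A) + prob (space M - B)"
    using assms by (intro measure_Un_le) auto
  finally show ?thesis using assms by (simp add: prob_compl)
qed

text \<open>\<open>whp\<close> asks only for a measurable subset of each event. Intersecting two
  such subsets, each allowed half of the error probability, therefore works even when
  \<open>T\<close> is not measurable.\<close>

lemma (in prob_space) whp_eventually_combine:
  assumes "whp M Q" "whp M R"
    and imp: "\<forall>\<^sub>F n in sequentially. \<forall>\<omega>. Q n \<omega> \<longrightarrow> R n \<omega> \<longrightarrow> T n \<omega>"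
  shows "whp M T"
  unfolding whp_def
proof (intro allI impI)
  fix \<delta> :: real assume "0 < \<delta>"
  then have d: "0 < \<delta> / 2" by simp
  obtain N1 where N1: "\<forall>n\<ge>N1. \<exists>A\<in>sets M. prob A \<ge> 1 - \<delta> / 2 \<and> (\<forall>\<omega>\<in>A. Q n \<omega>)"
    using assms(1) d unfolding whp_def by blast
  obtain N2 where N2: "\<forall>n\<ge>N2. \<exists>A\<in>sets M. prob A \<ge> 1 - \<delta> / 2 \<and> (\<forall>\<omega>\<in>A. R n \<omega>)"
    using assms(2) d unfolding whp_def by blast
  obtain N3 where N3: "\<forall>n\<ge>N3. \<forall>\<omega>. Q n \<omega> \<longrightarrow> R n \<omega> \<longrightarrow> T n \<omega>"
    using imp unfolding eventually_sequentially by blast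
  show "\<exists>N. \<forall>n\<ge>N. \<exists>A\<in>sets M. prob A \<ge> 1 - \<delta> \<and> (\<forall>\<omega>\<in>A. T n \<omega>)"
  proof (intro exI[of _ "max N1 (max N2 N3)"] allI impI)
    fix n assume n: "max N1 (max N2 N3) \<le> n"
    obtain A where A: "A \<in> sets M" "prob A \<ge> 1 - \<delta> / 2" "\<forall>\<omega>\<in>A. Q n \<omega>"
      using N1 n by (metis max.boundedE)
    obtain B where B: "B \<in> sets M" "prob B \<ge> 1 - \<delta> / 2" "\<forall>\<omega>\<in>B. R n \<omega>"
      using N2 n by (metis max.boundedE)
    have "1 - \<delta> \<le> prob (A \<inter> B)"
      using prob_Int_ge[OF A(1) B(1)] A(2) B(2) by simp
    moreover have "\<forall>\<omega>\<in>A \<inter> B. T n \<omega>" using A(3) B(3) N3 n by auto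
    ultimately show "\<exists>A\<in>sets M. prob A \<ge> 1 - \<delta> \<and> (\<forall>\<omega>\<in>A. T n \<omega>)"
      using A(1) B(1) by blast
  qed
qed

lemma (in prob_space) whp_eventually:
  assumes "\<forall>\<^sub>F n in sequentially. \<forall>\<omega>. Q n \<omega>"
  shows "whp M Q"
  unfolding whp_def
proof (intro allI impI)
  fix \<delta> :: real assume "0 < \<delta>"
  then have "1 - \<delta> \<le> prob (space M)" by (simp add: prob_space)
  then show "\<exists>N. \<forall>n\<ge>N. \<exists>A\<in>sets M. prob A \<ge> 1 - \<delta> \<and> (\<forall>\<omega>\<in>A. Q n \<omega>)"
    using assms unfolding eventually_sequentially by blast
qed

lemma (in prob_space) whp_eventually_mono:
  assumes "whp M Q" "\<forall>\<^sub>F n in sequentially. \<forall>\<omega>. Q n \<omega> \<longrightarrow> T n \<omega>"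
  shows "whp M T"
  by (rule whp_eventually_combine[OF assms(1,1)]) (use assms(2) in \<open>auto elim: eventually_mono\<close>)

lemma (in prob_space) whp_mono:
  assumes "whp M Q" "\<And>n \<omega>. Q n \<omega> \<Longrightarrow> T n \<omega>"
  shows "whp M T"
  by (rule whp_eventually_mono[OF assms(1)]) (simp add: assms(2))

lemma (in prob_space) whp_conj:
  assumes "whp M Q" "whp M R"
  shows "whp M (\<lambda>n \<omega>. Q n \<omega> \<and> R n \<omega>)"
  by (rule whp_eventually_combine[OF assms]) simp

lemma (in prob_space) whp_ball_finite:
  assumes "finite I" "\<And>i. i \<in> I \<Longrightarrow> whp M (Q i)"
  shows "whp M (\<lambda>n \<omega>. \<forall>i\<in>I. Q i n \<omega>)"
  using assms
proof (induction I rule: finite_induct)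
  case empty
  then show ?case by (intro whp_eventually) simp
next
  case (insert i I)
  then have "whp M (\<lambda>n \<omega>. Q i n \<omega> \<and> (\<forall>i\<in>I. Q i n \<omega>))"
    by (intro whp_conj) auto
  then show ?case by simp
qed

lemma (in prob_space) whp_AE:
  assumes "AE \<omega> in M. Q \<omega>"
  shows "whp M (\<lambda>n. Q)"
proof -
  obtain N where N: "N \<in> null_sets M" "{\<omega>\<in>space M. \<not> Q \<omega>} \<subseteq> N"
    using assms unfolding eventually_ae_filter by blast
  have *: "space M - N \<in> sets M" "prob (space M - N) = 1"
    using N(1) prob_compl[of N] measure_eq_0_null_sets[OF N(1)] by auto
  show ?thesis
    unfolding whp_def
  proof (intro allI impI exI bexI[of _ "space M - N"] conjI ballI)
    show "1 - \<delta> \<le> prob (space M - N)" if "0 < \<delta>" for \<delta>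
      using that *(2) by simp
  qed (use N(2) *(1) in auto)
qed

lemma whp_subseq:
  assumes "whp M Q" "filterlim a at_top sequentially"
  shows "whp M (\<lambda>n. Q (a n))"
  unfolding whp_def
proof (intro allI impI)
  fix \<delta> :: real assume "0 < \<delta>"
  then obtain N where N: "\<forall>n\<ge>N. \<exists>A\<in>sets M. measure M A \<ge> 1 - \<delta> \<and> (\<forall>\<omega>\<in>A. Q n \<omega>)"
    using assms(1) unfolding whp_def by blast
  obtain N' where "\<forall>n\<ge>N'. N \<le> a n"
    using assms(2) unfolding filterlim_at_top eventually_sequentially by blast
  then show "\<exists>N. \<forall>n\<ge>N. \<exists>A\<in>sets M. measure M A \<ge> 1 - \<delta> \<and> (\<forall>\<omega>\<in>A. Q (a n) \<omega>)"
    using N by blast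
qed

text \<open>Supplies a sample point at which relations between constants, which do not involve
  \<open>\<omega>\<close>, can be read off.\<close>

lemma whp_ex:
  assumes "whp M Q"
  shows "\<exists>n \<omega>. Q n \<omega>"
proof -
  obtain N where "\<forall>n\<ge>N. \<exists>A\<in>sets M. measure M A \<ge> 1 - 1 / 2 \<and> (\<forall>\<omega>\<in>A. Q n \<omega>)"
    using assms unfolding whp_def by (metis half_gt_zero zero_less_one)
  then obtain A where A: "measure M A \<ge> 1 / 2" "\<forall>\<omega>\<in>A. Q N \<omega>" by auto
  then have "A \<noteq> {}" by auto
  then show ?thesis using A(2) by auto
qed

text \<open>The approximants may depend on \<open>\<epsilon>\<close>: any two of them are close to
  one common sample value by \<open>whp_ex\<close>, so they form a Cauchy sequence, whose limit is
  \<open>u\<close>. Convergence is thereby shown without identifying the limit, and discretised sums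
  never have to be turned into integrals.\<close>

lemma (in prob_space) whp_uniform_limit_exists:
  fixes f :: "nat \<Rightarrow> 'a \<Rightarrow> 'x \<Rightarrow> real"
  assumes "\<And>\<epsilon>. 0 < \<epsilon> \<Longrightarrow> \<exists>a. whp M (\<lambda>n \<omega>. \<forall>x\<in>X. \<bar>f n \<omega> x - a x\<bar> \<le> \<epsilon>)"
  shows "\<exists>u. \<forall>\<epsilon>>0. whp M (\<lambda>n \<omega>. \<forall>x\<in>X. \<bar>f n \<omega> x - u x\<bar> \<le> \<epsilon>)"
proof -
  have "\<forall>k. \<exists>a. whp M (\<lambda>n \<omega>. \<forall>x\<in>X. \<bar>f n \<omega> x - a x\<bar> \<le> inverse (real (Suc k)))"
    by (intro allI assms) simp
  from choice[OF this] obtain a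
    where "\<forall>k. whp M (\<lambda>n \<omega>. \<forall>x\<in>X. \<bar>f n \<omega> x - a k x\<bar> \<le> inverse (real (Suc k)))"
    by (elim exE)
  note a = this[THEN spec]
  have close: "\<bar>a j x - a k x\<bar> \<le> inverse (real (Suc j)) + inverse (real (Suc k))"
    if "x \<in> X" for j k x
  proof -
    obtain n \<omega> where "(\<forall>x\<in>X. \<bar>f n \<omega> x - a j x\<bar> \<le> inverse (real (Suc j)))
      \<and> (\<forall>x\<in>X. \<bar>f n \<omega> x - a k x\<bar> \<le> inverse (real (Suc k)))"
      using whp_ex[OF whp_conj[OF a[of j] a[of k]]] by (elim exE)
    then have "\<bar>f n \<omega> x - a j x\<bar> \<le> inverse (real (Suc j))"
      "\<bar>f n \<omega> x - a k x\<bar> \<le> inverse (real (Suc k))"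
      using that by simp_all
    then show ?thesis by linarith
  qed
  have lim0: "(\<lambda>k. inverse (real (Suc k))) \<longlonglongrightarrow> 0"
    by (rule LIMSEQ_inverse_real_of_nat)
  define u where "u = (\<lambda>x. lim (\<lambda>k. a k x))"
  have conv: "(\<lambda>k. a k x) \<longlonglongrightarrow> u x" if x: "x \<in> X" for x
  proof -
    have "Cauchy (\<lambda>k. a k x)"
    proof (rule CauchyI')
      fix e :: real assume "0 < e"
      then obtain M where M: "\<And>k. M \<le> k \<Longrightarrow> inverse (real (Suc k)) < e / 2"
        using order_tendstoD(2)[OF lim0, of "e / 2"] by (auto simp: eventually_sequentially)
      show "\<exists>M. \<forall>m\<ge>M. \<forall>n>m. dist (a m x) (a n x) < e"
      proof (intro exI[of _ M] allI impI)
        fix m n assume "M \<le> m" "m < n"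
        then show "dist (a m x) (a n x) < e"
          using close[OF x, of m n] M[of m] M[of n] by (simp add: dist_real_def)
      qed
    qed
    then show ?thesis unfolding u_def by (simp add: Cauchy_convergent_iff convergent_LIMSEQ_iff)
  qed
  have au: "\<bar>a k x - u x\<bar> \<le> inverse (real (Suc k))" if x: "x \<in> X" for k x
  proof (rule LIMSEQ_le)
    show "(\<lambda>j. \<bar>a k x - a j x\<bar>) \<longlonglongrightarrow> \<bar>a k x - u x\<bar>"
      by (intro tendsto_intros conv x)
    show "(\<lambda>j. inverse (real (Suc k)) + inverse (real (Suc j))) \<longlonglongrightarrow> inverse (real (Suc k))"
      using tendsto_add[OF tendsto_const lim0] by simp
    show "\<exists>N. \<forall>n\<ge>N. \<bar>a k x - a n x\<bar> \<le> inverse (real (Suc k)) + inverse (real (Suc n))"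
      using close[OF x] by blast
  qed
  show ?thesis
  proof (intro exI[of _ u] allI impI)
    fix \<epsilon> :: real assume "0 < \<epsilon>"
    then obtain k where k: "inverse (real (Suc k)) < \<epsilon> / 2"
      using reals_Archimedean[of "\<epsilon> / 2"] by auto
    show "whp M (\<lambda>n \<omega>. \<forall>x\<in>X. \<bar>f n \<omega> x - u x\<bar> \<le> \<epsilon>)"
    proof (rule whp_mono[OF a[of k]], intro ballI)
      fix n \<omega> x assume "\<forall>x\<in>X. \<bar>f n \<omega> x - a k x\<bar> \<le> inverse (real (Suc k))" "x \<in> X"
      then have "\<bar>f n \<omega> x - a k x\<bar> \<le> inverse (real (Suc k))" by blast
      then show "\<bar>f n \<omega> x - u x\<bar> \<le> \<epsilon>" using au[OF \<open>x \<in> X\<close>, of k] k by linarith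
    qed
  qed
qed

section \<open>Laws of large numbers for the pieces\<close>

locale fragmentation =
  fixes b :: nat and D :: "(nat \<Rightarrow> real) measure"
  assumes b: "2 \<le> b"
    and D_prob: "prob_space D"
    and D_sets: "sets D = sets (PiM {..<b - 1} (\<lambda>_. borel))"
    and D_unit: "AE v in D. valid_division b v"

sublocale fragmentation \<subseteq> sequence_space D
  by (simp add: sequence_space_def product_prob_spaceI D_prob)

context fragmentation
begin

lemma b1: "1 \<le> b" using b by simp

lemma AE_valid: "AE \<omega> in S. \<forall>k. valid_division b (\<omega> k)"
  unfolding AE_all_countable using AE_component[OF UNIV_I D_unit] by blast

lemma measurable_component_D [measurable]: "(\<lambda>\<omega>. \<omega> k) \<in> S \<rightarrow>\<^sub>M D"
  by simp

lemma indep_components: "P.indep_vars (\<lambda>_. D) (\<lambda>k \<omega>. \<omega> k) {..<n::nat}"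
proof (cases "n = 0")
  case True
  then show ?thesis by (simp add: P.indep_vars_def P.indep_sets_def)
next
  case False
  have "distr S (PiM {..<n} (\<lambda>_. D)) (\<lambda>\<omega>. restrict \<omega> {..<n}) = PiM {..<n} (\<lambda>_. D)"
    by (rule distr_PiM_restrict_finite) auto
  also have "\<dots> = PiM {..<n} (\<lambda>k. distr S D (\<lambda>\<omega>. \<omega> k))"
    by (simp add: PiM_component)
  finally show ?thesis
    using False by (subst P.indep_vars_iff_distr_eq_PiM) auto
qed

lemma law_of_large_numbers:
  assumes f [measurable]: "f \<in> borel_measurable D" and "AE v in D. f v \<in> {0..B}" "0 < \<epsilon>"
  shows "whp S (\<lambda>n \<omega>. \<bar>(\<Sum>k<n. f (\<omega> k)) - real n * (\<integral>v. f v \<partial>D)\<bar> \<le> \<epsilon> * real n)"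
  unfolding whp_def
proof (intro allI impI)
  fix \<delta> :: real assume \<delta>: "0 < \<delta>"
  \<comment> \<open>The enlarged bound keeps the width of the interval positive even for
    \<open>B = 0\<close>; Hoeffding's inequality divides by its square.\<close>
  define C where "C = \<bar>B\<bar> + 1"
  let ?\<mu> = "\<integral>v. f v \<partial>D"
  have C: "0 < C" by (simp add: C_def)
  have tail: "P.prob {\<omega>\<in>space S. \<bar>(\<Sum>k<n. f (\<omega> k)) - real n * ?\<mu>\<bar> \<ge> \<epsilon> * real n}
    \<le> 2 * exp (- (2 * \<epsilon>\<^sup>2 / C\<^sup>2) * real n)" if n: "0 < n" for n
  proof -
    have exp_f: "P.expectation (\<lambda>\<omega>. f (\<omega> k)) = ?\<mu>" for k
      using integral_distr[of "\<lambda>\<omega>. \<omega> k" S D f] by (simp add: PiM_component)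
    interpret H: Hoeffding_ineq S "{..<n}" "\<lambda>k \<omega>. f (\<omega> k)" "\<lambda>_. 0" "\<lambda>_. C" "real n * ?\<mu>"
    proof unfold_locales
      show "P.indep_vars (\<lambda>_. borel) (\<lambda>k \<omega>. f (\<omega> k)) {..<n}"
        by (rule P.indep_vars_compose2[OF indep_components]) simp
      have "AE v in D. f v \<in> {0..C}"
        using assms(2) by eventually_elim (auto simp: C_def)
      then show "AE \<omega> in S. f (\<omega> k) \<in> {0..C}" for k
        by (rule AE_component[OF UNIV_I])
    next
      show "real n * ?\<mu> \<equiv> \<Sum>k<n. P.expectation (\<lambda>\<omega>. f (\<omega> k))"
        by (simp add: exp_f)
    qed auto
    have "P.prob {\<omega>\<in>space S. \<bar>(\<Sum>k<n. f (\<omega> k)) - real n * ?\<mu>\<bar> \<ge> \<epsilon> * real n}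
      \<le> 2 * exp (-2 * (\<epsilon> * real n)\<^sup>2 / (\<Sum>k<n. (C - 0)\<^sup>2))"
      using assms(3) C n by (intro H.Hoeffding_ineq_abs_ge) auto
    also have "-2 * (\<epsilon> * real n)\<^sup>2 / (\<Sum>k<n. (C - 0)\<^sup>2) = - (2 * \<epsilon>\<^sup>2 / C\<^sup>2) * real n"
      using n by (simp add: power2_eq_square field_simps)
    finally show ?thesis .
  qed
  have "(\<lambda>n. 2 * exp (- (2 * \<epsilon>\<^sup>2 / C\<^sup>2) * real n)) \<longlonglongrightarrow> 0"
  proof -
    have "0 < 2 * \<epsilon>\<^sup>2 / C\<^sup>2" using assms(3) C by simp
    then have "(\<lambda>n. exp (- (2 * \<epsilon>\<^sup>2 / C\<^sup>2)) ^ n) \<longlonglongrightarrow> 0"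
      by (intro LIMSEQ_realpow_zero) auto
    then show ?thesis
      unfolding exp_of_nat2_mult by (rule tendsto_mult_right_zero)
  qed
  then have "\<forall>\<^sub>F n in sequentially. 2 * exp (- (2 * \<epsilon>\<^sup>2 / C\<^sup>2) * real n) < \<delta>"
    using \<delta> by (rule order_tendstoD)
  then obtain N where N: "\<And>n. N \<le> n \<Longrightarrow> 2 * exp (- (2 * \<epsilon>\<^sup>2 / C\<^sup>2) * real n) < \<delta>"
    unfolding eventually_sequentially by blast
  show "\<exists>N. \<forall>n\<ge>N. \<exists>A\<in>sets S. P.prob A \<ge> 1 - \<delta> \<and>
    (\<forall>\<omega>\<in>A. \<bar>(\<Sum>k<n. f (\<omega> k)) - real n * ?\<mu>\<bar> \<le> \<epsilon> * real n)"
  proof (intro exI[of _ "Suc N"] allI impI)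
    fix n assume n: "Suc N \<le> n"
    let ?B = "{\<omega>\<in>space S. \<bar>(\<Sum>k<n. f (\<omega> k)) - real n * ?\<mu>\<bar> \<ge> \<epsilon> * real n}"
    have B: "?B \<in> sets S" by measurable
    then have "1 - \<delta> \<le> P.prob (space S - ?B)"
      using tail[of n] N[of n] n by (simp add: P.prob_compl)
    then show "\<exists>A\<in>sets S. P.prob A \<ge> 1 - \<delta> \<and>
      (\<forall>\<omega>\<in>A. \<bar>(\<Sum>k<n. f (\<omega> k)) - real n * ?\<mu>\<bar> \<le> \<epsilon> * real n)"
      using B by (intro bexI[of _ "space S - ?B"]) (auto simp: not_le intro: less_imp_le)
  qed
qed

end

section \<open>Measurability of the pieces through order statistics\<close>

lemma nth_le_iff_length_filter:
  fixes xs :: "'a::linorder list"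
  assumes "sorted xs" "i < length xs"
  shows "xs ! i \<le> a \<longleftrightarrow> i < length (filter (\<lambda>x. x \<le> a) xs)"
  using assms
proof (induction xs arbitrary: i)
  case (Cons x xs)
  show ?case
  proof (cases "x \<le> a")
    case True
    then show ?thesis using Cons by (cases i) auto
  next
    case False
    then have "filter (\<lambda>x. x \<le> a) (x # xs) = []"
      using Cons.prems(1) by (auto simp: filter_empty_conv)
    moreover have "x \<le> (x # xs) ! i"
      using Cons.prems by (cases i) auto
    ultimately show ?thesis using False by auto
  qed
qed simp

lemma length_filter_map_upt:
  "real (length (filter P (map f [0..<n]))) = (\<Sum>i<n. if P (f i) then 1 else 0)"
  by (induction n) auto

lemma length_filter_conv_sum:
  "real (length (filter P xs)) = (\<Sum>i<length xs. if P (xs ! i) then 1 else 0)"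
  using length_filter_map_upt[of P "(!) xs" "length xs"] by (simp add: map_nth)

context fragmentation
begin

lemma measurable_coordinate [measurable]:
  assumes "i < b - 1"
  shows "(\<lambda>v. v i) \<in> borel_measurable D"
  using assms by (subst measurable_cong_sets[OF D_sets refl]) simp

text \<open>The \<open>i\<close>-th order statistic, counted from 0, is at most \<open>a\<close>
  exactly when more than \<open>i\<close> coordinates are, which is a condition on a sum of
  indicators.\<close>

lemma measurable_sorted_coordinate [measurable]:
  assumes "i < b - 1"
  shows "(\<lambda>v. sort (map v [0..<b - 1]) ! i) \<in> borel_measurable D"
  unfolding borel_measurable_iff_le
proof
  fix a :: real
  have eq: "sort (map v [0..<b - 1]) ! i \<le> a \<longleftrightarrow>
    real i < (\<Sum>j<b - 1. if v j \<le> a then 1 else 0)" for v :: "nat \<Rightarrow> real"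
  proof -
    have "sort (map v [0..<b - 1]) ! i \<le> a \<longleftrightarrow> i < length (filter (\<lambda>x. x \<le> a) (map v [0..<b - 1]))"
      using nth_le_iff_length_filter[of "sort (map v [0..<b - 1])" i a] assms
      by (simp add: filter_sort)
    also have "\<dots> \<longleftrightarrow> real i < real (length (filter (\<lambda>x. x \<le> a) (map v [0..<b - 1])))"
      by (rule of_nat_less_iff[symmetric])
    finally show ?thesis unfolding length_filter_map_upt .
  qed
  have [measurable]: "(\<lambda>v. \<Sum>j<b - 1. if v j \<le> a then 1 else (0::real)) \<in> borel_measurable D"
    by (rule borel_measurable_sum) measurable
  show "{v\<in>space D. sort (map v [0..<b - 1]) ! i \<le> a} \<in> sets D"
    unfolding eq by measurable
qed

lemma measurable_pieces_nth [measurable]: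
  assumes "i < b"
  shows "(\<lambda>v. pieces b v ! i) \<in> borel_measurable D"
proof -
  have eq: "pieces b v ! i = (if i < b - 1 then sort (map v [0..<b - 1]) ! i else 1)
    - (if i = 0 then 0 else sort (map v [0..<b - 1]) ! (i - 1))" for v
    using assms by (auto simp: pieces_def Let_def nth_append nth_Cons')
  have "(\<lambda>v. if i < b - 1 then sort (map v [0..<b - 1]) ! i else 1) \<in> borel_measurable D"
    by (cases "i < b - 1") (simp_all only: measurable_sorted_coordinate if_True if_False borel_measurable_const)
  moreover have "(\<lambda>v. if i = 0 then 0 else sort (map v [0..<b - 1]) ! (i - 1)) \<in> borel_measurable D"
  proof (cases "i = 0")
    case False
    then have "i - 1 < b - 1" using assms by simp
    then show ?thesis using False by (simp only: measurable_sorted_coordinate if_False)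
  qed simp
  ultimately show ?thesis unfolding eq by (rule borel_measurable_diff)
qed

lemma measurable_defect [measurable]: "defect b \<in> borel_measurable D"
  unfolding defect_def[abs_def]
  by (intro borel_measurable_times borel_measurable_const borel_measurable_prod
      borel_measurable_diff measurable_pieces_nth) auto

section \<open>Expected piece counts and their continuity\<close>

definition piece_count :: "real \<Rightarrow> (nat \<Rightarrow> real) \<Rightarrow> real" where
  "piece_count t v = real (length (filter (\<lambda>p. p \<le> t) (pieces b v)))"

text \<open>Right-continuous version of \<open>exp_pieces\<close>, which counts with
  \<open><\<close>. The spacing distribution counts with \<open>\<le>\<close>, so this is the
  function that occurs in its limit.\<close>

definition mean_count :: "real \<Rightarrow> real" where
  "mean_count t = (\<integral>v. piece_count t v \<partial>D)"

lemma piece_count_conv_sum: "piece_count t v = (\<Sum>i<b. if pieces b v ! i \<le> t then 1 else 0)"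
  unfolding piece_count_def length_filter_conv_sum using b1 by simp

lemma count_less_conv_sum:
  "real (length (filter (\<lambda>p. p < t) (pieces b v))) = (\<Sum>i<b. if pieces b v ! i < t then 1 else 0)"
  unfolding length_filter_conv_sum using b1 by simp

lemma measurable_piece_count [measurable]: "piece_count t \<in> borel_measurable D"
  unfolding piece_count_conv_sum[abs_def] by (rule borel_measurable_sum) measurable

lemma measurable_count_less [measurable]:
  "(\<lambda>v. real (length (filter (\<lambda>p. p < t) (pieces b v)))) \<in> borel_measurable D"
  unfolding count_less_conv_sum by (rule borel_measurable_sum) measurable

lemma piece_count_bounds: "0 \<le> piece_count t v" "piece_count t v \<le> real b"
  using length_filter_le[of "\<lambda>p. p \<le> t" "pieces b v"] b1 by (simp_all add: piece_count_def)

lemma count_less_bound: "length (filter (\<lambda>p. p < t) (pieces b v)) \<le> b"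
  using length_filter_le[of "\<lambda>p. p < t" "pieces b v"] b1 by simp

lemma length_filter_mono:
  assumes "\<And>x. P x \<Longrightarrow> Q x"
  shows "length (filter P xs) \<le> length (filter Q xs)"
  by (induction xs) (auto simp: assms)

lemma piece_count_mono: "s \<le> t \<Longrightarrow> piece_count s v \<le> piece_count t v"
  unfolding piece_count_def by (intro of_nat_mono length_filter_mono) auto

lemma piece_count_ge_1:
  assumes "valid_division b v" "1 \<le> t"
  shows "piece_count t v = real b"
proof -
  have "filter (\<lambda>p. p \<le> t) (pieces b v) = pieces b v"
    using pieces_le_1[OF assms(1)] assms(2) by (intro filter_True) force
  then show ?thesis using b1 by (simp add: piece_count_def)
qed

lemma integrable_piece_count [simp]: "integrable D (piece_count t)"
  by (rule M.integrable_const_bound[of _ "real b"]) (auto simp: piece_count_bounds)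

lemma integrable_count_less [simp]: "integrable D (\<lambda>v. real (length (filter (\<lambda>p. p < t) (pieces b v))))"
  by (rule M.integrable_const_bound[of _ "real b"]) (auto simp: count_less_bound)

lemma mean_count_mono: "s \<le> t \<Longrightarrow> mean_count s \<le> mean_count t"
  unfolding mean_count_def by (intro integral_mono) (auto simp: piece_count_mono)

lemma mean_count_nonneg: "0 \<le> mean_count t"
  unfolding mean_count_def by (intro integral_nonneg_AE) (auto simp: piece_count_bounds)

lemma mean_count_ge_1: "1 \<le> t \<Longrightarrow> mean_count t = real b"
proof -
  assume "1 \<le> t"
  then have "AE v in D. piece_count t v = real b"
    using D_unit by (auto elim: eventually_mono intro: piece_count_ge_1)
  then have "mean_count t = (\<integral>v. real b \<partial>D)"
    unfolding mean_count_def by (intro integral_cong_AE) auto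
  then show ?thesis using M.prob_space by simp
qed

lemma mean_count_le: "mean_count t \<le> real b"
  using mean_count_mono[of t "max t 1"] mean_count_ge_1[of "max t 1"] by simp

lemma mean_count_right_limit: "(\<lambda>n. mean_count (t + inverse (real (Suc n)))) \<longlonglongrightarrow> mean_count t"
  unfolding mean_count_def
proof (rule integral_dominated_convergence[where w = "\<lambda>_. real b"])
  show "AE v in D. (\<lambda>n. piece_count (t + inverse (real (Suc n))) v) \<longlonglongrightarrow> piece_count t v"
  proof (intro AE_I2)
    fix v
    have "(\<lambda>n. if p \<le> t + inverse (real (Suc n)) then 1 else 0::real) \<longlonglongrightarrow> (if p \<le> t then 1 else 0)" for p
    proof (cases "p \<le> t")
      case False
      then have "\<forall>\<^sub>F n in sequentially. inverse (real (Suc n)) < p - t"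
        using LIMSEQ_inverse_real_of_nat by (intro order_tendstoD) auto
      then show ?thesis
        using False by (intro tendsto_eventually) (auto elim: eventually_mono)
    qed (auto intro!: tendsto_eventually always_eventually add_increasing2)
    then show "(\<lambda>n. piece_count (t + inverse (real (Suc n))) v) \<longlonglongrightarrow> piece_count t v"
      unfolding piece_count_conv_sum by (intro tendsto_sum)
  qed
qed (auto simp: piece_count_bounds)

text \<open>From below, the condition \<open>p \<le> t - inverse (real (Suc n))\<close> eventually
  decides \<open>p < t\<close>. Left continuity of \<open>mean_count\<close> at \<open>t\<close>
  therefore amounts to equality with \<open>exp_pieces b D t\<close>.\<close>

lemma mean_count_left_limit: "(\<lambda>n. mean_count (t - inverse (real (Suc n)))) \<longlonglongrightarrow> exp_pieces b D t"
  unfolding mean_count_def exp_pieces_def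
proof (rule integral_dominated_convergence[where w = "\<lambda>_. real b"])
  show "AE v in D. (\<lambda>n. piece_count (t - inverse (real (Suc n))) v)
    \<longlonglongrightarrow> real (length (filter (\<lambda>p. p < t) (pieces b v)))"
  proof (intro AE_I2)
    fix v
    have "(\<lambda>n. if p \<le> t - inverse (real (Suc n)) then 1 else 0::real) \<longlonglongrightarrow> (if p < t then 1 else 0)" for p
    proof (cases "p < t")
      case True
      then have "\<forall>\<^sub>F n in sequentially. inverse (real (Suc n)) < t - p"
        using LIMSEQ_inverse_real_of_nat by (intro order_tendstoD) auto
      then show ?thesis
        using True by (intro tendsto_eventually) (auto elim: eventually_mono)
    next
      case False
      then have "\<not> p \<le> t - inverse (real (Suc n))" for n
        using positive_imp_inverse_positive[of "real (Suc n)"] by linarith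
      then show ?thesis using False by simp
    qed
    then show "(\<lambda>n. piece_count (t - inverse (real (Suc n))) v)
      \<longlonglongrightarrow> real (length (filter (\<lambda>p. p < t) (pieces b v)))"
      unfolding piece_count_conv_sum count_less_conv_sum by (intro tendsto_sum)
  qed
qed (auto simp: piece_count_bounds)

lemma exp_pieces_le_mean_count: "exp_pieces b D t \<le> mean_count t"
  unfolding exp_pieces_def mean_count_def
  by (intro integral_mono) (auto simp: piece_count_def intro!: length_filter_mono)

lemma mean_count_le_exp_pieces: "s < t \<Longrightarrow> mean_count s \<le> exp_pieces b D t"
  unfolding exp_pieces_def mean_count_def
  by (intro integral_mono) (auto simp: piece_count_def intro!: length_filter_mono)

text \<open>Almost surely every piece is shorter than 1, so \<open>mean_count\<close> has no jump at
  1. This gives continuity at the right endpoint.\<close>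

lemma exp_pieces_1: "exp_pieces b D 1 = real b"
proof -
  have "AE v in D. real (length (filter (\<lambda>p. p < 1) (pieces b v))) = real b"
    using D_unit
  proof eventually_elim
    case (elim v)
    then have "filter (\<lambda>p. p < 1) (pieces b v) = pieces b v"
      using pieces_less_1[OF b elim] by (intro filter_True) auto
    then show ?case using b1 by simp
  qed
  then have "exp_pieces b D 1 = (\<integral>v. real b \<partial>D)"
    unfolding exp_pieces_def by (intro integral_cong_AE) auto
  then show ?thesis using M.prob_space by simp
qed

text \<open>Continuity of \<open>exp_pieces\<close> squeezes \<open>mean_count\<close> onto it
  inside the interval, so the one-sided limits agree. The closed interval is wanted for compactness:
  the grid argument below needs uniform continuity up to the ends.\<close>

lemma continuous_on_mean_count:
  assumes "continuous_on {0<..<1} (exp_pieces b D)"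
  shows "continuous_on {0..1} mean_count"
proof -
  have eq: "exp_pieces b D x = mean_count x" if x: "x \<in> {0<..1}" for x
  proof (cases "x = 1")
    case True
    then show ?thesis by (simp add: exp_pieces_1 mean_count_ge_1)
  next
    case False
    then have "isCont (exp_pieces b D) x"
      using assms x by (simp add: continuous_on_eq_continuous_at)
    moreover have "(\<lambda>n. x + inverse (real (Suc n))) \<longlonglongrightarrow> x"
      using tendsto_add[OF tendsto_const LIMSEQ_inverse_real_of_nat, of x] by (simp del: of_nat_Suc)
    ultimately have "(\<lambda>n. exp_pieces b D (x + inverse (real (Suc n)))) \<longlonglongrightarrow> exp_pieces b D x"
      by (rule isCont_tendsto_compose)
    then have "mean_count x \<le> exp_pieces b D x"
      by (rule LIMSEQ_le_const) (auto intro!: mean_count_le_exp_pieces)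
    then show ?thesis using exp_pieces_le_mean_count[of x] by simp
  qed
  show ?thesis
    unfolding continuous_on_iff
  proof (intro ballI allI impI)
    fix x e :: real assume x: "x \<in> {0..1}" and e: "0 < e"
    have "\<forall>\<^sub>F n in sequentially. mean_count (x + inverse (real (Suc n))) < mean_count x + e"
      using mean_count_right_limit e by (intro order_tendstoD) auto
    then obtain n where n: "mean_count (x + inverse (real (Suc n))) < mean_count x + e"
      by (auto simp: eventually_sequentially)
    have right: "mean_count y < mean_count x + e" if "y < x + inverse (real (Suc n))" for y
      using mean_count_mono[of y "x + inverse (real (Suc n))"] that n by simp
    have "\<exists>d>0. \<forall>y\<in>{0..1}. x - d < y \<longrightarrow> mean_count x - e < mean_count y"
    proof (cases "x = 0")
      \<comment> \<open>At 0 only the right limit matters, so a positive expected number of pieces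
        of length 0 does no harm.\<close>
      case True
      then show ?thesis using e mean_count_mono[of x] by (force intro!: exI[of _ 1])
    next
      case False
      then have "\<forall>\<^sub>F n in sequentially. mean_count x - e < mean_count (x - inverse (real (Suc n)))"
        using mean_count_left_limit[of x] eq[of x] x e by (intro order_tendstoD) auto
      then obtain m where m: "mean_count x - e < mean_count (x - inverse (real (Suc m)))"
        by (auto simp: eventually_sequentially)
      show ?thesis
      proof (intro exI[of _ "inverse (real (Suc m))"] conjI ballI impI)
        fix y assume "x - inverse (real (Suc m)) < y"
        then show "mean_count x - e < mean_count y"
          by (intro less_le_trans[OF m] mean_count_mono less_imp_le)
      qed simp
    qed
    then obtain d where d: "0 < d" "\<forall>y\<in>{0..1}. x - d < y \<longrightarrow> mean_count x - e < mean_count y"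
      by blast
    show "\<exists>d>0. \<forall>y\<in>{0..1}. dist y x < d \<longrightarrow> dist (mean_count y) (mean_count x) < e"
    proof (intro exI[of _ "min d (inverse (real (Suc n)))"] conjI ballI impI)
      fix y :: real assume y: "y \<in> {0..1}" "dist y x < min d (inverse (real (Suc n)))"
      then have "y < x + inverse (real (Suc n))" "x - d < y" by (auto simp: dist_real_def)
      then show "dist (mean_count y) (mean_count x) < e"
        using right[of y] d(2) y(1) by (auto simp: dist_real_def abs_less_iff)
    qed (use d(1) in simp)
  qed
qed

text \<open>Glivenko-Cantelli argument: counts and means are monotone in \<open>t\<close>, so it
  suffices to control a finite grid on which \<open>mean_count\<close> varies by less than
  \<open>\<epsilon> / 2\<close> between neighbours. The other half of \<open>\<epsilon>\<close> is
  the deviation at the grid points. From \<open>t = 1\<close> on the counts are exactly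
  \<open>b\<close>.\<close>

lemma uniform_law_of_large_numbers:
  assumes cont: "continuous_on {0<..<1} (exp_pieces b D)" and \<epsilon>: "0 < \<epsilon>"
  shows "whp S (\<lambda>n \<omega>. \<forall>t\<ge>0. \<bar>(\<Sum>k<n. piece_count t (\<omega> k)) - real n * mean_count t\<bar> \<le> \<epsilon> * real n)"
proof -
  have "uniformly_continuous_on {0..1} mean_count"
    by (intro compact_uniformly_continuous continuous_on_mean_count cont) simp
  then obtain d where d: "0 < d"
    "\<And>s t. s \<in> {0..1} \<Longrightarrow> t \<in> {0..1} \<Longrightarrow> dist t s < d \<Longrightarrow> dist (mean_count t) (mean_count s) < \<epsilon> / 2"
    using \<epsilon> unfolding uniformly_continuous_on_def by (metis half_gt_zero)
  obtain K where K: "inverse (real (Suc K)) < d" using reals_Archimedean[OF d(1)] by blast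
  let ?q = "\<lambda>i. real i / real (Suc K)"
  have "whp S (\<lambda>n \<omega>. (\<forall>i\<in>{..Suc K}.
    \<bar>(\<Sum>k<n. piece_count (?q i) (\<omega> k)) - real n * mean_count (?q i)\<bar> \<le> \<epsilon> / 2 * real n)
    \<and> (\<forall>k. valid_division b (\<omega> k)))"
    using \<epsilon> unfolding mean_count_def
    by (intro P.whp_conj P.whp_ball_finite P.whp_AE AE_valid law_of_large_numbers[where B = "real b"])
       (auto simp: piece_count_bounds)
  then show ?thesis
  proof (rule P.whp_mono, intro allI impI)
    fix n \<omega> and t :: real
    assume *: "(\<forall>i\<in>{..Suc K}.
      \<bar>(\<Sum>k<n. piece_count (?q i) (\<omega> k)) - real n * mean_count (?q i)\<bar> \<le> \<epsilon> / 2 * real n)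
      \<and> (\<forall>k. valid_division b (\<omega> k))" and t: "0 \<le> t"
    have grid: "(\<Sum>k<n. piece_count (?q i) (\<omega> k)) \<le> real n * mean_count (?q i) + \<epsilon> / 2 * real n"
      "real n * mean_count (?q i) - \<epsilon> / 2 * real n \<le> (\<Sum>k<n. piece_count (?q i) (\<omega> k))"
      if "i \<le> Suc K" for i
      using conjunct1[OF *, THEN bspec, of i] that unfolding abs_le_iff atMost_iff by linarith+
    show "\<bar>(\<Sum>k<n. piece_count t (\<omega> k)) - real n * mean_count t\<bar> \<le> \<epsilon> * real n"
    proof (cases "t < 1")
      case False
      then show ?thesis using * \<epsilon> by (simp add: piece_count_ge_1 mean_count_ge_1)
    next
      case True
      define i where "i = nat \<lfloor>t * real (Suc K)\<rfloor>"
      have fl: "real i \<le> t * real (Suc K)" "t * real (Suc K) < real i + 1"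
        unfolding i_def using t by (simp_all del: of_nat_Suc)
      have "t * real (Suc K) < real (Suc K)" using True by simp
      then have i: "i < Suc K" using fl by (simp only: of_nat_less_iff[symmetric, where 'a = real])
      have q: "?q i \<le> t" "t < ?q (Suc i)" "?q (Suc i) - ?q i = inverse (real (Suc K))"
        using fl by (simp_all add: field_simps)
      have q01: "?q i \<in> {0..1}" "?q (Suc i) \<in> {0..1}" "t \<in> {0..1}"
        using i t True by (auto simp: field_simps)
      have "dist (?q (Suc i)) t < d" "dist (?q i) t < d"
        using q K unfolding dist_real_def by linarith+
      from d(2)[OF q01(3,2) this(1)] d(2)[OF q01(3,1) this(2)]
      have G: "mean_count (?q (Suc i)) \<le> mean_count t + \<epsilon> / 2" "mean_count t \<le> mean_count (?q i) + \<epsilon> / 2"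
        unfolding dist_real_def by linarith+
      have "(\<Sum>k<n. piece_count t (\<omega> k)) \<le> (\<Sum>k<n. piece_count (?q (Suc i)) (\<omega> k))"
        using q by (intro sum_mono piece_count_mono) simp
      also have "\<dots> \<le> real n * mean_count (?q (Suc i)) + \<epsilon> / 2 * real n"
        using i by (intro grid) simp
      also have "\<dots> \<le> real n * (mean_count t + \<epsilon> / 2) + \<epsilon> / 2 * real n"
        using G by (intro add_right_mono mult_left_mono) auto
      finally have 1: "(\<Sum>k<n. piece_count t (\<omega> k)) \<le> real n * mean_count t + \<epsilon> * real n"
        by (simp add: algebra_simps)
      have "real n * mean_count t - \<epsilon> * real n \<le> real n * (mean_count (?q i) + \<epsilon> / 2) - \<epsilon> * real n"
        using G by (intro diff_right_mono mult_left_mono) auto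
      also have "\<dots> = real n * mean_count (?q i) - \<epsilon> / 2 * real n"
        by (simp add: algebra_simps)
      also have "\<dots> \<le> (\<Sum>k<n. piece_count (?q i) (\<omega> k))"
        using i by (intro grid) simp
      also have "\<dots> \<le> (\<Sum>k<n. piece_count t (\<omega> k))"
        using q by (intro sum_mono piece_count_mono) simp
      finally show ?thesis using 1 by (simp add: abs_le_iff)
    qed
  qed
qed

text \<open>Excludes the limit \<open>c = 0\<close>, which the definition of \<^const>\<open>mean_stationary\<close> alone would allow.\<close>

lemma mean_spacing_lower_bound:
  obtains \<kappa> where "0 < \<kappa>"
    "whp S (\<lambda>n \<omega>. \<kappa> \<le> 1 / (largest b \<omega> n * real (Suc (n * (b - 1)))))"
proof -
  define \<mu> where "\<mu> = (\<integral>v. defect b v \<partial>D)"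
  have def01: "AE v in D. defect b v \<in> {0..1 / 2}"
    using D_unit
  proof eventually_elim
    case (elim v)
    show ?case using defect_le(1,3)[OF b elim] by simp
  qed
  have int: "integrable D (defect b)"
    by (rule M.integrable_const_bound[of _ "1 / 2"])
       (auto intro!: eventually_mono[OF def01])
  have "\<mu> \<noteq> 0"
  proof
    assume "\<mu> = 0"
    then have "AE v in D. defect b v = 0"
      unfolding \<mu>_def using int
      by (subst (asm) integral_nonneg_eq_0_iff_AE) (auto intro!: eventually_mono[OF def01])
    with D_unit have "AE v in D. False"
      by eventually_elim (metis defect_le(3)[OF b] less_irrefl)
    then show False by simp
  qed
  moreover have "0 \<le> \<mu>" 
    unfolding \<mu>_def by (intro integral_nonneg_AE) (auto intro!: eventually_mono[OF def01])
  ultimately have \<mu>: "0 < \<mu>" by simp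
  have bb: "0 < real (2 * b)" using b by simp
  have "whp S (\<lambda>n \<omega>. \<bar>(\<Sum>k<n. defect b (\<omega> k)) - real n * \<mu>\<bar> \<le> \<mu> / 2 * real n)"
    unfolding \<mu>_def using \<mu> unfolding \<mu>_def
    by (intro law_of_large_numbers[OF measurable_defect def01]) simp
  \<comment> \<open>The defects add up to at least \<open>\<mu> * n / 2\<close>, so
    \<open>L_n * n \<le> 2 / \<mu>\<close>. With \<open>N_n \<le> b * n\<close> this yields the
    constant \<open>\<mu> / (2 * b)\<close>.\<close>
  from this P.whp_AE[OF AE_valid]
  have "whp S (\<lambda>n \<omega>. \<mu> / real (2 * b) \<le> 1 / (largest b \<omega> n * real (Suc (n * (b - 1)))))"
  proof (rule P.whp_eventually_combine)
    show "\<forall>\<^sub>F n in sequentially. \<forall>\<omega>. \<bar>(\<Sum>k<n. defect b (\<omega> k)) - real n * \<mu>\<bar> \<le> \<mu> / 2 * real n \<longrightarrow>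
      (\<forall>k. valid_division b (\<omega> k)) \<longrightarrow> \<mu> / real (2 * b) \<le> 1 / (largest b \<omega> n * real (Suc (n * (b - 1))))"
      using eventually_gt_at_top[of 0]
    proof eventually_elim
      case (elim n)
      show ?case
      proof (intro allI impI)
        fix \<omega> assume lln: "\<bar>(\<Sum>k<n. defect b (\<omega> k)) - real n * \<mu>\<bar> \<le> \<mu> / 2 * real n"
          and valid: "\<forall>k. valid_division b (\<omega> k)"
        let ?L = "largest b \<omega> n"
        have L: "0 < ?L" by (rule largest_pos[OF b1])
        have "Suc (n * (b - 1)) \<le> b * n"
          using elim b by (cases b) (auto simp: algebra_simps)
        then have N: "real (Suc (n * (b - 1))) \<le> real b * real n"
          by (metis of_nat_le_iff of_nat_mult)
        have "\<mu> / 2 * real n \<le> (\<Sum>k<n. defect b (\<omega> k))"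
          using lln mult.commute[of "real n" \<mu>] by linarith
        then have "?L * (\<mu> / 2 * real n) \<le> ?L * (\<Sum>k<n. defect b (\<omega> k))"
          using L by (intro mult_left_mono) auto
        also have "\<dots> \<le> 1"
          using valid by (intro largest_mult_sum_defect_le_1[OF b]) simp
        finally have "?L * (\<mu> / 2 * real n) \<le> 1" .
        then have Ln: "?L * real n * \<mu> \<le> 2" by (simp add: algebra_simps)
        let ?X = "?L * real (Suc (n * (b - 1)))"
        have X: "0 < ?X" using L by (simp del: of_nat_Suc)
        have "\<mu> * ?X \<le> \<mu> * (?L * (real b * real n))"
          by (rule mult_left_mono[OF mult_left_mono[OF N less_imp_le[OF L]] less_imp_le[OF \<mu>]])
        also have "\<dots> = (?L * real n * \<mu>) * real b" by (simp only: mult_ac)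
        also have "\<dots> \<le> 2 * real b" by (rule mult_right_mono[OF Ln]) simp
        finally have "\<mu> / real (2 * b) * ?X \<le> 1"
          using bb by (simp only: times_divide_eq_left divide_le_eq_1_pos of_nat_mult of_nat_numeral)
        then show "\<mu> / real (2 * b) \<le> 1 / ?X"
          unfolding pos_le_divide_eq[OF X] .
      qed
    qed
  qed
  then show thesis using \<mu> bb by (intro that[of "\<mu> / real (2 * b)"]) simp_all
qed

end

section \<open>From the mean spacing to the spacing distribution\<close>

lemma sum_list_take_le:
  assumes "\<forall>x\<in>set s. (0::real) \<le> x"
  shows "sum_list (take k s) \<le> sum_list s"
proof -
  have "sum_list s = sum_list (take k s) + sum_list (drop k s)"
    by (metis append_take_drop_id sum_list_append)
  moreover have "0 \<le> sum_list (drop k s)"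
    using assms by (intro sum_list_nonneg) (auto dest: in_set_dropD)
  ultimately show ?thesis by simp
qed

text \<open>At \<open>y = 1\<close> every spacing is counted, which links
  \<open>mean_spacing\<close> to the quantity \<open>1 / (L_n N_n)\<close> common to both
  notions.\<close>

lemma mean_spacing_1:
  assumes "1 \<le> b" "\<And>k. valid_division b (\<omega> k)"
  shows "mean_spacing b \<omega> n 1 = 1 / (largest b \<omega> n * real (Suc (n * (b - 1))))"
proof -
  let ?s = "frag_state b \<omega> n"
  have "sum_list (take k ?s) \<le> 1" for k
    using sum_list_take_le[of ?s k] frag_state_nonneg[OF assms] sum_list_frag_state[OF assms(1)]
    by auto
  then have "{k. 1 \<le> k \<and> k \<le> length ?s \<and> sum_list (take k ?s) \<le> 1} = {1..length ?s}"
    by auto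
  then have "count_in ?s 1 = length ?s" by (simp add: count_in_def)
  then show ?thesis by (simp add: mean_spacing_def length_frag_state[OF assms(1)])
qed

section \<open>Estimates for the discretisation of time\<close>

lemma sum_lessThan_blocks:
  fixes h :: "nat \<Rightarrow> real"
  assumes "a 0 = 0" "\<And>j. a j \<le> a (Suc j)"
  shows "(\<Sum>k<a m. h k) = (\<Sum>j<m. \<Sum>k=a j..<a (Suc j). h k)"
proof (induction m)
  case (Suc m)
  have "(\<Sum>k<a (Suc m). h k) = (\<Sum>k<a m. h k) + (\<Sum>k=a m..<a (Suc m). h k)"
    using sum.atLeastLessThan_concat[of 0 "a m" "a (Suc m)" h] assms(2)
    by (simp add: atLeast0LessThan)
  then show ?case using Suc by simp
qed (simp add: assms(1))

lemma abs_diff_mult_right: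
  fixes x y z :: real
  assumes "0 < z"
  shows "\<bar>x - y\<bar> * z = \<bar>x * z - y * z\<bar>"
  using assms by (simp add: abs_mult flip: left_diff_distrib)

lemma real_div_bounds:
  assumes "0 < (M::nat)"
  shows "real (j * n div M) \<le> real j * real n / real M"
    and "real j * real n / real M - 1 < real (j * n div M)"
proof -
  have "real (M * (j * n div M) + j * n mod M) = real (j * n)"
    by (simp only: mult_div_mod_eq)
  then have eq: "real M * real (j * n div M) + real (j * n mod M) = real j * real n"
    by (simp only: of_nat_add of_nat_mult)
  have "0 \<le> real (j * n mod M)" "real (j * n mod M) < real M"
    using assms by simp_all
  then have "real M * real (j * n div M) \<le> real j * real n"
    "real j * real n < real M * real (j * n div M) + real M"
    using eq by linarith+
  then show "real (j * n div M) \<le> real j * real n / real M"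
    "real j * real n / real M - 1 < real (j * n div M)"
    using assms by (simp_all add: field_simps)
qed

lemma filterlim_mult_div_at_top:
  assumes "0 < (j::nat)" "0 < M"
  shows "filterlim (\<lambda>n. j * n div M) at_top sequentially"
  unfolding filterlim_at_top eventually_sequentially
proof (intro allI exI impI)
  fix Z n assume "Z * M \<le> n"
  also have "n \<le> j * n" using assms(1) by simp
  finally show "Z \<le> j * n div M" using assms(2) by (simp add: less_eq_div_iff_mult_less_eq)
qed

text \<open>Ratios of mesh sizes are known only up to neighbouring grid points, which shifts the
  index in a Riemann sum; for bounded \<open>g\<close> such a shift costs boundary terms only. In
  the second bound \<open>0 - 1 = 0\<close> repeats the term \<open>g 0\<close>.\<close>

lemma sum_shift_le:
  fixes g :: "nat \<Rightarrow> real"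
  assumes "\<And>j. 0 \<le> g j" "\<And>j. g j \<le> B"
  shows "(\<Sum>j<M. g (j + 2)) \<le> (\<Sum>j<M. g j) + 2 * B"
    and "(\<Sum>j<M. g j) - B \<le> (\<Sum>j<M. g (j - 1))"
proof -
  have "(\<Sum>j<M. g (j + 2)) = (\<Sum>j<M. g j) - g 0 - g 1 + g M + g (M + 1)"
    by (induction M) simp_all
  then show "(\<Sum>j<M. g (j + 2)) \<le> (\<Sum>j<M. g j) + 2 * B"
    using assms(1)[of 0] assms(1)[of 1] assms(2)[of M] assms(2)[of "M + 1"] by linarith
  have "(\<Sum>j<M. g (j - 1)) = (if M = 0 then 0 else (\<Sum>j<M. g j) + g 0 - g (M - 1))"
    by (induction M) auto
  moreover have "0 \<le> B" using assms[of 0] by linarith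
  ultimately show "(\<Sum>j<M. g j) - B \<le> (\<Sum>j<M. g (j - 1))"
    using assms(1)[of 0] assms(2)[of "M - 1"] by (auto split: if_splits)
qed

context fragmentation
begin

lemma le_length_frag_state: "real n \<le> real (Suc (n * (b - 1)))"
proof -
  have "n * 1 \<le> n * (b - 1)" using b by (intro mult_le_mono2) simp
  then show ?thesis by (simp only: of_nat_le_iff)
qed

text \<open>At a common sample point the quantity is at least \<open>\<kappa>\<close> and within
  \<open>\<kappa> / 2\<close> of \<open>c\<close>.\<close>

lemma limit_positive:
  assumes "\<And>\<epsilon>. 0 < \<epsilon> \<Longrightarrow>
    whp S (\<lambda>n \<omega>. \<bar>1 / (largest b \<omega> n * real (Suc (n * (b - 1)))) - c\<bar> \<le> \<epsilon>)"
  shows "0 < c"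
proof -
  obtain \<kappa> where \<kappa>: "0 < \<kappa>"
    "whp S (\<lambda>n \<omega>. \<kappa> \<le> 1 / (largest b \<omega> n * real (Suc (n * (b - 1)))))"
    by (rule mean_spacing_lower_bound)
  have "0 < \<kappa> / 2" using \<kappa>(1) by simp
  from whp_ex[OF P.whp_conj[OF \<kappa>(2) assms[OF this]]]
  obtain n \<omega> where "\<kappa> \<le> 1 / (largest b \<omega> n * real (Suc (n * (b - 1))))
    \<and> \<bar>1 / (largest b \<omega> n * real (Suc (n * (b - 1)))) - c\<bar> \<le> \<kappa> / 2"
    by (elim exE)
  then show ?thesis using \<kappa>(1) by linarith
qed

text \<open>With \<open>r_k = 1 / (L_k N_k)\<close> and \<open>a = j * n div M\<close> the ratio
  equals \<open>(r_a / r_n) * (N_a / N_n)\<close>. The first factor tends to 1 because both times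
  tend to infinity, the second to \<open>j / M\<close>.\<close>

lemma largest_ratio_limit:
  assumes c: "0 < c"
    and conv: "\<And>\<epsilon>. 0 < \<epsilon> \<Longrightarrow>
      whp S (\<lambda>n \<omega>. \<bar>1 / (largest b \<omega> n * real (Suc (n * (b - 1)))) - c\<bar> \<le> \<epsilon>)"
    and j: "0 < j" "j \<le> M" and \<eta>: "0 < \<eta>"
  shows "whp S (\<lambda>n \<omega>. \<bar>largest b \<omega> n / largest b \<omega> (j * n div M) - real j / real M\<bar> \<le> \<eta>)"
proof -
  \<comment> \<open>The bound \<open>c / 2\<close> keeps \<open>r_n\<close> away from 0; the bound
    \<open>\<eta> * c / 8\<close> puts \<open>r_a\<close> and \<open>r_n\<close> within
    \<open>\<eta> * c / 4\<close> of each other, hence a relative error of at most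
    \<open>\<eta> / 2\<close>.\<close>
  define \<theta> where "\<theta> = min (c / 2) (\<eta> * c / 8)"
  have \<theta>: "0 < \<theta>" "\<theta> \<le> c / 2" "\<theta> \<le> \<eta> * c / 8" using c \<eta> by (auto simp: \<theta>_def)
  have M: "0 < M" using j by simp
  have A: "whp S (\<lambda>n \<omega>. \<bar>1 / (largest b \<omega> (j * n div M) * real (Suc ((j * n div M) * (b - 1)))) - c\<bar> \<le> \<theta>)"
    by (rule whp_subseq[OF conv[OF \<theta>(1)] filterlim_mult_div_at_top[OF j(1) M]])
  have B: "whp S (\<lambda>n \<omega>. \<bar>1 / (largest b \<omega> n * real (Suc (n * (b - 1)))) - c\<bar> \<le> \<theta>)"
    by (rule conv[OF \<theta>(1)])
  show ?thesis
  proof (rule P.whp_eventually_combine[OF A B])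
    obtain n0 :: nat where n0: "2 * real b / \<eta> \<le> real n0"
      using real_arch_simple by blast
    show "\<forall>\<^sub>F n in sequentially. \<forall>\<omega>.
      \<bar>1 / (largest b \<omega> (j * n div M) * real (Suc ((j * n div M) * (b - 1)))) - c\<bar> \<le> \<theta> \<longrightarrow>
      \<bar>1 / (largest b \<omega> n * real (Suc (n * (b - 1)))) - c\<bar> \<le> \<theta> \<longrightarrow>
      \<bar>largest b \<omega> n / largest b \<omega> (j * n div M) - real j / real M\<bar> \<le> \<eta>"
      using eventually_ge_at_top[of "max 1 n0"]
    proof eventually_elim
      case (elim n)
      define a where "a = j * n div M"
      define Na Nn where "Na = real (Suc (a * (b - 1)))" and "Nn = real (Suc (n * (b - 1)))"
      have pos: "0 < Na" "0 < Nn" by (simp_all add: Na_def Nn_def del: of_nat_Suc)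
      have "j * n div M \<le> M * n div M" using j by (intro div_le_mono mult_le_mono) auto
      then have "a \<le> n" using M by (simp add: a_def)
      then have "Na \<le> Nn" unfolding Na_def Nn_def by (simp add: mult_right_mono)
      then have Q01: "0 \<le> Na / Nn" "Na / Nn \<le> 1" using pos by simp_all
      have Nn_ge: "real n \<le> Nn"
        unfolding Nn_def by (rule le_length_frag_state)
      have npos: "0 < real n" and n_large: "2 * real b / \<eta> \<le> real n"
        using elim n0 by auto
      have Na_eq: "Na = 1 + real a * real (b - 1)" and Nn_eq: "Nn = 1 + real n * real (b - 1)"
        unfolding Na_def Nn_def by simp_all
      have jM: "0 \<le> real j / real M" "real j / real M \<le> 1" using j by auto
      have e1: "Na - real j / real M * Nn = 1 - real j / real M
        - (real j * real n / real M - real a) * real (b - 1)"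
        unfolding Na_eq Nn_eq by (simp add: algebra_simps)
      have e2: "0 \<le> real j * real n / real M - real a" "real j * real n / real M - real a \<le> 1"
        using real_div_bounds[OF M, of j n] unfolding a_def by linarith+
      have "(real j * real n / real M - real a) * real (b - 1) \<le> 1 * real (b - 1)"
        using e2 by (intro mult_right_mono) auto
      moreover have "0 \<le> (real j * real n / real M - real a) * real (b - 1)"
        using e2 by simp
      moreover have "real (b - 1) + 1 = real b" using b by simp
      ultimately have "\<bar>Na - real j / real M * Nn\<bar> \<le> real b"
        using jM unfolding e1 by linarith
      then have "\<bar>Na / Nn - real j / real M\<bar> * Nn \<le> real b"
        unfolding abs_diff_mult_right[OF pos(2)] using pos by simp
      also have "real b \<le> \<eta> / 2 * real n"
        using n_large \<eta> by (simp add: field_simps)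
      also have "\<dots> \<le> \<eta> / 2 * Nn" using Nn_ge \<eta> by simp
      finally have quot: "\<bar>Na / Nn - real j / real M\<bar> \<le> \<eta> / 2"
        using pos by simp
      show ?case
      proof (intro allI impI)
        fix \<omega>
        define ra rn where "ra = 1 / (largest b \<omega> a * Na)" and "rn = 1 / (largest b \<omega> n * Nn)"
        assume "\<bar>1 / (largest b \<omega> (j * n div M) * real (Suc ((j * n div M) * (b - 1)))) - c\<bar> \<le> \<theta>"
          "\<bar>1 / (largest b \<omega> n * real (Suc (n * (b - 1)))) - c\<bar> \<le> \<theta>"
        then have r: "\<bar>ra - c\<bar> \<le> \<theta>" "\<bar>rn - c\<bar> \<le> \<theta>"
          unfolding ra_def rn_def a_def Na_def Nn_def by simp_all
        have L: "0 < largest b \<omega> a" "0 < largest b \<omega> n" by (rule largest_pos[OF b1])+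
        have eq: "largest b \<omega> n / largest b \<omega> a = ra / rn * (Na / Nn)"
          unfolding ra_def rn_def using L pos by (simp add: field_simps)
        have rn: "c / 2 \<le> rn" using r(2) \<theta>(2) by linarith
        then have rn_pos: "0 < rn" using c by simp
        have "\<bar>ra / rn - 1\<bar> * rn = \<bar>ra - rn\<bar>"
          unfolding abs_diff_mult_right[OF rn_pos] using rn_pos by simp
        also have "\<dots> \<le> \<eta> / 2 * (c / 2)" using r \<theta>(3) by linarith
        also have "\<dots> \<le> \<eta> / 2 * rn" using rn \<eta> by (intro mult_left_mono) auto
        finally have "\<bar>ra / rn - 1\<bar> \<le> \<eta> / 2"
          using rn c by simp
        then have "\<bar>(ra / rn - 1) * (Na / Nn)\<bar> \<le> \<eta> / 2 * 1"
          unfolding abs_mult using Q01 \<eta> by (intro mult_mono) auto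
        then have "\<bar>ra / rn * (Na / Nn) - real j / real M\<bar> \<le> \<eta>"
          using quot unfolding left_diff_distrib mult_1 by linarith
        then show "\<bar>largest b \<omega> n / largest b \<omega> (j * n div M) - real j / real M\<bar> \<le> \<eta>"
          using eq by (simp only: a_def)
      qed
    qed
  qed
qed

text \<open>The pathwise core of the limit theorem. The times before \<open>n\<close> are cut into
  \<open>M\<close> blocks on which \<open>L_n / L_k\<close> is nearly constant. Monotonicity of the
  counts allows this ratio to be replaced by a grid value, after which the law of large numbers
  applies to each block as a difference of two initial sums. The three error terms stem from the
  shift of the grid index, the rounding of the block ends, and the law of large numbers.\<close>

lemma small_count_estimate:
  fixes \<omega> :: "nat \<Rightarrow> nat \<Rightarrow> real"
  assumes valid: "\<And>k. valid_division b (\<omega> k)" and M: "0 < M" and n: "0 < n" and x: "x \<in> {0..<1}"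
    and ratio: "\<And>j. 0 < j \<Longrightarrow> j \<le> M \<Longrightarrow>
      \<bar>largest b \<omega> n / largest b \<omega> (j * n div M) - real j / real M\<bar> \<le> 1 / real M"
    and lln: "\<And>j t. j \<le> M \<Longrightarrow> 0 \<le> t \<Longrightarrow>
      \<bar>(\<Sum>k<j * n div M. piece_count t (\<omega> k)) - real (j * n div M) * mean_count t\<bar> \<le> \<epsilon> * real n"
  shows "\<bar>real (length (filter (\<lambda>l. l \<le> x * largest b \<omega> n) (frag_state b \<omega> n)))
      - real n / real M * (\<Sum>j<M. mean_count (x * (real j / real M)))\<bar>
    \<le> 2 * real b * real n / real M + real M * real b + 2 * real M * \<epsilon> * real n"
proof -
  define L where "L = largest b \<omega>"
  define a where "a = (\<lambda>j. j * n div M)"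
  define T where "T = (\<lambda>k. real (length (filter (\<lambda>p. L k * p \<le> x * L n) (pieces b (\<omega> k)))))"
  define g where "g = (\<lambda>j::nat. mean_count (x * (real j / real M)))"
  have L: "0 < L k" "j \<le> k \<Longrightarrow> L k \<le> L j" for j k
    unfolding L_def by (rule largest_pos[OF b1], rule largest_antimono[OF b1 valid])
  have xL: "x * L n < L k" if "k \<le> n" for k
  proof -
    have "x * L n < 1 * L n" using x L(1) by (intro mult_strict_right_mono) auto
    also have "\<dots> \<le> L k" using L(2)[OF that] by simp
    finally show ?thesis .
  qed
  have "x * L n < 1" using xL[of 0] by (simp add: L_def largest_0)
  then have total: "real (length (filter (\<lambda>l. l \<le> x * L n) (frag_state b \<omega> n))) = (\<Sum>k<n. T k)"
    using length_filter_frag_state[OF b1, of "x * L n" n \<omega>] xL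
    by (simp add: T_def L_def)
  have T: "T k = piece_count (x * (L n / L k)) (\<omega> k)" for k
    unfolding T_def piece_count_def using L(1)[of k]
    by (simp add: pos_le_divide_eq mult.commute)
  have a: "a 0 = 0" "a M = n" "a j \<le> a (Suc j)" for j
    unfolding a_def using M by (auto intro!: div_le_mono)
  have blocks: "(\<Sum>k<n. T k) = (\<Sum>j<M. \<Sum>k=a j..<a (Suc j). T k)"
    using sum_lessThan_blocks[of a T M] a by simp
  have g: "0 \<le> g j" "g j \<le> real b" for j
    unfolding g_def by (rule mean_count_nonneg, rule mean_count_le)
  have size: "\<bar>real (a (Suc j)) - real (a j) - real n / real M\<bar> \<le> 1" for j
  proof -
    have "real (Suc j) * real n / real M = real j * real n / real M + real n / real M"
      by (simp add: add_divide_distrib distrib_right)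
    then show ?thesis
      using real_div_bounds[OF M, of j n] real_div_bounds[OF M, of "Suc j" n]
      unfolding a_def by linarith
  qed
  have block: "\<bar>(\<Sum>k=a j..<a (Suc j). piece_count (x * (real i / real M)) (\<omega> k)) - real n / real M * g i\<bar>
    \<le> real b + 2 * \<epsilon> * real n" if "j < M" for i j
  proof -
    let ?t = "x * (real i / real M)"
    have t: "0 \<le> ?t" using x by simp
    let ?S = "\<lambda>m. \<Sum>k<m. piece_count ?t (\<omega> k)"
    have "(\<Sum>k=a j..<a (Suc j). piece_count ?t (\<omega> k)) = ?S (a (Suc j)) - ?S (a j)"
      using sum.atLeastLessThan_concat[of 0 "a j" "a (Suc j)" "\<lambda>k. piece_count ?t (\<omega> k)"] a(3)
      by (simp add: atLeast0LessThan)
    moreover have "\<bar>?S (a (Suc j)) - real (a (Suc j)) * g i\<bar> \<le> \<epsilon> * real n"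
      unfolding a_def g_def using that by (intro lln t) simp
    moreover have "\<bar>?S (a j) - real (a j) * g i\<bar> \<le> \<epsilon> * real n"
      unfolding a_def g_def using that by (intro lln t) simp
    moreover have "\<bar>(real (a (Suc j)) - real (a j) - real n / real M) * g i\<bar> \<le> 1 * real b"
      unfolding abs_mult using size g by (intro mult_mono) auto
    moreover have "(real (a (Suc j)) - real (a j) - real n / real M) * g i
      = real (a (Suc j)) * g i - real (a j) * g i - real n / real M * g i"
      by (simp only: left_diff_distrib)
    ultimately show ?thesis by linarith
  qed
  \<comment> \<open>The block ends at grid point \<open>Suc j\<close>, and the ratio there may err
    by one more grid step.\<close>
  have ratio_le: "L n / L k \<le> real (j + 2) / real M" if "j < M" "k < a (Suc j)" for j k
  proof -
    have "L n / L k \<le> L n / L (a (Suc j))"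
      using that L(1) L(2)[of k "a (Suc j)"] by (intro divide_left_mono) (auto intro: less_imp_le)
    also have "\<dots> \<le> real (Suc j) / real M + 1 / real M"
      using ratio[of "Suc j"] that(1) unfolding L_def a_def by (simp add: abs_le_iff)
    finally show ?thesis by (simp add: add_divide_distrib[symmetric])
  qed
  \<comment> \<open>\<open>ratio\<close> says nothing about \<open>j = 0\<close>; there the
    truncated index \<open>0 - 1 = 0\<close> makes the bound trivial.\<close>
  have ratio_ge: "real (j - 1) / real M \<le> L n / L k" if "j < M" "a j \<le> k" for j k
  proof (cases "j = 0")
    case True
    then show ?thesis using L(1)[of n] L(1)[of k] by simp
  next
    case False
    have "real (j - 1) / real M = real j / real M - 1 / real M"
      using False by (simp add: diff_divide_distrib of_nat_diff)
    also have "\<dots> \<le> L n / L (a j)"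
      using ratio[of j] that(1) False unfolding L_def a_def by linarith
    also have "\<dots> \<le> L n / L k"
      using that L(1) L(2)[of "a j" k] by (intro divide_left_mono) (auto intro: less_imp_le)
    finally show ?thesis .
  qed
  have "(\<Sum>k<n. T k) \<le> (\<Sum>j<M. real n / real M * g (j + 2) + (real b + 2 * \<epsilon> * real n))"
    unfolding blocks
  proof (rule sum_mono)
    fix j assume j: "j \<in> {..<M}"
    have "(\<Sum>k=a j..<a (Suc j). T k)
      \<le> (\<Sum>k=a j..<a (Suc j). piece_count (x * (real (j + 2) / real M)) (\<omega> k))"
      unfolding T using j x ratio_le[of j]
      by (intro sum_mono piece_count_mono mult_left_mono) auto
    also have "\<dots> \<le> real n / real M * g (j + 2) + (real b + 2 * \<epsilon> * real n)"
      using block[of j "j + 2"] j unfolding lessThan_iff by linarith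
    finally show "(\<Sum>k=a j..<a (Suc j). T k) \<le> real n / real M * g (j + 2) + (real b + 2 * \<epsilon> * real n)" .
  qed
  also have "\<dots> = real n / real M * (\<Sum>j<M. g (j + 2)) + real M * (real b + 2 * \<epsilon> * real n)"
    by (simp add: sum.distrib sum_distrib_left)
  also have "\<dots> \<le> real n / real M * ((\<Sum>j<M. g j) + 2 * real b) + real M * (real b + 2 * \<epsilon> * real n)"
    by (intro add_right_mono mult_left_mono sum_shift_le(1) g) simp
  also have "\<dots> = real n / real M * (\<Sum>j<M. g j)
    + (2 * real b * real n / real M + real M * real b + 2 * real M * \<epsilon> * real n)"
    by (simp add: algebra_simps add_divide_distrib)
  finally have upper: "(\<Sum>k<n. T k) \<le> \<dots>" .
  have "real n / real M * ((\<Sum>j<M. g j) - real b) - real M * (real b + 2 * \<epsilon> * real n)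
    \<le> real n / real M * (\<Sum>j<M. g (j - 1)) - real M * (real b + 2 * \<epsilon> * real n)"
    by (intro diff_right_mono mult_left_mono sum_shift_le(2) g) simp
  also have "\<dots> = (\<Sum>j<M. real n / real M * g (j - 1) - (real b + 2 * \<epsilon> * real n))"
    by (simp add: sum_subtractf sum_distrib_left)
  also have "\<dots> \<le> (\<Sum>k<n. T k)"
    unfolding blocks
  proof (rule sum_mono)
    fix j assume j: "j \<in> {..<M}"
    have "real n / real M * g (j - 1) - (real b + 2 * \<epsilon> * real n)
      \<le> (\<Sum>k=a j..<a (Suc j). piece_count (x * (real (j - 1) / real M)) (\<omega> k))"
      using block[of j "j - 1"] j unfolding lessThan_iff by linarith
    also have "\<dots> \<le> (\<Sum>k=a j..<a (Suc j). T k)"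
      unfolding T using j x ratio_ge[of j]
      by (intro sum_mono piece_count_mono mult_left_mono) auto
    finally show "real n / real M * g (j - 1) - (real b + 2 * \<epsilon> * real n)
      \<le> (\<Sum>k=a j..<a (Suc j). T k)" .
  qed
  finally have lower: "real n / real M * ((\<Sum>j<M. g j) - real b) - real M * (real b + 2 * \<epsilon> * real n)
    \<le> (\<Sum>k<n. T k)" .
  moreover have "real n / real M * ((\<Sum>j<M. g j) - real b) - real M * (real b + 2 * \<epsilon> * real n)
    = real n / real M * (\<Sum>j<M. g j) - (real b * real n / real M + real M * real b + 2 * real M * \<epsilon> * real n)"
    by (simp add: algebra_simps add_divide_distrib)
  moreover have "0 \<le> real b * real n / real M" by simp
  moreover have "2 * real b * real n / real M = real b * real n / real M + real b * real n / real M"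
    by simp
  ultimately show ?thesis
    using upper unfolding total[unfolded L_def] g_def L_def by linarith
qed

lemma spacing_stationary_if_mean_converges:
  assumes cont: "continuous_on {0<..<1} (exp_pieces b D)" and c: "0 < c"
    and conv: "\<And>\<epsilon>. 0 < \<epsilon> \<Longrightarrow>
      whp S (\<lambda>n \<omega>. \<bar>1 / (largest b \<omega> n * real (Suc (n * (b - 1)))) - c\<bar> \<le> \<epsilon>)"
  shows "spacing_stationary b S"
  unfolding spacing_stationary_def
proof (rule P.whp_uniform_limit_exists)
  fix \<epsilon> :: real assume \<epsilon>: "0 < \<epsilon>"
  \<comment> \<open>\<open>M\<close>, \<open>\<delta>\<close> and \<open>n0\<close> make each of
    three errors at most \<open>\<epsilon> / 3 * real n\<close>: the index shift, the law of large
    numbers, and the rounding together with the stray summand \<open>u x\<close>.\<close>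
  obtain M0 :: nat where "6 * real b / \<epsilon> \<le> real M0" using real_arch_simple by blast
  then have "\<exists>M. 0 < M \<and> 6 * real b / \<epsilon> \<le> real M" by (intro exI[of _ "Suc M0"]) auto
  then obtain M where M: "0 < M" "6 * real b / \<epsilon> \<le> real M" by blast
  define \<delta> where "\<delta> = \<epsilon> / (6 * real M)"
  have \<delta>: "0 < \<delta>" using \<epsilon> M by (simp add: \<delta>_def)
  define G where "G = (\<lambda>x. \<Sum>j<M. mean_count (x * (real j / real M)))"
  \<comment> \<open>At \<open>x = 1\<close> the distribution is exactly 1, whereas the counting
    estimate needs \<open>x < 1\<close>, since a spacing of length \<open>L_n\<close> is still to be
    split. Below 1, \<open>G x / real M\<close> is the Riemann sum of the integral of
    \<open>mean_count (x * s)\<close> over \<open>s\<close> in \<open>[0, 1]\<close>.\<close>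
  define u where "u = (\<lambda>x. if x = 1 then 1 else G x / (real M * real (b - 1)))"
  have ratio: "whp S (\<lambda>n \<omega>. \<forall>j\<in>{1..M}.
    \<bar>largest b \<omega> n / largest b \<omega> (j * n div M) - real j / real M\<bar> \<le> 1 / real M)"
    using M by (intro P.whp_ball_finite largest_ratio_limit[OF c conv]) auto
  have lln: "whp S (\<lambda>n \<omega>. \<forall>j\<in>{1..M}. \<forall>t\<ge>0.
    \<bar>(\<Sum>k<j * n div M. piece_count t (\<omega> k)) - real (j * n div M) * mean_count t\<bar> \<le> \<delta> * real (j * n div M))"
  proof (rule P.whp_ball_finite)
    fix j assume "j \<in> {1..M}"
    then show "whp S (\<lambda>n \<omega>. \<forall>t\<ge>0. \<bar>(\<Sum>k<j * n div M. piece_count t (\<omega> k))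
        - real (j * n div M) * mean_count t\<bar> \<le> \<delta> * real (j * n div M))"
      using M by (intro whp_subseq[OF uniform_law_of_large_numbers[OF cont \<delta>]]
        filterlim_mult_div_at_top) auto
  qed simp
  obtain n0 :: nat where n0: "3 * (real M + 1) * real b / \<epsilon> \<le> real n0"
    using real_arch_simple by blast
  have "whp S (\<lambda>n \<omega>. \<forall>x\<in>{0..1}. \<bar>spacing_distr b \<omega> n x - u x\<bar> \<le> \<epsilon>)"
  proof (rule P.whp_eventually_combine[OF P.whp_conj[OF ratio lln] P.whp_AE[OF AE_valid]])
    show "\<forall>\<^sub>F n in sequentially. \<forall>\<omega>.
      (\<forall>j\<in>{1..M}. \<bar>largest b \<omega> n / largest b \<omega> (j * n div M) - real j / real M\<bar> \<le> 1 / real M) \<and>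
      (\<forall>j\<in>{1..M}. \<forall>t\<ge>0. \<bar>(\<Sum>k<j * n div M. piece_count t (\<omega> k)) - real (j * n div M) * mean_count t\<bar>
        \<le> \<delta> * real (j * n div M)) \<longrightarrow>
      (\<forall>k. valid_division b (\<omega> k)) \<longrightarrow> (\<forall>x\<in>{0..1}. \<bar>spacing_distr b \<omega> n x - u x\<bar> \<le> \<epsilon>)"
      using eventually_ge_at_top[of "max 1 n0"]
    proof eventually_elim
      case (elim n)
      show ?case
      proof (intro allI impI ballI, elim conjE)
        fix \<omega> x
        assume R: "\<forall>j\<in>{1..M}. \<bar>largest b \<omega> n / largest b \<omega> (j * n div M) - real j / real M\<bar> \<le> 1 / real M"
          and E: "\<forall>j\<in>{1..M}. \<forall>t\<ge>0. \<bar>(\<Sum>k<j * n div M. piece_count t (\<omega> k))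
            - real (j * n div M) * mean_count t\<bar> \<le> \<delta> * real (j * n div M)"
          and valid: "\<forall>k. valid_division b (\<omega> k)" and x: "x \<in> {0..1::real}"
        have n: "0 < n" "3 * (real M + 1) * real b / \<epsilon> \<le> real n" using elim n0 by auto
        define Nn where "Nn = real (Suc (n * (b - 1)))"
        have Nn_eq: "Nn = real n * real (b - 1) + 1" by (simp add: Nn_def)
        have Nn: "real n \<le> Nn" "0 < Nn"
          unfolding Nn_def by (rule le_length_frag_state, simp del: of_nat_Suc)
        have len: "real (length (frag_state b \<omega> n)) = Nn"
          using length_frag_state[OF b1] by (simp add: Nn_def)
        show "\<bar>spacing_distr b \<omega> n x - u x\<bar> \<le> \<epsilon>"
        proof (cases "x = 1")
          case True
          have "filter (\<lambda>l. l \<le> largest b \<omega> n) (frag_state b \<omega> n) = frag_state b \<omega> n"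
            using frag_state_le_largest by (intro filter_True) auto
          then show ?thesis
            using True \<epsilon> len Nn by (simp add: spacing_distr_def u_def)
        next
          case False
          define C where "C = real (length (filter (\<lambda>l. l \<le> x * largest b \<omega> n) (frag_state b \<omega> n)))"
          have lln': "\<bar>(\<Sum>k<j * n div M. piece_count t (\<omega> k)) - real (j * n div M) * mean_count t\<bar>
              \<le> \<delta> * real n" if "j \<le> M" "0 \<le> t" for j t
          proof (cases "j = 0")
            case False
            have "j * n div M \<le> M * n div M" using that(1) by (intro div_le_mono mult_le_mono) auto
            then have "j * n div M \<le> n" using M(1) by simp
            then have "\<delta> * real (j * n div M) \<le> \<delta> * real n" using \<delta> by simp
            moreover have "j \<in> {1..M}" using that(1) False by simp
            ultimately show ?thesis using E that(2) by (blast intro: order_trans)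
          qed (use \<delta> in simp)
          have est: "\<bar>C - real n / real M * G x\<bar>
            \<le> 2 * real b * real n / real M + real M * real b + 2 * real M * \<delta> * real n"
            unfolding C_def G_def
            using valid M(1) n(1) x False R lln' by (intro small_count_estimate) auto
          have G: "0 \<le> G x" "G x \<le> real M * real b"
            using sum_bounded_above[of "{..<M}" "\<lambda>j. mean_count (x * (real j / real M))" "real b"]
            by (auto simp: G_def mean_count_le intro!: sum_nonneg mean_count_nonneg)
          have "1 \<le> real (b - 1)" using b by simp
          then have "G x / (real M * real (b - 1)) \<le> (real M * real b) / (real M * 1)"
            using G M(1) by (intro frac_le mult_left_mono) auto
          then have U: "0 \<le> u x" "u x \<le> real b"
            using G M(1) False by (simp_all add: u_def)
          have uN: "u x * Nn = real n / real M * G x + u x"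
            unfolding Nn_eq u_def using False b M(1) by (simp add: field_simps)
          have "\<bar>spacing_distr b \<omega> n x - u x\<bar> * Nn = \<bar>C - u x * Nn\<bar>"
            unfolding abs_diff_mult_right[OF Nn(2)] using Nn(2) len
            by (simp add: spacing_distr_def C_def)
          also have "\<dots> \<le> 2 * real b * real n / real M + real M * real b + 2 * real M * \<delta> * real n + real b"
            using est U unfolding uN by linarith
          also have "\<dots> \<le> \<epsilon> / 3 * real n + \<epsilon> / 3 * real n + \<epsilon> / 3 * real n"
          proof -
            have "2 * real b / real M \<le> \<epsilon> / 3"
              using M \<epsilon> by (simp add: field_simps)
            then have "2 * real b / real M * real n \<le> \<epsilon> / 3 * real n"
              by (rule mult_right_mono) simp
            moreover have "(real M + 1) * real b \<le> \<epsilon> / 3 * real n"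
              using n(2) \<epsilon> by (simp add: field_simps)
            moreover have "2 * real M * \<delta> * real n = \<epsilon> / 3 * real n"
              unfolding \<delta>_def using M(1) by (simp add: field_simps)
            moreover have "2 * real b / real M * real n = 2 * real b * real n / real M" by simp
            moreover have "(real M + 1) * real b = real M * real b + real b"
              by (simp only: distrib_right mult_1)
            ultimately show ?thesis by linarith
          qed
          also have "\<dots> \<le> \<epsilon> * Nn" using Nn(1) \<epsilon> by simp
          finally show ?thesis using Nn(2) by simp
        qed
      qed
    qed
  qed
  then show "\<exists>a. whp S (\<lambda>n \<omega>. \<forall>x\<in>{0..1}. \<bar>spacing_distr b \<omega> n x - a x\<bar> \<le> \<epsilon>)" by blast
qed

lemma mean_stationary_imp_spacing_stationary:
  assumes cont: "continuous_on {0<..<1} (exp_pieces b D)" and "mean_stationary b S"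
  shows "spacing_stationary b S"
proof -
  obtain c where "\<forall>y\<in>{0<..1}. \<forall>\<epsilon>>0. whp S (\<lambda>n \<omega>. \<bar>mean_spacing b \<omega> n y - c\<bar> \<le> \<epsilon>)"
    using assms(2) unfolding mean_stationary_def by blast
  then have mean: "whp S (\<lambda>n \<omega>. \<bar>mean_spacing b \<omega> n 1 - c\<bar> \<le> \<epsilon>)" if "0 < \<epsilon>" for \<epsilon>
    using that by auto
  have conv: "whp S (\<lambda>n \<omega>. \<bar>1 / (largest b \<omega> n * real (Suc (n * (b - 1)))) - c\<bar> \<le> \<epsilon>)"
    if "0 < \<epsilon>" for \<epsilon>
  proof (rule P.whp_eventually_combine[OF mean[OF that] P.whp_AE[OF AE_valid]])
    show "\<forall>\<^sub>F n in sequentially. \<forall>\<omega>. \<bar>mean_spacing b \<omega> n 1 - c\<bar> \<le> \<epsilon> \<longrightarrow>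
      (\<forall>k. valid_division b (\<omega> k)) \<longrightarrow> \<bar>1 / (largest b \<omega> n * real (Suc (n * (b - 1)))) - c\<bar> \<le> \<epsilon>"
      using mean_spacing_1[OF b1] by (intro always_eventually) auto
  qed
  show ?thesis
    using limit_positive[OF conv] by (rule spacing_stationary_if_mean_converges[OF cont _ conv])
qed

end

section \<open>From the spacing distribution to the mean spacing\<close>

text \<open>Discretised layer-cake formula: \<open>w\<close> is the measure of the points of
  \<open>[0, 1]\<close> below \<open>w\<close>, and the grid points \<open>j / M\<close> below
  \<open>w\<close> number exactly \<open>w * M\<close> rounded up.\<close>

lemma grid_average_bound:
  fixes w :: real
  assumes "0 \<le> w" "w \<le> 1" "0 < M"
  shows "\<bar>w - (\<Sum>j<M. if w \<le> real j / real M then 0 else 1) / real M\<bar> \<le> 1 / real M"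
proof -
  define k where "k = nat \<lceil>w * real M\<rceil>"
  have k: "w * real M \<le> real k" "real k \<le> w * real M + 1"
    unfolding k_def using assms by (simp_all add: of_nat_nat ceiling_correct)
  have "w * real M \<le> 1 * real M" using assms by (intro mult_right_mono) auto
  then have "w * real M \<le> real_of_int (int M)" by linarith
  then have "\<lceil>w * real M\<rceil> \<le> int M" by (rule ceiling_le)
  then have kM: "k \<le> M" unfolding k_def by (simp only: nat_le_iff)
  have iff: "w \<le> real j / real M \<longleftrightarrow> \<not> j < k" for j
  proof -
    have "w \<le> real j / real M \<longleftrightarrow> w * real M \<le> real_of_int (int j)"
      using assms(3) by (simp add: pos_le_divide_eq)
    also have "\<dots> \<longleftrightarrow> \<lceil>w * real M\<rceil> \<le> int j" by (rule ceiling_le_iff[symmetric])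
    also have "\<dots> \<longleftrightarrow> \<not> j < k" unfolding k_def by linarith
    finally show ?thesis .
  qed
  have "(\<Sum>j<M. if w \<le> real j / real M then 0 else 1) = (\<Sum>j<M. if j \<in> {..<k} then 1 else (0::real))"
    by (intro sum.cong) (auto simp: iff)
  also have "\<dots> = real k"
    using kM by (subst sum.inter_restrict[symmetric]) (auto simp: Int_absorb1)
  finally have "(\<Sum>j<M. if w \<le> real j / real M then 0 else 1) = real k" .
  moreover have "\<bar>w - real k / real M\<bar> * real M = \<bar>w * real M - real k\<bar>"
    using assms(3) by (simp add: abs_diff_mult_right)
  ultimately show ?thesis
    using k assms(3) by (simp add: pos_le_divide_eq abs_le_iff)
qed

text \<open>Summed over all spacings, the layer-cake formula writes the total length in units of
  \<open>L\<close> as \<open>N\<close> times the integral of \<open>1 - u_n\<close>. For total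
  length 1 this identifies \<open>1 / (L_n N_n)\<close> with the mean of \<open>u_n\<close>.\<close>

lemma sum_list_grid_bound:
  assumes "0 < L" "0 < M" "\<forall>z\<in>set s. 0 \<le> z \<and> z \<le> (L::real)"
  shows "\<bar>sum_list s / L - (\<Sum>j<M. real (length s) - real (length (filter (\<lambda>l. l \<le> real j / real M * L) s))) / real M\<bar>
    \<le> real (length s) / real M"
  using assms(3)
proof (induction s)
  case (Cons z s)
  let ?T = "\<lambda>s. \<Sum>j<M. real (length s) - real (length (filter (\<lambda>l. l \<le> real j / real M * L) s))"
  have "z \<le> real j / real M * L \<longleftrightarrow> z / L \<le> real j / real M" for j
    using assms(1) by (simp add: pos_divide_le_eq)
  then have "?T (z # s) = (\<Sum>j<M. (if z / L \<le> real j / real M then 0 else 1)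
      + (real (length s) - real (length (filter (\<lambda>l. l \<le> real j / real M * L) s))))"
    by (intro sum.cong) auto
  then have "?T (z # s) = (\<Sum>j<M. if z / L \<le> real j / real M then 0 else 1) + ?T s"
    by (simp add: sum.distrib)
  moreover have "\<bar>z / L - (\<Sum>j<M. if z / L \<le> real j / real M then 0 else 1) / real M\<bar> \<le> 1 / real M"
    using Cons.prems assms by (intro grid_average_bound) auto
  moreover have "\<bar>sum_list s / L - ?T s / real M\<bar> \<le> real (length s) / real M"
    using Cons by auto
  ultimately show ?case
    unfolding sum_list.Cons list.size add_divide_distrib of_nat_add by (auto simp: add_divide_distrib)
qed simp

lemma (in fragmentation) spacing_stationary_imp_mean_converges:
  assumes "spacing_stationary b S"
  obtains c where "\<And>\<epsilon>. 0 < \<epsilon> \<Longrightarrow>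
    whp S (\<lambda>n \<omega>. \<bar>1 / (largest b \<omega> n * real (Suc (n * (b - 1)))) - c\<bar> \<le> \<epsilon>)"
proof -
  obtain u where u: "\<And>\<epsilon>. 0 < \<epsilon> \<Longrightarrow>
      whp S (\<lambda>n \<omega>. \<forall>x\<in>{0..1}. \<bar>spacing_distr b \<omega> n x - u x\<bar> \<le> \<epsilon>)"
    using assms unfolding spacing_stationary_def by (elim exE) blast
  \<comment> \<open>The dummy argument makes a number into a function on a one-point set, the form
    required by \<open>whp_uniform_limit_exists\<close>.\<close>
  define f :: "nat \<Rightarrow> (nat \<Rightarrow> nat \<Rightarrow> real) \<Rightarrow> unit \<Rightarrow> real"
    where "f = (\<lambda>n \<omega> _. 1 / (largest b \<omega> n * real (Suc (n * (b - 1)))))"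
  have "\<exists>c. \<forall>\<epsilon>>0. whp S (\<lambda>n \<omega>. \<forall>x\<in>{()}. \<bar>f n \<omega> x - c x\<bar> \<le> \<epsilon>)"
  proof (rule P.whp_uniform_limit_exists)
    fix \<epsilon> :: real assume \<epsilon>: "0 < \<epsilon>"
    obtain M0 where M0: "inverse (real (Suc M0)) < \<epsilon> / 2"
      using reals_Archimedean[of "\<epsilon> / 2"] \<epsilon> by auto
    define M where "M = Suc M0"
    have M: "0 < M" "1 / real M \<le> \<epsilon> / 2"
      using M0 unfolding M_def by (simp_all add: inverse_eq_divide)
    define a where "a = (\<Sum>j<M. 1 - u (real j / real M)) / real M"
    have \<epsilon>2: "0 < \<epsilon> / 2" using \<epsilon> by simp
    have "whp S (\<lambda>n \<omega>. \<forall>x\<in>{()}. \<bar>f n \<omega> x - a\<bar> \<le> \<epsilon>)"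
    proof (rule P.whp_eventually_combine[OF u[OF \<epsilon>2] P.whp_AE[OF AE_valid]],
        intro always_eventually allI impI ballI)
      fix n \<omega> and x :: unit
      assume close: "\<forall>x\<in>{0..1}. \<bar>spacing_distr b \<omega> n x - u x\<bar> \<le> \<epsilon> / 2"
        and valid: "\<forall>k. valid_division b (\<omega> k)"
      define L where "L = largest b \<omega> n"
      define Nn where "Nn = real (Suc (n * (b - 1)))"
      let ?s = "frag_state b \<omega> n"
      have pos: "0 < L" "0 < Nn" unfolding L_def Nn_def by (rule largest_pos[OF b1], simp del: of_nat_Suc)
      have len: "real (length ?s) = Nn" using length_frag_state[OF b1] by (simp add: Nn_def)
      have count: "real (length (filter (\<lambda>l. l \<le> t * L) ?s)) = Nn * spacing_distr b \<omega> n t" for t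
        using len pos by (simp add: spacing_distr_def L_def)
      define T where "T = (\<Sum>j<M. 1 - spacing_distr b \<omega> n (real j / real M))"
      have "\<bar>sum_list ?s / L - (\<Sum>j<M. real (length ?s) - real (length (filter (\<lambda>l. l \<le> real j / real M * L) ?s))) / real M\<bar>
        \<le> real (length ?s) / real M"
        using frag_state_nonneg[OF b1, of \<omega>] valid frag_state_le_largest[of _ b \<omega> n]
        by (intro sum_list_grid_bound pos M(1)) (auto simp: L_def)
      then have "\<bar>1 / L - (\<Sum>j<M. Nn - Nn * spacing_distr b \<omega> n (real j / real M)) / real M\<bar> \<le> Nn / real M"
        unfolding len count sum_list_frag_state[OF b1] .
      moreover have "(\<Sum>j<M. Nn - Nn * spacing_distr b \<omega> n (real j / real M)) = T * Nn"
        unfolding T_def sum_distrib_right by (intro sum.cong) (auto simp: algebra_simps)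
      moreover have "\<bar>1 / (L * Nn) - T / real M\<bar> * Nn = \<bar>1 / L - T * Nn / real M\<bar>"
        unfolding abs_diff_mult_right[OF pos(2)] using pos by simp
      ultimately have "\<bar>1 / (L * Nn) - T / real M\<bar> * Nn \<le> 1 / real M * Nn" by simp
      then have 1: "\<bar>1 / (L * Nn) - T / real M\<bar> \<le> 1 / real M"
        using pos(2) by (rule mult_right_le_imp_le)
      have "\<bar>T - (\<Sum>j<M. 1 - u (real j / real M))\<bar>
        \<le> (\<Sum>j<M. \<bar>(1 - spacing_distr b \<omega> n (real j / real M)) - (1 - u (real j / real M))\<bar>)"
        unfolding T_def sum_subtractf[symmetric] by (rule sum_abs)
      also have "\<dots> \<le> (\<Sum>j<M. \<epsilon> / 2)"
      proof (rule sum_mono)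
        fix j assume "j \<in> {..<M}"
        then have "real j / real M \<in> {0..1}" by simp
        then have "\<bar>spacing_distr b \<omega> n (real j / real M) - u (real j / real M)\<bar> \<le> \<epsilon> / 2"
          using close by blast
        then show "\<bar>(1 - spacing_distr b \<omega> n (real j / real M)) - (1 - u (real j / real M))\<bar> \<le> \<epsilon> / 2"
          by linarith
      qed
      also have "\<dots> = \<epsilon> / 2 * real M" by simp
      finally have "\<bar>T / real M - a\<bar> * real M \<le> \<epsilon> / 2 * real M"
        using M(1) by (simp add: abs_diff_mult_right a_def)
      then have "\<bar>T / real M - a\<bar> \<le> \<epsilon> / 2" using M(1) by simp
      then show "\<bar>f n \<omega> x - a\<bar> \<le> \<epsilon>"
        using 1 M(2) unfolding f_def L_def Nn_def by linarith
    qed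
    then show "\<exists>a. whp S (\<lambda>n \<omega>. \<forall>x\<in>{()}. \<bar>f n \<omega> x - a x\<bar> \<le> \<epsilon>)"
      by (intro exI[of _ "\<lambda>_. a"])
  qed
  then show thesis using that unfolding f_def by auto
qed

section \<open>Measurability of list-valued random variables\<close>

text \<open>Stands in for a sigma-algebra on lists: measurability is tested on countably many
  numerical maps, and padding with 0 defines each coordinate for lists of every length.\<close>

definition list_measurable :: "'a measure \<Rightarrow> ('a \<Rightarrow> real list) \<Rightarrow> bool" where
  "list_measurable M f \<longleftrightarrow> (\<lambda>x. length (f x)) \<in> M \<rightarrow>\<^sub>M count_space UNIV \<and>
    (\<forall>i. (\<lambda>x. nth_default 0 (f x) i) \<in> borel_measurable M)"

lemma list_measurableD:
  assumes "list_measurable M f"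
  shows "(\<lambda>x. length (f x)) \<in> M \<rightarrow>\<^sub>M count_space UNIV"
    and "(\<lambda>x. nth_default 0 (f x) i) \<in> borel_measurable M"
  using assms by (auto simp: list_measurable_def)

lemma list_measurable_const: "list_measurable M (\<lambda>_. s)"
  by (simp add: list_measurable_def)

lemma list_measurable_compose_countable:
  assumes "\<And>i::nat. list_measurable M (f i)" and [measurable]: "g \<in> M \<rightarrow>\<^sub>M count_space UNIV"
  shows "list_measurable M (\<lambda>x. f (g x) x)"
  unfolding list_measurable_def
proof (intro conjI allI)
  show "(\<lambda>x. length (f (g x) x)) \<in> M \<rightarrow>\<^sub>M count_space UNIV"
    using list_measurableD(1)[OF assms(1)] assms(2) by (rule measurable_compose_countable)
  show "(\<lambda>x. nth_default 0 (f (g x) x) i) \<in> borel_measurable M" for i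
    using list_measurableD(2)[OF assms(1)] assms(2) by (rule measurable_compose_countable)
qed

lemma list_measurable_append:
  assumes "list_measurable M f" "list_measurable M g"
  shows "list_measurable M (\<lambda>x. f x @ g x)"
proof -
  note [measurable] = list_measurableD[OF assms(1)] list_measurableD[OF assms(2)]
  have "(\<lambda>x. nth_default 0 (f x @ g x) i) \<in> borel_measurable M" for i
  proof -
    have [measurable]: "(\<lambda>x. nth_default 0 (g x) (i - length (f x))) \<in> borel_measurable M"
      by (rule measurable_compose_countable[where g = "\<lambda>x. i - length (f x)"]) measurable
    have "nth_default 0 (f x @ g x) i
      = (if i < length (f x) then nth_default 0 (f x) i else nth_default 0 (g x) (i - length (f x)))" for x
      by (simp add: nth_default_append nth_default_nth)
    then show ?thesis by simp
  qed
  then show ?thesis by (simp add: list_measurable_def)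
qed

lemma list_measurable_take:
  assumes "list_measurable M f"
  shows "list_measurable M (\<lambda>x. take k (f x))"
proof -
  note [measurable] = list_measurableD[OF assms]
  show ?thesis by (simp add: list_measurable_def nth_default_take_eq)
qed

lemma list_measurable_drop:
  assumes "list_measurable M f"
  shows "list_measurable M (\<lambda>x. drop k (f x))"
proof -
  note [measurable] = list_measurableD[OF assms]
  have "nth_default 0 (drop k (f x)) i = nth_default 0 (f x) (k + i)" for x i
    by (auto simp: nth_default_def)
  then show ?thesis by (simp add: list_measurable_def)
qed

lemma list_measurable_scale:
  assumes "list_measurable M f" and [measurable]: "g \<in> borel_measurable M"
  shows "list_measurable M (\<lambda>x. map ((*) (g x)) (f x))"
proof -
  note [measurable] = list_measurableD[OF assms(1)]
  have "nth_default 0 (map ((*) (g x)) (f x)) i = g x * nth_default 0 (f x) i" for x i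
    by (rule nth_default_map_eq) simp
  then show ?thesis by (simp add: list_measurable_def)
qed

lemma list_measurable_if:
  assumes "list_measurable M f" "list_measurable M g" and [measurable]: "Measurable.pred M Q"
  shows "list_measurable M (\<lambda>x. if Q x then f x else g x)"
proof -
  note [measurable] = list_measurableD[OF assms(1)] list_measurableD[OF assms(2)]
  have "(\<lambda>x. length (if Q x then f x else g x)) = (\<lambda>x. if Q x then length (f x) else length (g x))"
    "\<And>i. (\<lambda>x. nth_default 0 (if Q x then f x else g x) i)
      = (\<lambda>x. if Q x then nth_default 0 (f x) i else nth_default 0 (g x) i)"
    by auto
  then show ?thesis by (simp add: list_measurable_def)
qed

lemma ball_set_conv_nth_default:
  "(\<forall>y\<in>set s. Q y) \<longleftrightarrow> (\<forall>i. i < length s \<longrightarrow> Q (nth_default d s i))"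
  by (auto simp: all_set_conv_all_nth nth_default_nth)

lemma in_set_conv_nth_default:
  "y \<in> set s \<longleftrightarrow> (\<exists>i<length s. nth_default d s i = y)"
  by (auto simp: in_set_conv_nth nth_default_nth)

lemma measurable_Max_list:
  assumes "list_measurable M f"
  shows "(\<lambda>x. Max (set (f x))) \<in> borel_measurable M"
  unfolding borel_measurable_iff_le
proof
  note [measurable] = list_measurableD[OF assms]
  fix a :: real
  have "Max (set (f x)) \<le> a \<longleftrightarrow> (if length (f x) = 0 then Max {} \<le> a
    else \<forall>i. i < length (f x) \<longrightarrow> nth_default 0 (f x) i \<le> a)" for x
    using ball_set_conv_nth_default[of "f x" "\<lambda>y. y \<le> a" 0] by simp
  then have "{x\<in>space M. Max (set (f x)) \<le> a} = {x\<in>space M. if length (f x) = 0 then Max {} \<le> a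
    else \<forall>i. i < length (f x) \<longrightarrow> nth_default 0 (f x) i \<le> a}"
    by simp
  also have "\<dots> \<in> sets M" by measurable
  finally show "{x\<in>space M. Max (set (f x)) \<le> a} \<in> sets M" .
qed

lemma list_measurable_split_max:
  assumes "list_measurable M f" "list_measurable M g"
  shows "list_measurable M (\<lambda>x. split_max (f x) (g x))"
proof -
  note [measurable] = list_measurableD[OF assms(1)] measurable_Max_list[OF assms(1)]
  define idx where "idx = (\<lambda>x. LEAST i. i < length (f x) \<and> f x ! i = Max (set (f x)))"
  have "idx = (\<lambda>x. LEAST i. i < length (f x) \<and> nth_default 0 (f x) i = Max (set (f x)))"
    unfolding idx_def by (intro ext arg_cong[of _ _ Least]) (auto simp: nth_default_nth)
  moreover have "(\<lambda>x. LEAST i. i < length (f x) \<and> nth_default 0 (f x) i = Max (set (f x)))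
    \<in> M \<rightarrow>\<^sub>M count_space UNIV"
    by measurable
  ultimately have idx [measurable]: "idx \<in> M \<rightarrow>\<^sub>M count_space UNIV" by simp
  have least: "idx x < length (f x)" if "f x \<noteq> []" for x
  proof -
    have "Max (set (f x)) \<in> set (f x)" using that by simp
    then have "\<exists>i. i < length (f x) \<and> f x ! i = Max (set (f x))" by (simp add: in_set_conv_nth)
    then show ?thesis unfolding idx_def by (rule LeastI2_ex) simp
  qed
  define h where "h = (\<lambda>i x. take i (f x) @ map ((*) (nth_default 0 (f x) i)) (g x) @ drop (Suc i) (f x))"
  have h: "list_measurable M (\<lambda>x. h (idx x) x)"
  proof (rule list_measurable_compose_countable[OF _ idx])
    show "list_measurable M (h i)" for i
      unfolding h_def by (intro list_measurable_append list_measurable_take list_measurable_drop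
          list_measurable_scale assms list_measurableD(2))
  qed
  \<comment> \<open>On the empty list \<open>split_max\<close> scales by an unspecified value. That
    value is a constant, so the scaled list remains measurable whatever it is.\<close>
  define z :: real where "z = [] ! (LEAST i. False)"
  have "split_max (f x) (g x) = (if length (f x) = 0 then map ((*) z) (g x) else h (idx x) x)" for x
  proof (cases "f x = []")
    case True
    then show ?thesis by (simp add: split_max_def z_def)
  next
    case False
    have "(LEAST i. i < length (f x) \<and> f x ! i = Max (set (f x))) = idx x" by (simp add: idx_def)
    then show ?thesis
      using False by (simp add: split_max_def Let_def h_def nth_default_nth[OF least[OF False]])
  qed
  moreover have "list_measurable M (\<lambda>x. if length (f x) = 0 then map ((*) z) (g x) else h (idx x) x)"
    by (intro list_measurable_if list_measurable_scale assms h) measurable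
  ultimately show ?thesis by simp
qed

lemma list_measurable_concat:
  assumes "\<And>j. j < J \<Longrightarrow> list_measurable M (\<lambda>x. f x ! j)" "\<And>x. length (f x) = J"
  shows "list_measurable M (\<lambda>x. concat (f x))"
proof -
  have "list_measurable M (\<lambda>x. concat (map (\<lambda>j. f x ! j) [0..<k]))" if "k \<le> J" for k
    using that
  proof (induction k)
    case (Suc k)
    then show ?case by (simp add: list_measurable_append assms(1))
  qed (simp add: list_measurable_const)
  from this[of J] have "list_measurable M (\<lambda>x. concat (map ((!) (f x)) [0..<J]))" by simp
  moreover have "map ((!) (f x)) [0..<J] = f x" for x
    using map_nth[of "f x"] assms(2)[of x] by simp
  ultimately show ?thesis by simp
qed

section \<open>The process inside a block of spacings\<close>

text \<open>The leftmost block attaining the global maximum is taken, so that ties are broken as in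
  \<open>split_max\<close> and concatenating the blocks recovers the original process.\<close>

definition block_index :: "real list list \<Rightarrow> nat" where
  "block_index bs = (LEAST j. j < length bs \<and> Max (set (concat bs)) \<in> set (bs ! j))"

definition split_block :: "real list list \<Rightarrow> real list \<Rightarrow> real list list" where
  "split_block bs q = bs[block_index bs := split_max (bs ! block_index bs) q]"

fun run_blocks :: "nat \<Rightarrow> real list list \<Rightarrow> (nat \<Rightarrow> nat \<Rightarrow> real) \<Rightarrow> nat \<Rightarrow> real list list" where
  "run_blocks b bs \<omega> 0 = bs"
| "run_blocks b bs \<omega> (Suc n) = split_block (run_blocks b bs \<omega> n) (pieces b (\<omega> n))"

definition proper_blocks :: "real list list \<Rightarrow> bool" where
  "proper_blocks bs \<longleftrightarrow> bs \<noteq> [] \<and> (\<forall>s\<in>set bs. s \<noteq> [] \<and> (\<forall>x\<in>set s. 0 \<le> x))"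

lemma block_index_props:
  assumes "proper_blocks bs"
  shows "block_index bs < length bs"
    and "Max (set (concat bs)) \<in> set (bs ! block_index bs)"
    and "j < block_index bs \<Longrightarrow> Max (set (concat bs)) \<notin> set (bs ! j)"
proof -
  have "concat bs \<noteq> []"
    using assms by (cases bs) (auto simp: proper_blocks_def)
  then have "Max (set (concat bs)) \<in> set (concat bs)" by (intro Max_in) auto
  then obtain s where "s \<in> set bs" "Max (set (concat bs)) \<in> set s" by auto
  then have ex: "\<exists>j. j < length bs \<and> Max (set (concat bs)) \<in> set (bs ! j)"
    using in_set_conv_nth[of s bs] by blast
  then have "block_index bs < length bs \<and> Max (set (concat bs)) \<in> set (bs ! block_index bs)"
    unfolding block_index_def by (rule LeastI_ex)
  then show "block_index bs < length bs"
    and "Max (set (concat bs)) \<in> set (bs ! block_index bs)" by auto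
  then show "Max (set (concat bs)) \<notin> set (bs ! j)" if "j < block_index bs"
    using that not_less_Least[of j "\<lambda>j. j < length bs \<and> Max (set (concat bs)) \<in> set (bs ! j)"]
    unfolding block_index_def by auto
qed

lemma Max_block_index:
  assumes "proper_blocks bs"
  shows "Max (set (bs ! block_index bs)) = Max (set (concat bs))"
proof (rule Max_eqI)
  show "y \<le> Max (set (concat bs))" if "y \<in> set (bs ! block_index bs)" for y
    using that block_index_props(1)[OF assms] by (intro Max_ge) auto
qed (use block_index_props(2)[OF assms] in auto)

text \<open>No earlier block contains the maximum, so the first maximum of the chosen block is also
  the first maximum of the whole list.\<close>

lemma concat_split_block:
  assumes "proper_blocks bs"
  shows "concat (split_block bs q) = split_max (concat bs) q"
proof -
  define j where "j = block_index bs"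
  define m where "m = Max (set (concat bs))"
  note p = block_index_props[OF assms, folded j_def m_def]
  obtain xs ys where xy: "bs ! j = xs @ m # ys" "m \<notin> set xs"
    using split_list_first[OF p(2)] by blast
  have "m \<notin> set (concat (take j bs))"
    using p(1,3) by (auto simp: in_set_conv_nth[of _ "take j bs"])
  then have "m \<notin> set (concat (take j bs) @ xs)" using xy(2) by simp
  moreover have "concat bs = (concat (take j bs) @ xs) @ m # (ys @ concat (drop (Suc j) bs))"
    using xy(1) by (subst id_take_nth_drop[OF p(1)]) simp
  ultimately have 1: "split_max (concat bs) q
    = (concat (take j bs) @ xs) @ map ((*) m) q @ (ys @ concat (drop (Suc j) bs))"
    using m_def[symmetric] by (intro split_max_eq)
  have 2: "split_max (bs ! j) q = xs @ map ((*) m) q @ ys"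
    using Max_block_index[OF assms] by (intro split_max_eq[OF xy(1) _ xy(2)]) (simp add: m_def j_def)
  show ?thesis
    unfolding split_block_def j_def[symmetric] upd_conv_take_nth_drop[OF p(1)] 1 2 by simp
qed

lemma length_split_block [simp]: "length (split_block bs q) = length bs"
  by (simp add: split_block_def)

lemma split_block_nth:
  assumes "proper_blocks bs"
  shows "split_block bs q ! i = (if i = block_index bs then split_max (bs ! i) q else bs ! i)"
  using block_index_props(1)[OF assms] by (simp add: split_block_def nth_list_update)

lemma proper_split_block:
  assumes "proper_blocks bs" "q \<noteq> []" "\<forall>p\<in>set q. 0 \<le> p"
  shows "proper_blocks (split_block bs q)"
proof -
  let ?s = "bs ! block_index bs"
  have ok: "s \<noteq> []" "\<forall>x\<in>set s. 0 \<le> x" if "s \<in> set bs" for s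
    using assms(1) that unfolding proper_blocks_def by simp_all
  note s = ok[OF nth_mem[OF block_index_props(1)[OF assms(1)]]]
  have "0 < length q" "0 < length ?s" using s(1) assms(2) by simp_all
  then have "0 < length (split_max ?s q)"
    using length_split_max[OF s(1), of q] by linarith
  then have new: "split_max ?s q \<noteq> []" "\<forall>x\<in>set (split_max ?s q). 0 \<le> x"
    using split_max_nonneg[OF s assms(3)] by auto
  have "t \<noteq> [] \<and> (\<forall>x\<in>set t. 0 \<le> x)" if "t \<in> set (split_block bs q)" for t
  proof -
    have "t = split_max ?s q \<or> t \<in> set bs"
      using that set_update_subset_insert[of bs "block_index bs" "split_max ?s q"]
      unfolding split_block_def by blast
    then show ?thesis using new ok by metis
  qed
  moreover have "split_block bs q \<noteq> []"
    using assms(1) by (simp add: proper_blocks_def split_block_def)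
  ultimately show ?thesis unfolding proper_blocks_def by simp
qed

lemma length_run_blocks [simp]: "length (run_blocks b bs \<omega> n) = length bs"
  by (induction n) auto

lemma run_blocks_case_nat:
  "run_blocks b bs (case_nat v \<omega>) (Suc n) = run_blocks b (split_block bs (pieces b v)) \<omega> n"
  by (induction n) auto

lemma pieces_not_Nil: "1 \<le> b \<Longrightarrow> pieces b v \<noteq> []"
  by (simp flip: length_0_conv)

lemma proper_run_blocks:
  assumes "1 \<le> b" "proper_blocks bs" "\<And>k. valid_division b (\<omega> k)"
  shows "proper_blocks (run_blocks b bs \<omega> n)"
proof (induction n)
  case (Suc n)
  then show ?case
    using pieces_not_Nil[OF assms(1)] pieces_nonneg[OF assms(3)] by (simp add: proper_split_block)
qed (simp add: assms(2))

lemma concat_run_blocks: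
  assumes "1 \<le> b" "proper_blocks bs" "\<And>k. valid_division b (\<omega> k)"
  shows "concat (run_blocks b bs \<omega> n) = run b (concat bs) \<omega> n"
  by (induction n) (simp_all add: concat_split_block[OF proper_run_blocks[OF assms]])

lemma sum_list_run_blocks_nth:
  assumes "1 \<le> b" "proper_blocks bs" "\<And>k. valid_division b (\<omega> k)" "i < length bs"
  shows "sum_list (run_blocks b bs \<omega> n ! i) = sum_list (bs ! i)"
proof (induction n)
  case (Suc n)
  have p: "proper_blocks (run_blocks b bs \<omega> n)" by (rule proper_run_blocks[OF assms(1-3)])
  then have "run_blocks b bs \<omega> n ! i \<noteq> []" using assms(4) by (auto simp: proper_blocks_def)
  then have "sum_list (split_max (run_blocks b bs \<omega> n ! i) (pieces b (\<omega> n))) = sum_list (bs ! i)"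
    using Suc by (simp add: sum_list_split_max sum_list_pieces)
  then show ?case using Suc unfolding run_blocks.simps split_block_nth[OF p] by auto
qed simp

lemma length_run_blocks_nth_ge:
  assumes "1 \<le> b" "proper_blocks bs" "\<And>k. valid_division b (\<omega> k)" "i < length bs"
  shows "length (bs ! i) \<le> length (run_blocks b bs \<omega> n ! i)"
proof (induction n)
  case (Suc n)
  have p: "proper_blocks (run_blocks b bs \<omega> n)" by (rule proper_run_blocks[OF assms(1-3)])
  then have "run_blocks b bs \<omega> n ! i \<noteq> []" using assms(4) by (auto simp: proper_blocks_def)
  from length_split_max[OF this, of "pieces b (\<omega> n)"] Suc assms(1)
  have "length (bs ! i) \<le> length (split_max (run_blocks b bs \<omega> n ! i) (pieces b (\<omega> n)))" by simp
  then show ?case using Suc unfolding run_blocks.simps split_block_nth[OF p] by auto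
qed simp

context fragmentation
begin

lemma list_measurable_pieces:
  assumes "w \<in> M \<rightarrow>\<^sub>M D"
  shows "list_measurable M (\<lambda>x. pieces b (w x))"
proof -
  have "(\<lambda>x. nth_default 0 (pieces b (w x)) i) \<in> borel_measurable M" for i
  proof (cases "i < b")
    case True
    then show ?thesis
      using measurable_compose[OF assms measurable_pieces_nth[OF True]] b1 by (simp add: nth_default_nth)
  qed (use b1 in \<open>simp add: nth_default_beyond\<close>)
  then show ?thesis using b1 by (simp add: list_measurable_def)
qed

lemma list_measurable_run:
  assumes "list_measurable M f" "\<And>k. (\<lambda>x. w x k) \<in> M \<rightarrow>\<^sub>M D"
  shows "list_measurable M (\<lambda>x. run b (f x) (w x) n)"
  by (induction n) (simp_all add: assms list_measurable_split_max list_measurable_pieces)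

lemma list_measurable_run_blocks_nth:
  assumes "\<And>x. length (f x) = J" "\<And>j. j < J \<Longrightarrow> list_measurable M (\<lambda>x. f x ! j)"
    "\<And>k. (\<lambda>x. w x k) \<in> M \<rightarrow>\<^sub>M D" "j < J"
  shows "list_measurable M (\<lambda>x. run_blocks b (f x) (w x) n ! j)"
  using assms(4)
proof (induction n arbitrary: j)
  case (Suc n)
  let ?B = "\<lambda>x. run_blocks b (f x) (w x) n"
  have B: "list_measurable M (\<lambda>x. ?B x ! j)" if "j < J" for j by (rule Suc.IH[OF that])
  have len: "length (?B x) = J" for x by (simp add: assms(1))
  have [measurable]: "(\<lambda>x. Max (set (concat (?B x)))) \<in> borel_measurable M"
    by (rule measurable_Max_list[OF list_measurable_concat[OF B len]])
  have "(\<lambda>x. LEAST j. j < J \<and> (\<exists>i<length (?B x ! j).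
      nth_default 0 (?B x ! j) i = Max (set (concat (?B x))))) \<in> M \<rightarrow>\<^sub>M count_space UNIV"
  proof (rule measurable_Least)
    fix j
    show "Measurable.pred M (\<lambda>x. j < J \<and> (\<exists>i<length (?B x ! j).
      nth_default 0 (?B x ! j) i = Max (set (concat (?B x)))))"
    proof (cases "j < J")
      case True
      note [measurable] = list_measurableD[OF B[OF True]]
      show ?thesis by measurable
    qed simp
  qed
  then have [measurable]: "(\<lambda>x. block_index (?B x)) \<in> M \<rightarrow>\<^sub>M count_space UNIV"
    unfolding block_index_def len in_set_conv_nth_default[of _ _ 0] .
  have "run_blocks b (f x) (w x) (Suc n) ! j
    = (if block_index (?B x) = j then split_max (?B x ! j) (pieces b (w x n)) else ?B x ! j)" for x
    using Suc.prems len[of x] by (cases "block_index (?B x) = j") (simp_all add: split_block_def)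
  moreover have "list_measurable M
    (\<lambda>x. if block_index (?B x) = j then split_max (?B x ! j) (pieces b (w x n)) else ?B x ! j)"
    by (intro list_measurable_if list_measurable_split_max B Suc.prems list_measurable_pieces assms(3))
       measurable
  ultimately show ?case by simp
qed (use assms(2) in simp)

text \<open>Conditioning on the first division: whatever it is, the remaining divisions are again
  distributed as \<open>S\<close>.\<close>

lemma emeasure_case_nat:
  assumes [measurable]: "Measurable.pred S Q"
  shows "emeasure S {\<omega>\<in>space S. Q \<omega>} = (\<integral>\<^sup>+v. emeasure S {\<omega>\<in>space S. Q (case_nat v \<omega>)} \<partial>D)"
proof -
  have f: "(\<lambda>(v, \<omega>). case_nat v \<omega>) \<in> D \<Otimes>\<^sub>M S \<rightarrow>\<^sub>M S" by measurable
  have "emeasure S {\<omega>\<in>space S. Q \<omega>}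
    = emeasure (distr (D \<Otimes>\<^sub>M S) S (\<lambda>(v, \<omega>). case_nat v \<omega>)) {\<omega>\<in>space S. Q \<omega>}"
    by (simp only: PiM_iter)
  also have "\<dots> = emeasure (D \<Otimes>\<^sub>M S) {x\<in>space (D \<Otimes>\<^sub>M S). Q (case_nat (fst x) (snd x))}"
    using measurable_space[OF f] by (subst emeasure_distr[OF f])
      (auto intro!: arg_cong[of _ _ "emeasure _"] simp: split_beta)
  also have "\<dots> = (\<integral>\<^sup>+v. emeasure S (Pair v -` {x\<in>space (D \<Otimes>\<^sub>M S). Q (case_nat (fst x) (snd x))}) \<partial>D)"
    by (rule P.emeasure_pair_measure_alt) measurable
  also have "\<dots> = (\<integral>\<^sup>+v. emeasure S {\<omega>\<in>space S. Q (case_nat v \<omega>)} \<partial>D)"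
    by (intro nn_integral_cong arg_cong[of _ _ "emeasure _"]) (auto simp: space_pair_measure)
  finally show ?thesis .
qed

text \<open>Conditioning on the first \<open>m\<close> divisions, used to freeze the configuration
  at time \<open>m\<close>.\<close>

lemma emeasure_comb_seq:
  assumes [measurable]: "Measurable.pred S Q"
  shows "emeasure S {\<omega>\<in>space S. Q \<omega>} = (\<integral>\<^sup>+\<omega>. emeasure S {\<omega>'\<in>space S. Q (comb_seq m \<omega> \<omega>')} \<partial>S)"
proof -
  note f = measurable_comb_seq[of m D]
  have "emeasure S {\<omega>\<in>space S. Q \<omega>}
    = emeasure (distr (S \<Otimes>\<^sub>M S) S (\<lambda>(\<omega>, \<omega>'). comb_seq m \<omega> \<omega>')) {\<omega>\<in>space S. Q \<omega>}"
    by (simp only: PiM_comb_seq)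
  also have "\<dots> = emeasure (S \<Otimes>\<^sub>M S) {x\<in>space (S \<Otimes>\<^sub>M S). Q (comb_seq m (fst x) (snd x))}"
    using measurable_space[OF f] by (subst emeasure_distr[OF f])
      (auto intro!: arg_cong[of _ _ "emeasure _"] simp: split_beta)
  also have "\<dots> = (\<integral>\<^sup>+\<omega>. emeasure S (Pair \<omega> -` {x\<in>space (S \<Otimes>\<^sub>M S). Q (comb_seq m (fst x) (snd x))}) \<partial>S)"
    by (rule P.emeasure_pair_measure_alt) measurable
  also have "\<dots> = (\<integral>\<^sup>+\<omega>. emeasure S {\<omega>'\<in>space S. Q (comb_seq m \<omega> \<omega>')} \<partial>S)"
    by (intro nn_integral_cong arg_cong[of _ _ "emeasure _"]) (auto simp: space_pair_measure)
  finally show ?thesis .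
qed

lemma measurable_block_event:
  assumes "i < length bs"
  shows "Measurable.pred S (\<lambda>\<omega>. length (run_blocks b bs \<omega> n ! i) \<le> k
    \<and> Max (set (concat (run_blocks b bs \<omega> n))) \<le> l)"
proof -
  have B: "list_measurable S (\<lambda>\<omega>. run_blocks b bs \<omega> n ! j)" if "j < length bs" for j
    by (rule list_measurable_run_blocks_nth) (auto simp: list_measurable_const that)
  have [measurable]: "(\<lambda>\<omega>. Max (set (concat (run_blocks b bs \<omega> n)))) \<in> borel_measurable S"
    by (rule measurable_Max_list[OF list_measurable_concat[OF B length_run_blocks]])
  have [measurable]: "Measurable.pred S (\<lambda>\<omega>. length (run_blocks b bs \<omega> n ! i) \<le> k)"
    using measurable_compose[OF list_measurableD(1)[OF B[OF assms]], of "\<lambda>x. x \<le> k" "count_space UNIV"]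
    by simp
  show ?thesis by measurable
qed

text \<open>Until the whole configuration has been refined to mesh \<open>l\<close>, block \<open>i\<close> evolves, in its own
  clock, as a fragmentation process started from block \<open>i\<close> alone.\<close>

lemma block_domination:
  assumes "proper_blocks bs" "i < length bs"
  shows "emeasure S {\<omega>\<in>space S. length (run_blocks b bs \<omega> n ! i) \<le> length (bs ! i) + r * (b - 1)
      \<and> Max (set (concat (run_blocks b bs \<omega> n))) \<le> l}
    \<le> emeasure S {\<omega>\<in>space S. Max (set (run b (bs ! i) \<omega> r)) \<le> l}"
  using assms
proof (induction n arbitrary: bs r)
  case 0
  note [measurable] = measurable_Max_list[OF list_measurable_run[OF list_measurable_const measurable_component_D]]
  have s: "bs ! i \<noteq> []" "\<forall>x\<in>set (bs ! i). 0 \<le> x" "set (bs ! i) \<subseteq> set (concat bs)"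
    using 0(1) nth_mem[OF 0(2)] unfolding proper_blocks_def set_concat by blast+
  show ?case
  \<comment> \<open>A mesh that is already at most \<open>l\<close> stays so when the block is split
    further on its own, so the right-hand probability is 1. Otherwise the left-hand event is
    empty.\<close>
  proof (cases "Max (set (concat bs)) \<le> l")
    case True
    have "Max (set (bs ! i)) \<le> Max (set (concat bs))"
      using s by (intro Max_mono) auto
    then have le: "Max (set (bs ! i)) \<le> l" using True by linarith
    have "AE \<omega> in S. Max (set (run b (bs ! i) \<omega> r)) \<le> l"
      using AE_valid
    proof eventually_elim
      case (elim \<omega>)
      show ?case
        using Max_run_antimono[OF b1 s(1), of \<omega> 0 r] elim s(2) le by simp
    qed
    then have "emeasure S {\<omega>\<in>space S. Max (set (run b (bs ! i) \<omega> r)) \<le> l} = 1"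
      by (intro P.emeasure_eq_1_AE) auto
    then show ?thesis by (simp add: P.measure_le_1)
  qed simp
next
  case (Suc n)
  let ?E = "\<lambda>bs k n \<omega>. length (run_blocks b bs \<omega> n ! i) \<le> k \<and> Max (set (concat (run_blocks b bs \<omega> n))) \<le> l"
  define j where "j = block_index bs"
  note p = Suc.prems
  have nth: "split_block bs q ! i = (if i = j then split_max (bs ! i) q else bs ! i)" for q
    unfolding j_def by (rule split_block_nth[OF p(1)])
  have proper: "proper_blocks (split_block bs (pieces b v))" if "valid_division b v" for v
    using pieces_not_Nil[OF b1] pieces_nonneg[OF that] by (intro proper_split_block p) auto
  have eq: "emeasure S {\<omega>\<in>space S. ?E bs k (Suc n) \<omega>}
    = (\<integral>\<^sup>+v. emeasure S {\<omega>\<in>space S. ?E (split_block bs (pieces b v)) k n \<omega>} \<partial>D)" for k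
    by (subst emeasure_case_nat[OF measurable_block_event[OF p(2)]]) (simp only: run_blocks_case_nat)
  show ?case
  proof (cases "i = j")
    \<comment> \<open>The first split falls outside block \<open>i\<close>, so the induction
      hypothesis bounds the integrand by a quantity that does not depend on
      \<open>v\<close>.\<close>
    case False
    have "emeasure S {\<omega>\<in>space S. ?E bs (length (bs ! i) + r * (b - 1)) (Suc n) \<omega>}
      \<le> (\<integral>\<^sup>+v. emeasure S {\<omega>\<in>space S. Max (set (run b (bs ! i) \<omega> r)) \<le> l} \<partial>D)"
      unfolding eq
    proof (rule nn_integral_mono_AE)
      show "AE v in D. emeasure S {\<omega>\<in>space S. ?E (split_block bs (pieces b v)) (length (bs ! i) + r * (b - 1)) n \<omega>}
        \<le> emeasure S {\<omega>\<in>space S. Max (set (run b (bs ! i) \<omega> r)) \<le> l}"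
        using D_unit
      proof eventually_elim
        case (elim v)
        show ?case
          using Suc.IH[OF proper[OF elim], of r] p(2) unfolding nth if_not_P[OF False] by simp
      qed
    qed
    then show ?thesis by (simp add: M.emeasure_space_1)
  next
    case True
    have s: "bs ! i \<noteq> []" using p by (auto simp: proper_blocks_def)
    have len: "length (split_block bs (pieces b v) ! i) = length (bs ! i) + (b - 1)" for v
      using length_split_max[OF s, of "pieces b v"] b1 unfolding nth if_P[OF True] by simp
    show ?thesis
    proof (cases r)
      \<comment> \<open>Block \<open>i\<close> has just been split although its budget allows no
        split, and blocks never shrink: the event is null.\<close>
      case 0
      have "AE \<omega> in S. \<not> ?E bs (length (bs ! i) + r * (b - 1)) (Suc n) \<omega>"
        using AE_valid
      proof eventually_elim
        case (elim \<omega>)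
        have \<omega>: "\<omega> = case_nat (\<omega> 0) (\<lambda>k. \<omega> (Suc k))"
          by (auto simp: fun_eq_iff split: nat.split)
        have "length (split_block bs (pieces b (\<omega> 0)) ! i)
          \<le> length (run_blocks b (split_block bs (pieces b (\<omega> 0))) (\<lambda>k. \<omega> (Suc k)) n ! i)"
          using elim p(2) by (intro length_run_blocks_nth_ge[OF b1] proper) auto
        also have "run_blocks b (split_block bs (pieces b (\<omega> 0))) (\<lambda>k. \<omega> (Suc k)) n = run_blocks b bs \<omega> (Suc n)"
          by (subst (3) \<omega>) (simp only: run_blocks_case_nat)
        finally have "length (bs ! i) < length (run_blocks b bs \<omega> (Suc n) ! i)"
          using b unfolding len by linarith
        then show ?case unfolding 0 by linarith
      qed
      then have "emeasure S {\<omega>\<in>space S. ?E bs (length (bs ! i) + r * (b - 1)) (Suc n) \<omega>} = 0"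
        by (rule emeasure_eq_0_AE)
      then show ?thesis by (simp only: zero_le)
    next
      \<comment> \<open>One split of the budget is spent. Block \<open>i\<close> holds the global
        maximum, so this split is also the one that its stand-alone process would make; integrating
        over \<open>v\<close> restores that first step.\<close>
      case (Suc r')
      have k: "length (bs ! i) + r * (b - 1) = length (split_block bs (pieces b v) ! i) + r' * (b - 1)" for v
        unfolding len Suc by simp
      have meas: "Measurable.pred S (\<lambda>\<omega>. Max (set (run b (bs ! i) \<omega> r)) \<le> l)"
        using measurable_Max_list[OF list_measurable_run[OF list_measurable_const measurable_component_D]]
        by measurable
      have "emeasure S {\<omega>\<in>space S. ?E bs (length (bs ! i) + r * (b - 1)) (Suc n) \<omega>}
        \<le> (\<integral>\<^sup>+v. emeasure S {\<omega>\<in>space S. Max (set (run b (split_max (bs ! i) (pieces b v)) \<omega> r')) \<le> l} \<partial>D)"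
        unfolding eq
      proof (rule nn_integral_mono_AE)
        show "AE v in D. emeasure S {\<omega>\<in>space S. ?E (split_block bs (pieces b v)) (length (bs ! i) + r * (b - 1)) n \<omega>}
          \<le> emeasure S {\<omega>\<in>space S. Max (set (run b (split_max (bs ! i) (pieces b v)) \<omega> r')) \<le> l}"
          using D_unit
        proof eventually_elim
          case (elim v)
          show ?case
            using Suc.IH[OF proper[OF elim], of r'] p(2) unfolding k[of v] nth if_P[OF True] by simp
        qed
      qed
      also have "\<dots> = emeasure S {\<omega>\<in>space S. Max (set (run b (bs ! i) \<omega> r)) \<le> l}"
        unfolding emeasure_case_nat[OF meas] by (simp only: Suc run_case_nat)
      finally show ?thesis .
    qed
  qed
qed

end

section \<open>Uniformity of the division points\<close>

lemma run_add: "run b s \<omega> (m + n) = run b (run b s \<omega> m) (\<lambda>k. \<omega> (m + k)) n"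
  by (induction n) simp_all

lemma list_measurable_singleton:
  assumes [measurable]: "g \<in> borel_measurable M"
  shows "list_measurable M (\<lambda>x. [g x])"
  by (simp add: list_measurable_def nth_default_Cons split: nat.split)

lemma pred_three_inequalities:
  fixes f g h :: "'a \<Rightarrow> real"
  assumes [measurable]: "f \<in> borel_measurable M" "g \<in> borel_measurable M" "h \<in> borel_measurable M"
  shows "Measurable.pred M (\<lambda>x. \<eta> \<le> f x \<and> g x \<le> a * f x - d \<and> h x \<le> l)"
  by measurable

section \<open>Counting the spacings to the left of a point\<close>

lemma count_in_ge:
  assumes "\<forall>x\<in>set s. 0 \<le> x" "p \<le> length s" "sum_list (take p s) \<le> y"
  shows "p \<le> count_in s y"
proof -
  have "{1..p} \<subseteq> {k. 1 \<le> k \<and> k \<le> length s \<and> sum_list (take k s) \<le> y}"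
  proof
    fix k assume k: "k \<in> {1..p}"
    have "sum_list (take k (take p s)) \<le> sum_list (take p s)"
      using assms(1) by (intro sum_list_take_le) (auto dest: in_set_takeD)
    then show "k \<in> {k. 1 \<le> k \<and> k \<le> length s \<and> sum_list (take k s) \<le> y}"
      using k assms(2,3) by (simp add: min_def)
  qed
  then have "card {1..p} \<le> count_in s y"
    unfolding count_in_def by (rule card_mono[rotated]) (rule finite_subset[of _ "{..length s}"], auto)
  then show ?thesis by simp
qed

lemma count_in_le:
  assumes "\<forall>x\<in>set s. 0 \<le> x" "y < sum_list (take p s)"
  shows "count_in s y \<le> p"
proof -
  have "{k. 1 \<le> k \<and> k \<le> length s \<and> sum_list (take k s) \<le> y} \<subseteq> {1..p}"
  proof
    fix k assume "k \<in> {k. 1 \<le> k \<and> k \<le> length s \<and> sum_list (take k s) \<le> y}"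
    then have k: "1 \<le> k" "sum_list (take k s) \<le> y" by auto
    have "sum_list (take p (take k s)) \<le> sum_list (take k s)"
      using assms(1) by (intro sum_list_take_le) (auto dest: in_set_takeD)
    then have "k < p \<or> k = p"
      using k(2) assms(2) by (cases "p \<le> k") (auto simp: min_def)
    then show "k \<in> {1..p}" using k(1) by auto
  qed
  then have "count_in s y \<le> card {1..p}"
    unfolding count_in_def by (intro card_mono) auto
  then show ?thesis by simp
qed

lemma count_in_le_length: "count_in s y \<le> length s"
proof -
  have "count_in s y \<le> card {1..length s}"
    unfolding count_in_def by (intro card_mono) auto
  then show ?thesis by simp
qed

lemma length_concat_lower_bound:
  fixes K \<eta> \<beta> :: real
  assumes "list_all2 (\<lambda>z t. K * (z - \<eta>) - \<beta> \<le> real (length t)) s B"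
  shows "K * (sum_list s - real (length s) * \<eta>) - real (length s) * \<beta> \<le> real (length (concat B))"
  using assms by (induction rule: list_all2_induct) (auto simp: algebra_simps)

lemma sum_list_concat: "sum_list (concat xss) = sum_list (map sum_list xss)"
  by (induction xss) auto

text \<open>Blocks inside \<open>(0, y)\<close> bound the count from below, and blocks beyond
  \<open>y\<close> bound its complement from below; only the block straddling \<open>y\<close>, of
  length at most \<open>\<rho>\<close>, is lost in each. Lower bounds on block sizes thus give both
  directions. In them \<open>\<eta>\<close> absorbs spacings too short to be controlled, and
  \<open>\<beta>\<close> the rounding.\<close>

lemma count_in_concat_bounds:
  fixes K \<eta> \<beta> \<rho> y :: real
  assumes nonneg: "\<forall>x\<in>set (concat B). 0 \<le> x" and s: "map sum_list B = s" "sum_list s = 1"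
    and s_bounds: "\<forall>z\<in>set s. 0 \<le> z \<and> z \<le> \<rho>" and y: "0 \<le> y" "y \<le> 1"
    and K: "0 \<le> K" "0 \<le> \<eta>" "0 \<le> \<beta>" "0 \<le> \<rho>"
    and len: "list_all2 (\<lambda>z t. K * (z - \<eta>) - \<beta> \<le> real (length t)) s B"
  shows "K * (y - \<rho> - real (length s) * \<eta>) - real (length s) * \<beta> \<le> real (count_in (concat B) y)"
    and "K * (1 - y - \<rho> - real (length s) * \<eta>) - real (length s) * \<beta>
      \<le> real (length (concat B)) - real (count_in (concat B) y)"
proof -
  let ?J = "length s"
  \<comment> \<open>The maximum \<open>j\<close> of this set is the number of initial blocks that
    fit into \<open>(0, y)\<close>; unless all do, the next block straddles
    \<open>y\<close>.\<close>
  define A where "A = {j. j \<le> ?J \<and> sum_list (take j s) \<le> y}"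
  define j where "j = Max A"
  have A: "finite A" "0 \<in> A" using y unfolding A_def by auto
  then have "j \<in> A" unfolding j_def by (intro Max_in) auto
  then have j: "j \<le> ?J" "sum_list (take j s) \<le> y" by (auto simp: A_def)
  have next_gt: "y < sum_list (take (Suc j) s)" if "j < ?J"
  proof (rule ccontr)
    assume "\<not> y < sum_list (take (Suc j) s)"
    then have "Suc j \<in> A" using that by (simp add: A_def)
    then have "Suc j \<le> j" unfolding j_def using A(1) by (intro Max_ge)
    then show False by simp
  qed
  have next_le: "sum_list (take (Suc j) s) \<le> sum_list (take j s) + \<rho>" if "j < ?J"
    using s_bounds nth_mem[OF that] by (simp add: take_Suc_conv_app_nth[OF that])
  have split: "concat B = concat (take k B) @ concat (drop k B)" for k
    by (metis append_take_drop_id concat_append)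
  have take: "take (length (concat (take k B))) (concat B) = concat (take k B)" for k
    using split[of k] by (metis append_eq_conv_conj)
  have sum: "sum_list (concat (take k B)) = sum_list (take k s)" for k
    unfolding sum_list_concat s(1)[symmetric] by (simp add: take_map)
  have weaken: "K * (t - real ?J * \<eta>) - real ?J * \<beta> \<le> K * (t' - real k * \<eta>) - real k * \<beta>"
    if "k \<le> ?J" "t \<le> t'" for k t t'
  proof -
    have "real k * \<eta> \<le> real ?J * \<eta>" "real k * \<beta> \<le> real ?J * \<beta>"
      using that(1) K by (auto intro: mult_right_mono)
    moreover from this have "K * (t - real ?J * \<eta>) \<le> K * (t' - real k * \<eta>)"
      using that(2) K by (intro mult_left_mono) auto
    ultimately show ?thesis by linarith
  qed
  have low: "y - \<rho> \<le> sum_list (take j s)"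
  proof (cases "j < ?J")
    case True
    then show ?thesis using next_gt next_le by simp
  next
    case False
    then show ?thesis using j(1) s(2) y K(4) by simp
  qed
  have "K * (y - \<rho> - real ?J * \<eta>) - real ?J * \<beta> \<le> real (length (concat (take j B)))"
    using weaken[OF j(1) low] length_concat_lower_bound[OF list_all2_takeI[OF len, of j]]
    unfolding length_take min.absorb2[OF j(1)] by linarith
  moreover have "length (concat (take j B)) \<le> count_in (concat B) y"
    using arg_cong[OF split[of j], of length] j(2)
    by (intro count_in_ge nonneg) (simp_all only: take sum length_append le_add1)
  ultimately show "K * (y - \<rho> - real ?J * \<eta>) - real ?J * \<beta> \<le> real (count_in (concat B) y)"
    by linarith
  show "K * (1 - y - \<rho> - real ?J * \<eta>) - real ?J * \<beta>
      \<le> real (length (concat B)) - real (count_in (concat B) y)"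
  proof (cases "j < ?J")
    case True
    have "sum_list s = sum_list (take (Suc j) s) + sum_list (drop (Suc j) s)"
      by (metis append_take_drop_id sum_list_append)
    then have "1 - y - \<rho> \<le> sum_list (drop (Suc j) s)"
      using next_le[OF True] j(2) s(2) by linarith
    from weaken[OF _ this, of "?J - Suc j"]
    have "K * (1 - y - \<rho> - real ?J * \<eta>) - real ?J * \<beta> \<le> real (length (concat (drop (Suc j) B)))"
      using length_concat_lower_bound[OF list_all2_dropI[OF len, of "Suc j"]] by simp
    moreover have "count_in (concat B) y \<le> length (concat (take (Suc j) B))"
      using next_gt[OF True] by (intro count_in_le nonneg) (simp only: take sum)
    moreover have "length (concat B) = length (concat (take (Suc j) B)) + length (concat (drop (Suc j) B))"
      using arg_cong[OF split[of "Suc j"], of length] by (simp only: length_append)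
    ultimately show ?thesis by linarith
  next
    \<comment> \<open>All blocks fit into \<open>(0, y)\<close>, so \<open>y\<close> is 1 and the
      left-hand side is not positive.\<close>
    case False
    then have "1 - y \<le> 0" using j s(2) by simp
    moreover have "0 \<le> real ?J * \<eta>" "0 \<le> real ?J * \<beta>" using K by simp_all
    ultimately have "1 - y - \<rho> - real ?J * \<eta> \<le> 0" using K(4) by linarith
    with K(1) have "K * (1 - y - \<rho> - real ?J * \<eta>) \<le> 0" by (rule mult_nonneg_nonpos)
    then show ?thesis
      using \<open>0 \<le> real ?J * \<beta>\<close> count_in_le_length[of "concat B" y] by linarith
  qed
qed

lemma (in prob_space) whp_complement:
  assumes "\<And>\<delta>. 0 < \<delta> \<Longrightarrow> \<exists>N. \<forall>n\<ge>N. {\<omega>\<in>space M. Q n \<omega>} \<in> sets M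
    \<and> emeasure M {\<omega>\<in>space M. Q n \<omega>} \<le> ennreal \<delta>"
  shows "whp M (\<lambda>n \<omega>. \<not> Q n \<omega>)"
  unfolding whp_def
proof (intro allI impI)
  fix \<delta> :: real assume "0 < \<delta>"
  then obtain N where N: "\<forall>n\<ge>N. {\<omega>\<in>space M. Q n \<omega>} \<in> sets M
    \<and> emeasure M {\<omega>\<in>space M. Q n \<omega>} \<le> ennreal \<delta>" using assms by blast
  show "\<exists>N. \<forall>n\<ge>N. \<exists>A\<in>sets M. prob A \<ge> 1 - \<delta> \<and> (\<forall>\<omega>\<in>A. \<not> Q n \<omega>)"
  proof (intro exI[of _ N] allI impI)
    fix n assume "N \<le> n"
    then have B: "{\<omega>\<in>space M. Q n \<omega>} \<in> sets M" "emeasure M {\<omega>\<in>space M. Q n \<omega>} \<le> ennreal \<delta>"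
      using N by auto
    then have "prob {\<omega>\<in>space M. Q n \<omega>} \<le> \<delta>"
      using \<open>0 < \<delta>\<close> by (simp add: emeasure_eq_measure)
    then have "1 - \<delta> \<le> prob (space M - {\<omega>\<in>space M. Q n \<omega>})"
      using B(1) by (simp add: prob_compl)
    then show "\<exists>A\<in>sets M. prob A \<ge> 1 - \<delta> \<and> (\<forall>\<omega>\<in>A. \<not> Q n \<omega>)"
      using B(1) by (intro bexI[of _ "space M - {\<omega>\<in>space M. Q n \<omega>}"]) auto
  qed
qed

text \<open>Lets a starting time and a good event \<open>A\<close> be fixed first, depending on
  \<open>\<delta>\<close>, and the asymptotics be studied on \<open>A\<close> afterwards.\<close>

lemma (in prob_space) whp_local:
  assumes "\<And>\<delta>. 0 < \<delta> \<Longrightarrow> \<exists>A\<in>sets M. prob A \<ge> 1 - \<delta> \<and> whp M (\<lambda>n \<omega>. \<omega> \<in> A \<longrightarrow> Q n \<omega>)"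
  shows "whp M Q"
  unfolding whp_def
proof (intro allI impI)
  fix \<delta> :: real assume "0 < \<delta>"
  then have d: "0 < \<delta> / 2" by simp
  obtain A where A: "A \<in> sets M" "prob A \<ge> 1 - \<delta> / 2" "whp M (\<lambda>n \<omega>. \<omega> \<in> A \<longrightarrow> Q n \<omega>)"
    using assms[OF d] by blast
  obtain N where N: "\<forall>n\<ge>N. \<exists>B\<in>sets M. prob B \<ge> 1 - \<delta> / 2 \<and> (\<forall>\<omega>\<in>B. \<omega> \<in> A \<longrightarrow> Q n \<omega>)"
    using A(3) d unfolding whp_def by blast
  show "\<exists>N. \<forall>n\<ge>N. \<exists>A\<in>sets M. prob A \<ge> 1 - \<delta> \<and> (\<forall>\<omega>\<in>A. Q n \<omega>)"
  proof (intro exI[of _ N] allI impI)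
    fix n assume "N \<le> n"
    then obtain B where B: "B \<in> sets M" "prob B \<ge> 1 - \<delta> / 2" "\<forall>\<omega>\<in>B. \<omega> \<in> A \<longrightarrow> Q n \<omega>"
      using N by blast
    have "1 - \<delta> \<le> prob (A \<inter> B)"
      using prob_Int_ge[OF A(1) B(1)] A(2) B(2) by simp
    then show "\<exists>A\<in>sets M. prob A \<ge> 1 - \<delta> \<and> (\<forall>\<omega>\<in>A. Q n \<omega>)"
      using A(1) B(1,3) by (intro bexI[of _ "A \<inter> B"]) auto
  qed
qed

lemma whp_offset:
  assumes "whp M (\<lambda>n. Q (m + n))"
  shows "whp M Q"
  unfolding whp_def
proof (intro allI impI)
  fix \<delta> :: real assume "0 < \<delta>"
  then obtain N where N: "\<forall>n\<ge>N. \<exists>A\<in>sets M. measure M A \<ge> 1 - \<delta> \<and> (\<forall>\<omega>\<in>A. Q (m + n) \<omega>)"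
    using assms unfolding whp_def by blast
  show "\<exists>N. \<forall>n\<ge>N. \<exists>A\<in>sets M. measure M A \<ge> 1 - \<delta> \<and> (\<forall>\<omega>\<in>A. Q n \<omega>)"
  proof (intro exI[of _ "m + N"] allI impI)
    fix n assume "m + N \<le> n"
    then have "N \<le> n - m" "m + (n - m) = n" by auto
    then show "\<exists>A\<in>sets M. measure M A \<ge> 1 - \<delta> \<and> (\<forall>\<omega>\<in>A. Q n \<omega>)"
      using N[rule_format, of "n - m"] by simp
  qed
qed

section \<open>Block sizes when \<open>1 / (L_n N_n)\<close> converges\<close>

definition (in fragmentation) spacing_number :: "nat \<Rightarrow> real" where
  "spacing_number n = real (Suc (n * (b - 1)))"

locale convergent_fragmentation = fragmentation +
  fixes c :: real
  assumes c: "0 < c"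
    and conv: "\<And>\<epsilon>. 0 < \<epsilon> \<Longrightarrow> whp S (\<lambda>n \<omega>. \<bar>1 / (largest b \<omega> n * spacing_number n) - c\<bar> \<le> \<epsilon>)"
begin

lemma spacing_number_pos: "0 < spacing_number n"
  unfolding spacing_number_def by (simp del: of_nat_Suc)

lemma spacing_number_ge: "real n \<le> spacing_number n"
  unfolding spacing_number_def by (rule le_length_frag_state)

lemma spacing_number_Suc: "spacing_number (Suc n) = spacing_number n + real b - 1"
proof -
  have "real (b - 1) = real b - 1" using b by simp
  then show ?thesis
    by (simp only: spacing_number_def of_nat_Suc of_nat_mult) (simp add: algebra_simps)
qed

lemma spacing_number_mono: "m \<le> n \<Longrightarrow> spacing_number m \<le> spacing_number n"
  unfolding spacing_number_def by (simp add: mult_right_mono)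

lemma largest_bounds:
  assumes "\<bar>1 / (largest b \<omega> n * spacing_number n) - c\<bar> \<le> \<theta>" "0 < \<theta>" "\<theta> < c"
  shows "largest b \<omega> n \<le> 1 / ((c - \<theta>) * spacing_number n)" "1 / ((c + \<theta>) * spacing_number n) \<le> largest b \<omega> n"
proof -
  have L: "0 < largest b \<omega> n" by (rule largest_pos[OF b1])
  have 1: "c - \<theta> \<le> 1 / (largest b \<omega> n * spacing_number n)" "1 / (largest b \<omega> n * spacing_number n) \<le> c + \<theta>"
    using assms(1) by linarith+
  have "(c - \<theta>) * (largest b \<omega> n * spacing_number n) \<le> 1"
    using 1(1) L spacing_number_pos[of n] by (simp add: pos_le_divide_eq)
  then have "largest b \<omega> n * ((c - \<theta>) * spacing_number n) \<le> 1" by (simp only: mult_ac)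
  then show "largest b \<omega> n \<le> 1 / ((c - \<theta>) * spacing_number n)"
    using assms spacing_number_pos[of n] by (simp add: pos_le_divide_eq)
  have "1 \<le> (c + \<theta>) * (largest b \<omega> n * spacing_number n)"
    using 1(2) L spacing_number_pos[of n] by (simp add: pos_divide_le_eq)
  then have "1 \<le> largest b \<omega> n * ((c + \<theta>) * spacing_number n)" by (simp only: mult_ac)
  then show "1 / ((c + \<theta>) * spacing_number n) \<le> largest b \<omega> n"
    using assms c spacing_number_pos[of n] by (simp add: pos_divide_le_eq)
qed

text \<open>By \<open>block_domination\<close> a short block would force its stand-alone copy to
  have mesh at most \<open>l\<close> after \<open>r\<close> splits. That mesh is
  \<open>z * L_r\<close>, about \<open>z / (c * N_r)\<close>, and exceeds \<open>l\<close> as long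
  as \<open>N_r < X\<close>. The factor \<open>(c - \<theta>) / (c + \<theta>)\<close> compares the
  upper estimate of the mesh at time \<open>m + n\<close> with the lower estimate of
  \<open>L_r\<close>. The threshold \<open>n0\<close> is uniform over all configurations with
  \<open>z \<ge> \<eta>\<close>, so that the past can be integrated out.\<close>

lemma short_block_unlikely:
  assumes \<theta>: "0 < \<theta>" "\<theta> < c" and \<delta>: "0 < \<delta>" and \<eta>: "0 < \<eta>"
  shows "\<exists>n0. \<forall>n\<ge>n0. \<forall>bs i z. proper_blocks bs \<longrightarrow> i < length bs \<longrightarrow> bs ! i = [z] \<longrightarrow> \<eta> \<le> z \<longrightarrow>
    emeasure S {\<omega>\<in>space S. real (length (run_blocks b bs \<omega> n ! i)) \<le> (c - \<theta>) / (c + \<theta>) * spacing_number (m + n) * z - real b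
      \<and> Max (set (concat (run_blocks b bs \<omega> n))) \<le> 1 / ((c - \<theta>) * spacing_number (m + n))} \<le> ennreal \<delta>"
proof -
  define \<kappa> where "\<kappa> = (c - \<theta>) / (c + \<theta>)"
  have \<kappa>: "0 < \<kappa>" using \<theta> c by (simp add: \<kappa>_def)
  obtain R0 where R0: "\<forall>r\<ge>R0. \<exists>A\<in>sets S. P.prob A \<ge> 1 - \<delta>
      \<and> (\<forall>\<omega>\<in>A. \<bar>1 / (largest b \<omega> r * spacing_number r) - c\<bar> \<le> \<theta>)"
    using conv[OF \<theta>(1)] \<delta> unfolding whp_def by blast
  obtain n0 :: nat where n0: "spacing_number (Suc R0) / (\<kappa> * \<eta>) < real n0"
    using reals_Archimedean2 by blast
  show ?thesis
    unfolding \<kappa>_def[symmetric]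
  proof (intro exI[of _ n0] allI impI)
    fix n bs i z
    assume n: "n0 \<le> n" and bs: "proper_blocks bs" "i < length bs" "bs ! i = [z]" and z: "\<eta> \<le> z"
    define X where "X = \<kappa> * spacing_number (m + n) * z"
    define l where "l = 1 / ((c - \<theta>) * spacing_number (m + n))"
    have "spacing_number (Suc R0) / (\<kappa> * \<eta>) < spacing_number (m + n)"
      using n0 n spacing_number_ge[of n] spacing_number_mono[of n "m + n"] by linarith
    then have "spacing_number (Suc R0) < spacing_number (m + n) * (\<kappa> * \<eta>)"
      using \<kappa> \<eta> by (simp add: pos_divide_less_eq)
    also have "\<dots> = \<kappa> * spacing_number (m + n) * \<eta>" by simp
    also have "\<dots> \<le> X"
      unfolding X_def using z \<kappa> spacing_number_pos[of "m + n"] by (intro mult_left_mono) auto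
    finally have X: "spacing_number (Suc R0) < X" .
    obtain q :: nat where "X \<le> real q" using real_arch_simple by blast
    then have "X \<le> spacing_number (Suc q)" using spacing_number_ge[of q] spacing_number_mono[of q "Suc q"] by linarith
    then have ex: "\<exists>r. X \<le> spacing_number (Suc r)" by blast
    \<comment> \<open>The last \<open>r\<close> with \<open>spacing_number r < X\<close>. A split
      adds \<open>b - 1\<close> spacings, so a block of length at most \<open>X - real b\<close> has
      at most \<open>spacing_number r\<close> entries. The size of \<open>X\<close> forces
      \<open>R0 < r\<close>, which puts the estimate for \<open>L_r\<close> at disposal.\<close>
    define r where "r = (LEAST r. X \<le> spacing_number (Suc r))"
    have r: "X \<le> spacing_number (Suc r)" unfolding r_def using ex by (rule LeastI_ex)
    have rR: "R0 < r"
    proof (rule ccontr)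
      assume "\<not> R0 < r"
      then have "spacing_number (Suc r) \<le> spacing_number (Suc R0)" by (intro spacing_number_mono) simp
      then show False using r X by linarith
    qed
    then have "\<not> X \<le> spacing_number (Suc (r - 1))"
      unfolding r_def by (intro not_less_Least) simp
    then have Xr: "spacing_number r < X" using rR by simp
    obtain A where A: "A \<in> sets S" "P.prob A \<ge> 1 - \<delta>" "\<forall>\<omega>\<in>A. \<bar>1 / (largest b \<omega> r * spacing_number r) - c\<bar> \<le> \<theta>"
      using R0 rR by (meson less_imp_le)
    have "emeasure S {\<omega>\<in>space S. real (length (run_blocks b bs \<omega> n ! i)) \<le> X - real b
        \<and> Max (set (concat (run_blocks b bs \<omega> n))) \<le> l}
      \<le> emeasure S {\<omega>\<in>space S. length (run_blocks b bs \<omega> n ! i) \<le> length (bs ! i) + r * (b - 1)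
        \<and> Max (set (concat (run_blocks b bs \<omega> n))) \<le> l}"
    proof (rule emeasure_mono)
      have "k \<le> length (bs ! i) + r * (b - 1)" if "real k \<le> X - real b" for k
      proof -
        have "real k \<le> spacing_number r" using that r spacing_number_Suc[of r] by linarith
        then show ?thesis by (simp only: spacing_number_def of_nat_le_iff bs(3)) simp
      qed
      then show "{\<omega>\<in>space S. real (length (run_blocks b bs \<omega> n ! i)) \<le> X - real b
          \<and> Max (set (concat (run_blocks b bs \<omega> n))) \<le> l}
        \<subseteq> {\<omega>\<in>space S. length (run_blocks b bs \<omega> n ! i) \<le> length (bs ! i) + r * (b - 1)
          \<and> Max (set (concat (run_blocks b bs \<omega> n))) \<le> l}"
        by blast
      show "{\<omega>\<in>space S. length (run_blocks b bs \<omega> n ! i) \<le> length (bs ! i) + r * (b - 1)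
          \<and> Max (set (concat (run_blocks b bs \<omega> n))) \<le> l} \<in> sets S"
        using measurable_block_event[OF bs(2)] by (simp only: pred_def)
    qed
    also have "\<dots> \<le> emeasure S {\<omega>\<in>space S. Max (set (run b (bs ! i) \<omega> r)) \<le> l}"
      by (rule block_domination[OF bs(1,2)])
    also have "\<dots> \<le> emeasure S (space S - A)"
    proof (rule emeasure_mono)
      show "{\<omega>\<in>space S. Max (set (run b (bs ! i) \<omega> r)) \<le> l} \<subseteq> space S - A"
      proof (intro subsetI DiffI)
        fix \<omega> assume w: "\<omega> \<in> {\<omega>\<in>space S. Max (set (run b (bs ! i) \<omega> r)) \<le> l}"
        then show "\<omega> \<in> space S" by blast
        show "\<omega> \<notin> A"
        proof
          assume "\<omega> \<in> A"
          then have "\<bar>1 / (largest b \<omega> r * spacing_number r) - c\<bar> \<le> \<theta>" using A(3) by blast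
          note L = largest_bounds(2)[OF this \<theta>]
          have zpos: "0 < z" using z \<eta> by linarith
          have ne: "run b [1] \<omega> r \<noteq> []" by (rule run_not_Nil[OF b1]) simp
          have "run b [z] \<omega> r = map ((*) z) (run b [1] \<omega> r)"
            using run_scale[OF b1, of "[1]" z \<omega> r] zpos by simp
          moreover have "z * Max (set (run b [1] \<omega> r)) = Max ((*) z ` set (run b [1] \<omega> r))"
            using zpos ne by (intro mono_Max_commute) (auto simp: mono_def)
          ultimately have "z * largest b \<omega> r \<le> l"
            using w bs(3) by (simp add: largest_eq)
          moreover have "z * (1 / ((c + \<theta>) * spacing_number r)) \<le> z * largest b \<omega> r"
            using L zpos by (intro mult_left_mono) auto
          ultimately have le: "z / ((c + \<theta>) * spacing_number r) \<le> 1 / ((c - \<theta>) * spacing_number (m + n))"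
            unfolding l_def by simp
          have "0 < (c + \<theta>) * spacing_number r" "0 < (c - \<theta>) * spacing_number (m + n)"
            using c \<theta> spacing_number_pos by simp_all
          then have "z * ((c - \<theta>) * spacing_number (m + n)) \<le> (c + \<theta>) * spacing_number r"
            using le by (simp add: divide_simps mult_ac split: if_splits)
          then have "X * (c + \<theta>) \<le> spacing_number r * (c + \<theta>)"
            unfolding X_def \<kappa>_def using c \<theta> by (simp add: mult_ac)
          then have "X \<le> spacing_number r" using c \<theta> by simp
          then show False using Xr by linarith
        qed
      qed
    qed (use A(1) in auto)
    also have "\<dots> \<le> ennreal \<delta>"
      using A(1,2) \<delta> by (simp add: P.emeasure_eq_measure P.prob_compl)
    finally show "emeasure S {\<omega>\<in>space S. real (length (run_blocks b bs \<omega> n ! i)) \<le> \<kappa> * spacing_number (m + n) * z - real b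
      \<and> Max (set (concat (run_blocks b bs \<omega> n))) \<le> 1 / ((c - \<theta>) * spacing_number (m + n))} \<le> ennreal \<delta>"
      unfolding X_def l_def .
  qed
qed

text \<open>Genealogy of the spacings: block \<open>i\<close> collects the descendants at time
  \<open>m + n\<close> of the \<open>i\<close>-th spacing at time \<open>m\<close>.\<close>

definition blocks :: "nat \<Rightarrow> (nat \<Rightarrow> nat \<Rightarrow> real) \<Rightarrow> nat \<Rightarrow> real list list" where
  "blocks m \<omega> n = run_blocks b (map (\<lambda>z. [z]) (frag_state b \<omega> m)) (\<lambda>k. \<omega> (m + k)) n"

text \<open>\<open>short_block_unlikely\<close> concerns a fixed configuration; conditioning on the
  first \<open>m\<close> divisions reduces the random one to it. The mesh bound remains inside the
  negation because block domination controls the joint event only.\<close>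

lemma block_lengths:
  assumes \<theta>: "0 < \<theta>" "\<theta> < c" and \<eta>: "0 < \<eta>" and i: "i < Suc (m * (b - 1))"
  shows "whp S (\<lambda>n \<omega>. \<not> (\<eta> \<le> frag_state b \<omega> m ! i
    \<and> real (length (blocks m \<omega> n ! i)) \<le> (c - \<theta>) / (c + \<theta>) * spacing_number (m + n) * (frag_state b \<omega> m ! i) - real b
    \<and> Max (set (concat (blocks m \<omega> n))) \<le> 1 / ((c - \<theta>) * spacing_number (m + n))))"
proof (rule P.whp_complement)
  fix \<delta> :: real assume \<delta>: "0 < \<delta>"
  define \<kappa> where "\<kappa> = (c - \<theta>) / (c + \<theta>)"
  let ?J = "Suc (m * (b - 1))"
  let ?Q = "\<lambda>n \<omega>. \<eta> \<le> frag_state b \<omega> m ! i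
    \<and> real (length (blocks m \<omega> n ! i)) \<le> \<kappa> * spacing_number (m + n) * (frag_state b \<omega> m ! i) - real b
    \<and> Max (set (concat (blocks m \<omega> n))) \<le> 1 / ((c - \<theta>) * spacing_number (m + n))"
  obtain n0 where n0: "\<And>n bs i z. n0 \<le> n \<Longrightarrow> proper_blocks bs \<Longrightarrow> i < length bs \<Longrightarrow> bs ! i = [z] \<Longrightarrow> \<eta> \<le> z \<Longrightarrow>
    emeasure S {\<omega>\<in>space S. real (length (run_blocks b bs \<omega> n ! i)) \<le> \<kappa> * spacing_number (m + n) * z - real b
      \<and> Max (set (concat (run_blocks b bs \<omega> n))) \<le> 1 / ((c - \<theta>) * spacing_number (m + n))} \<le> ennreal \<delta>"
    using short_block_unlikely[OF \<theta> \<delta> \<eta>, of m] unfolding \<kappa>_def by blast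
  have len: "length (frag_state b \<omega> m) = ?J" for \<omega> by (rule length_frag_state[OF b1])
  have state: "list_measurable S (\<lambda>\<omega>. frag_state b \<omega> m)"
    unfolding frag_state_eq_run by (intro list_measurable_run list_measurable_const measurable_component_D)
  have entry: "(\<lambda>\<omega>. frag_state b \<omega> m ! j) \<in> borel_measurable S" if "j < ?J" for j
    using list_measurableD(2)[OF state, of j] that by (simp add: nth_default_nth len)
  have B: "list_measurable S (\<lambda>\<omega>. blocks m \<omega> n ! j)" if "j < ?J" for n j
    unfolding blocks_def
  proof (rule list_measurable_run_blocks_nth)
    show "length (map (\<lambda>z. [z]) (frag_state b \<omega> m)) = ?J" for \<omega> by (simp add: len)
    show "list_measurable S (\<lambda>\<omega>. map (\<lambda>z. [z]) (frag_state b \<omega> m) ! j)" if "j < ?J" for j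
      using list_measurable_singleton[OF entry[OF that]] that by (simp add: len)
  qed (use that in auto)
  have len_blocks: "length (blocks m \<omega> n) = ?J" for \<omega> n by (simp add: blocks_def len)
  have meas: "Measurable.pred S (?Q n)" for n
  proof -
    have "(\<lambda>\<omega>. Max (set (concat (blocks m \<omega> n)))) \<in> borel_measurable S"
      by (rule measurable_Max_list[OF list_measurable_concat[OF B len_blocks]])
    moreover have "(\<lambda>\<omega>. real (length (blocks m \<omega> n ! i))) \<in> borel_measurable S"
      using measurable_compose[OF list_measurableD(1)[OF B[OF i, of n]], of real borel] by simp
    ultimately show ?thesis
      using entry[OF i] by (intro pred_three_inequalities)
  qed
  show "\<exists>N. \<forall>n\<ge>N. {\<omega>\<in>space S. \<eta> \<le> frag_state b \<omega> m ! i
      \<and> real (length (blocks m \<omega> n ! i)) \<le> (c - \<theta>) / (c + \<theta>) * spacing_number (m + n) * (frag_state b \<omega> m ! i) - real b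
      \<and> Max (set (concat (blocks m \<omega> n))) \<le> 1 / ((c - \<theta>) * spacing_number (m + n))} \<in> sets S
    \<and> emeasure S {\<omega>\<in>space S. \<eta> \<le> frag_state b \<omega> m ! i
      \<and> real (length (blocks m \<omega> n ! i)) \<le> (c - \<theta>) / (c + \<theta>) * spacing_number (m + n) * (frag_state b \<omega> m ! i) - real b
      \<and> Max (set (concat (blocks m \<omega> n))) \<le> 1 / ((c - \<theta>) * spacing_number (m + n))} \<le> ennreal \<delta>"
    unfolding \<kappa>_def[symmetric]
  proof (intro exI[of _ n0] allI impI conjI)
    fix n assume n: "n0 \<le> n"
    show "{\<omega>\<in>space S. ?Q n \<omega>} \<in> sets S" using meas[of n] by (simp only: pred_def)
    have "emeasure S {\<omega>\<in>space S. ?Q n \<omega>} = (\<integral>\<^sup>+\<omega>. emeasure S {\<omega>'\<in>space S. ?Q n (comb_seq m \<omega> \<omega>')} \<partial>S)"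
      by (rule emeasure_comb_seq[OF meas])
    also have "\<dots> \<le> (\<integral>\<^sup>+\<omega>. ennreal \<delta> \<partial>S)"
    proof (rule nn_integral_mono_AE)
      show "AE \<omega> in S. emeasure S {\<omega>'\<in>space S. ?Q n (comb_seq m \<omega> \<omega>')} \<le> ennreal \<delta>"
        using AE_valid
      proof eventually_elim
        case (elim \<omega>)
        let ?s = "frag_state b \<omega> m"
        let ?bs = "map (\<lambda>z. [z]) ?s"
        have s: "frag_state b (comb_seq m \<omega> \<omega>') m = ?s" for \<omega>'
          using run_comb_seq[of b "[1]" m \<omega> \<omega>' 0] by (simp add: frag_state_eq_run)
        have "(\<lambda>k. comb_seq m \<omega> \<omega>' (m + k)) = \<omega>'" for \<omega>'
          by (simp add: fun_eq_iff comb_seq_add add.commute[of m])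
        then have blk: "blocks m (comb_seq m \<omega> \<omega>') n = run_blocks b ?bs \<omega>' n" for \<omega>'
          unfolding blocks_def s by simp
        have "?bs \<noteq> []" using len[of \<omega>] by auto
        then have proper: "proper_blocks ?bs"
          using frag_state_nonneg[OF b1, of \<omega>] elim by (auto simp: proper_blocks_def)
        show ?case
        proof (cases "\<eta> \<le> ?s ! i")
          case True
          have "i < length ?bs" "?bs ! i = [?s ! i]" using i len[of \<omega>] by simp_all
          from n0[OF n proper this True] show ?thesis
            unfolding s blk using True by simp
        next
          case False
          then show ?thesis unfolding s by simp
        qed
      qed
    qed
    also have "\<dots> = ennreal \<delta>" by (simp add: P.emeasure_space_1)
    finally show "emeasure S {\<omega>\<in>space S. ?Q n \<omega>} \<le> ennreal \<delta>" .
  qed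
qed

lemma largest_tendsto_0:
  assumes "0 < \<epsilon>"
  shows "whp S (\<lambda>n \<omega>. largest b \<omega> n \<le> \<epsilon>)"
proof -
  have c2: "0 < c / 2" "c / 2 < c" using c by simp_all
  obtain n0 :: nat where n0: "2 / (c * \<epsilon>) < real n0" using reals_Archimedean2 by blast
  show ?thesis
  proof (rule P.whp_eventually_mono[OF conv[OF c2(1)]])
    show "\<forall>\<^sub>F n in sequentially. \<forall>\<omega>. \<bar>1 / (largest b \<omega> n * spacing_number n) - c\<bar> \<le> c / 2 \<longrightarrow> largest b \<omega> n \<le> \<epsilon>"
      using eventually_ge_at_top[of n0]
    proof eventually_elim
      case (elim n)
      show ?case
      proof (intro allI impI)
        fix \<omega> assume "\<bar>1 / (largest b \<omega> n * spacing_number n) - c\<bar> \<le> c / 2"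
        from largest_bounds(1)[OF this c2]
        have "largest b \<omega> n \<le> 1 / ((c / 2) * spacing_number n)" by simp
        also have "\<dots> \<le> \<epsilon>"
        proof -
          have "2 / (c * \<epsilon>) \<le> spacing_number n" using n0 elim spacing_number_ge[of n] by linarith
          then have "2 \<le> spacing_number n * (c * \<epsilon>)" using c assms by (simp add: pos_divide_le_eq)
          then have "1 \<le> \<epsilon> * ((c / 2) * spacing_number n)" by (simp add: mult_ac)
          then show ?thesis using c spacing_number_pos[of n] by (simp add: pos_divide_le_eq)
        qed
        finally show "largest b \<omega> n \<le> \<epsilon>" .
      qed
    qed
  qed
qed

text \<open>The time \<open>m\<close> is fixed so late that all spacings are short, and then
  \<open>n\<close> tends to infinity. There are four losses of \<open>\<epsilon> / 4\<close>: the
  spacing straddling \<open>y\<close>, the spacings shorter than \<open>\<eta>\<close>, the factor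
  \<open>\<kappa>\<close>, and the rounding by \<open>b\<close> in each block.\<close>

lemma counts_uniform:
  assumes y: "0 < y" "y \<le> 1" and \<epsilon>: "0 < \<epsilon>"
  shows "whp S (\<lambda>n \<omega>. \<bar>real (count_in (frag_state b \<omega> n) y) / spacing_number n - y\<bar> \<le> \<epsilon>)"
proof (rule P.whp_local)
  fix \<delta> :: real assume "0 < \<delta>"
  \<comment> \<open>The bound \<open>\<theta> \<le> c * \<epsilon> / 8\<close> gives
    \<open>1 - \<epsilon> / 4 \<le> \<kappa>\<close>; the minimum with 1 ensures
    \<open>\<theta> < c\<close>.\<close>
  define \<theta> where "\<theta> = c * min 1 \<epsilon> / 8"
  define \<kappa> where "\<kappa> = (c - \<theta>) / (c + \<theta>)"
  have "min 1 \<epsilon> / 8 < 1" by linarith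
  then have "c * (min 1 \<epsilon> / 8) < c * 1" using c by (intro mult_strict_left_mono)
  then have \<theta>: "0 < \<theta>" "\<theta> < c" using c \<epsilon> by (simp_all add: \<theta>_def)
  have "\<theta> * 8 \<le> c * \<epsilon>" unfolding \<theta>_def using c by (simp add: mult_left_mono)
  moreover have "(1 - \<epsilon> / 4) * (c + \<theta>) = c + \<theta> - c * \<epsilon> / 4 - \<epsilon> * \<theta> / 4"
    by (simp add: algebra_simps)
  moreover have "0 < \<epsilon> * \<theta>" using \<epsilon> \<theta>(1) by simp
  ultimately have "(1 - \<epsilon> / 4) * (c + \<theta>) \<le> c - \<theta>" by linarith
  then have \<kappa>: "0 < \<kappa>" "1 - \<epsilon> / 4 \<le> \<kappa>" "\<kappa> \<le> 1"
    unfolding \<kappa>_def using \<theta> c by (simp_all add: pos_le_divide_eq)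
  have \<epsilon>4: "0 < \<epsilon> / 4" using \<epsilon> by simp
  obtain m A where A: "A \<in> sets S" "P.prob A \<ge> 1 - \<delta>" "\<forall>\<omega>\<in>A. largest b \<omega> m \<le> \<epsilon> / 4"
    using largest_tendsto_0[OF \<epsilon>4] \<open>0 < \<delta>\<close> unfolding whp_def by blast
  define J where "J = Suc (m * (b - 1))"
  define \<eta> where "\<eta> = \<epsilon> / (4 * real J)"
  have J: "0 < real J" by (simp add: J_def del: of_nat_Suc)
  have \<eta>: "0 < \<eta>" "real J * \<eta> = \<epsilon> / 4" using \<epsilon> J by (simp_all add: \<eta>_def)
  have lengths: "whp S (\<lambda>n \<omega>. \<forall>i\<in>{..<J}. \<not> (\<eta> \<le> frag_state b \<omega> m ! i
    \<and> real (length (blocks m \<omega> n ! i)) \<le> \<kappa> * spacing_number (m + n) * (frag_state b \<omega> m ! i) - real b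
    \<and> Max (set (concat (blocks m \<omega> n))) \<le> 1 / ((c - \<theta>) * spacing_number (m + n))))"
    unfolding \<kappa>_def J_def by (intro P.whp_ball_finite block_lengths \<theta> \<eta>(1)) auto
  have "filterlim (\<lambda>n. m + n) at_top sequentially"
    by (rule filterlim_at_top_mono[OF filterlim_ident]) (auto intro: always_eventually)
  note large = whp_subseq[OF conv[OF \<theta>(1)] this]
  obtain n0 :: nat where n0: "4 * (real J * real b) / \<epsilon> < real n0" using reals_Archimedean2 by blast
  have "whp S (\<lambda>n \<omega>. \<omega> \<in> A \<longrightarrow> \<bar>real (count_in (frag_state b \<omega> (m + n)) y) / spacing_number (m + n) - y\<bar> \<le> \<epsilon>)"
  proof (rule P.whp_eventually_combine[OF P.whp_conj[OF lengths large] P.whp_AE[OF AE_valid]])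
    show "\<forall>\<^sub>F n in sequentially. \<forall>\<omega>. (\<forall>i\<in>{..<J}. \<not> (\<eta> \<le> frag_state b \<omega> m ! i
        \<and> real (length (blocks m \<omega> n ! i)) \<le> \<kappa> * spacing_number (m + n) * (frag_state b \<omega> m ! i) - real b
        \<and> Max (set (concat (blocks m \<omega> n))) \<le> 1 / ((c - \<theta>) * spacing_number (m + n))))
      \<and> \<bar>1 / (largest b \<omega> (m + n) * spacing_number (m + n)) - c\<bar> \<le> \<theta> \<longrightarrow>
      (\<forall>k. valid_division b (\<omega> k)) \<longrightarrow>
      (\<omega> \<in> A \<longrightarrow> \<bar>real (count_in (frag_state b \<omega> (m + n)) y) / spacing_number (m + n) - y\<bar> \<le> \<epsilon>)"
      using eventually_ge_at_top[of n0]
    proof eventually_elim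
      case (elim n)
      show ?case
      proof (intro allI impI, elim conjE)
        fix \<omega> assume long: "\<forall>i\<in>{..<J}. \<not> (\<eta> \<le> frag_state b \<omega> m ! i
            \<and> real (length (blocks m \<omega> n ! i)) \<le> \<kappa> * spacing_number (m + n) * (frag_state b \<omega> m ! i) - real b
            \<and> Max (set (concat (blocks m \<omega> n))) \<le> 1 / ((c - \<theta>) * spacing_number (m + n)))"
          and r: "\<bar>1 / (largest b \<omega> (m + n) * spacing_number (m + n)) - c\<bar> \<le> \<theta>"
          and valid: "\<forall>k. valid_division b (\<omega> k)" and "\<omega> \<in> A"
        let ?s = "frag_state b \<omega> m"
        let ?B = "blocks m \<omega> n"
        define N where "N = spacing_number (m + n)"
        define K where "K = \<kappa> * N"
        have N: "0 < N" "real n0 \<le> N"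
          using spacing_number_pos[of "m + n"] spacing_number_ge[of "m + n"] elim unfolding N_def by auto
        have K: "0 \<le> K" using \<kappa> N by (simp add: K_def)
        have len: "length ?s = J" unfolding J_def by (rule length_frag_state[OF b1])
        have "map (\<lambda>z. [z]) ?s \<noteq> []" using len J by auto
        then have proper: "proper_blocks (map (\<lambda>z. [z]) ?s)"
          using frag_state_nonneg[OF b1, of \<omega>] valid by (auto simp: proper_blocks_def)
        have "concat ?B = run b (concat (map (\<lambda>z. [z]) ?s)) (\<lambda>k. \<omega> (m + k)) n"
          unfolding blocks_def using valid by (intro concat_run_blocks b1 proper) auto
        then have concat: "concat ?B = frag_state b \<omega> (m + n)"
          unfolding frag_state_eq_run by (simp add: run_add concat_map_singleton)
        have lenB: "length ?B = J" by (simp add: blocks_def len)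
        have sums: "map sum_list ?B = ?s"
        proof (rule nth_equalityI)
          fix i assume "i < length (map sum_list ?B)"
          then have i: "i < length ?s" by (simp add: lenB len)
          then have "sum_list (?B ! i) = sum_list (map (\<lambda>z. [z]) ?s ! i)"
            unfolding blocks_def using valid by (intro sum_list_run_blocks_nth b1 proper) auto
          then show "map sum_list ?B ! i = ?s ! i" using i by (simp add: lenB len)
        qed (simp add: lenB len)
        \<comment> \<open>With the mesh condition secured, the negated conjunction in
          \<open>long\<close> leaves only one possibility for a spacing of length at least
          \<open>\<eta>\<close>: its block is long.\<close>
        have mesh: "Max (set (concat ?B)) \<le> 1 / ((c - \<theta>) * spacing_number (m + n))"
          using largest_bounds(1)[OF r \<theta>] unfolding concat largest_def .
        have all2: "list_all2 (\<lambda>z t. K * (z - \<eta>) - real b \<le> real (length t)) ?s ?B"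
        proof (rule list_all2_all_nthI)
          fix i assume i: "i < length ?s"
          show "K * (?s ! i - \<eta>) - real b \<le> real (length (?B ! i))"
          proof (cases "\<eta> \<le> ?s ! i")
            case True
            then have "K * (?s ! i) - real b < real (length (?B ! i))"
              using bspec[OF long, of i] mesh i unfolding K_def N_def len lessThan_iff not_le[symmetric]
              by blast
            moreover have "K * (?s ! i - \<eta>) \<le> K * (?s ! i)"
              using K \<eta> by (intro mult_left_mono) auto
            ultimately show ?thesis by linarith
          next
            case False
            then have "K * (?s ! i - \<eta>) \<le> 0" using K by (intro mult_nonneg_nonpos) auto
            then show ?thesis by linarith
          qed
        qed (simp add: len lenB)
        have nonneg: "\<forall>x\<in>set (concat ?B). 0 \<le> x"
          unfolding concat using frag_state_nonneg[OF b1, of \<omega>] valid by blast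
        have small: "\<forall>z\<in>set ?s. 0 \<le> z \<and> z \<le> \<epsilon> / 4"
          using frag_state_nonneg[OF b1, of \<omega>] valid frag_state_le_largest[of _ b \<omega> m] A(3) \<open>\<omega> \<in> A\<close>
          by (meson order_trans)
        define C where "C = real (count_in (frag_state b \<omega> (m + n)) y)"
        note bounds = count_in_concat_bounds[OF nonneg sums sum_list_frag_state[OF b1] small
            less_imp_le[OF y(1)] y(2) K less_imp_le[OF \<eta>(1)] _ less_imp_le[OF \<epsilon>4] all2]
        have total: "real (length (concat ?B)) = N"
          unfolding concat length_frag_state[OF b1] N_def spacing_number_def ..
        have Jb: "real J * real b \<le> \<epsilon> / 4 * N"
        proof -
          have "4 * (real J * real b) / \<epsilon> \<le> N" using n0 N by linarith
          then show ?thesis using \<epsilon> by (simp add: pos_divide_le_eq mult_ac)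
        qed
        have lower: "\<kappa> * N * (y - \<epsilon> / 4 - \<epsilon> / 4) - real J * real b \<le> C"
          using bounds(1) unfolding len \<eta>(2) concat C_def K_def by simp
        \<comment> \<open>The lower bound for the spacings beyond \<open>y\<close> acts as an upper
          bound for \<open>C\<close>, since the total is exactly \<open>N\<close>.\<close>
        have upper: "\<kappa> * N * (1 - y - \<epsilon> / 4 - \<epsilon> / 4) - real J * real b \<le> N - C"
          using bounds(2) unfolding len \<eta>(2) total unfolding concat C_def K_def by simp
        have shrink: "(t - \<epsilon> / 4) * N \<le> \<kappa> * N * t" if "t \<le> 1" for t
        proof -
          have "(1 - \<kappa>) * t \<le> (1 - \<kappa>) * 1" using \<kappa> that by (intro mult_left_mono) auto
          then have "t - \<epsilon> / 4 \<le> \<kappa> * t" using \<kappa>(2) by (simp add: algebra_simps)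
          then have "(t - \<epsilon> / 4) * N \<le> (\<kappa> * t) * N" using N by (intro mult_right_mono) auto
          then show ?thesis by (simp add: mult_ac)
        qed
        have "(y - \<epsilon> / 4 - \<epsilon> / 4 - \<epsilon> / 4) * N \<le> C + \<epsilon> / 4 * N"
          using shrink[of "y - \<epsilon> / 4 - \<epsilon> / 4"] lower Jb y \<epsilon> by linarith
        moreover have "(1 - y - \<epsilon> / 4 - \<epsilon> / 4 - \<epsilon> / 4) * N \<le> N - C + \<epsilon> / 4 * N"
          using shrink[of "1 - y - \<epsilon> / 4 - \<epsilon> / 4"] upper Jb y \<epsilon> by linarith
        ultimately have "\<bar>C - y * N\<bar> \<le> \<epsilon> * N"
          unfolding abs_le_iff by (simp add: algebra_simps)
        moreover have "\<bar>C / N - y\<bar> * N = \<bar>C - y * N\<bar>"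
          unfolding abs_diff_mult_right[OF N(1)] using N by simp
        ultimately have "\<bar>C / N - y\<bar> * N \<le> \<epsilon> * N" by simp
        then show "\<bar>real (count_in (frag_state b \<omega> (m + n)) y) / spacing_number (m + n) - y\<bar> \<le> \<epsilon>"
          unfolding C_def[symmetric] N_def[symmetric] using N(1) by (rule mult_right_le_imp_le)
      qed
    qed
  qed
  from whp_offset[of S "\<lambda>n \<omega>. \<omega> \<in> A \<longrightarrow> \<bar>real (count_in (frag_state b \<omega> n) y) / spacing_number n - y\<bar> \<le> \<epsilon>", OF this]
  show "\<exists>A\<in>sets S. P.prob A \<ge> 1 - \<delta> \<and>
      whp S (\<lambda>n \<omega>. \<omega> \<in> A \<longrightarrow> \<bar>real (count_in (frag_state b \<omega> n) y) / spacing_number n - y\<bar> \<le> \<epsilon>)"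
    using A(1,2) by blast
qed

text \<open>\<open>mean_spacing\<close> is \<open>y * r / q\<close> with
  \<open>r = 1 / (L_n N_n)\<close> tending to \<open>c\<close> and the proportion \<open>q\<close>
  of spacings left of \<open>y\<close> tending to \<open>y\<close>, so the limit is \<open>c\<close>
  for every \<open>y\<close>.\<close>

lemma mean_stationary: "mean_stationary b S"
  unfolding mean_stationary_def
proof (intro exI[of _ c] ballI allI impI)
  fix y \<epsilon> :: real assume y: "y \<in> {0<..1}" and \<epsilon>: "0 < \<epsilon>"
  \<comment> \<open>The bound \<open>y / 2\<close> keeps \<open>q\<close> away from 0; the other one
    makes \<open>\<delta> * (1 + c) \<le> \<epsilon> * (y / 2)\<close>, which is what remains to be
    shown once the error is multiplied by \<open>q\<close>.\<close>
  define \<delta> where "\<delta> = min (y / 2) (\<epsilon> * y / (2 * (1 + c)))"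
  have "0 < \<epsilon> * y / (2 * (1 + c))" using y \<epsilon> c by simp
  then have \<delta>: "0 < \<delta>" "\<delta> \<le> y / 2" "\<delta> \<le> \<epsilon> * y / (2 * (1 + c))"
    using y unfolding \<delta>_def min_less_iff_conj by (simp_all only: min.cobounded1 min.cobounded2) auto
  then have \<delta>': "\<delta> * (1 + c) \<le> \<epsilon> * (y / 2)" using c by (simp add: pos_le_divide_eq mult_ac)
  have "whp S (\<lambda>n \<omega>. \<bar>1 / (largest b \<omega> n * spacing_number n) - c\<bar> \<le> \<delta>
    \<and> \<bar>real (count_in (frag_state b \<omega> n) y) / spacing_number n - y\<bar> \<le> \<delta>)"
    using y \<delta>(1) by (intro P.whp_conj conv counts_uniform) auto
  then show "whp S (\<lambda>n \<omega>. \<bar>mean_spacing b \<omega> n y - c\<bar> \<le> \<epsilon>)"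
  proof (rule P.whp_mono, elim conjE)
    fix n \<omega>
    define r where "r = 1 / (largest b \<omega> n * spacing_number n)"
    define q where "q = real (count_in (frag_state b \<omega> n) y) / spacing_number n"
    assume "\<bar>1 / (largest b \<omega> n * spacing_number n) - c\<bar> \<le> \<delta>"
      "\<bar>real (count_in (frag_state b \<omega> n) y) / spacing_number n - y\<bar> \<le> \<delta>"
    then have rq: "\<bar>r - c\<bar> \<le> \<delta>" "\<bar>q - y\<bar> \<le> \<delta>" by (simp_all add: r_def q_def)
    have q: "y / 2 \<le> q" using rq(2) \<delta>(2) by linarith
    then have q0: "0 < q" using y by simp
    have "mean_spacing b \<omega> n y = y * r / q"
      unfolding mean_spacing_def r_def q_def using spacing_number_pos[of n] by simp
    then have "\<bar>mean_spacing b \<omega> n y - c\<bar> * q = \<bar>y * (r - c) - c * (q - y)\<bar>"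
      unfolding abs_diff_mult_right[OF q0] using q0 by (simp add: algebra_simps)
    also have "\<dots> \<le> \<bar>y * (r - c)\<bar> + \<bar>c * (q - y)\<bar>" by (rule abs_triangle_ineq4)
    also have "\<dots> \<le> 1 * \<delta> + c * \<delta>"
      unfolding abs_mult using y c rq \<delta>(1) by (intro add_mono mult_mono) auto
    also have "\<dots> \<le> \<epsilon> * (y / 2)" using \<delta>' by (simp add: algebra_simps)
    also have "\<dots> \<le> \<epsilon> * q" using q \<epsilon> by (intro mult_left_mono) auto
    finally show "\<bar>mean_spacing b \<omega> n y - c\<bar> \<le> \<epsilon>" using q0 by (rule mult_right_le_imp_le)
  qed
qed

end

lemma (in fragmentation) spacing_stationary_imp_mean_stationary:
  assumes "spacing_stationary b S"
  shows "mean_stationary b S"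
proof -
  obtain c where conv: "\<And>\<epsilon>. 0 < \<epsilon> \<Longrightarrow>
    whp S (\<lambda>n \<omega>. \<bar>1 / (largest b \<omega> n * real (Suc (n * (b - 1)))) - c\<bar> \<le> \<epsilon>)"
    using spacing_stationary_imp_mean_converges[OF assms] by blast
  interpret convergent_fragmentation b D c
    by unfold_locales (use limit_positive[OF conv] conv in \<open>simp_all only: spacing_number_def\<close>)
  show ?thesis by (rule mean_stationary)
qed

theorem theorem3:
  fixes b :: nat and D :: "(nat \<Rightarrow> real) measure"
  assumes b: "b \<ge> 2"
    and D_prob: "prob_space D"
    and D_sets: "sets D = sets (PiM {..<b - 1} (\<lambda>_. borel))"
    and D_unit: "AE v in D. \<forall>i<b - 1. v i \<in> {0<..<1}"
    and F_uc: "uniformly_continuous_on {0<..<1} (exp_pieces b D)"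
    and F_diff: "\<forall>x\<in>{0<..<1}. exp_pieces b D differentiable (at x)"
    and F'_pos: "\<exists>c>0. \<forall>x\<in>{0<..<1}. deriv (exp_pieces b D) x \<ge> c"
  shows "spacing_stationary b (PiM UNIV (\<lambda>_::nat. D)) \<longleftrightarrow>
         mean_stationary b (PiM UNIV (\<lambda>_::nat. D))"
proof -
  interpret fragmentation b D
    unfolding fragmentation_def valid_division_def by (intro conjI b D_prob D_sets D_unit)
  show ?thesis
    using spacing_stationary_imp_mean_stationary
      mean_stationary_imp_spacing_stationary[OF uniformly_continuous_imp_continuous[OF F_uc]]
    by blast
qed

end
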